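(* Let $N\ge2$ and let $W\in C^2((-\infty,1])$ satisfy $W(0)=0$ and $W\ge0$. Then for every $\varepsilon>0$ the problem $f''+\frac{N-1}rf'-\frac{N-1}{r^2}f=-\frac1{\varepsilon^2}W'(1-f^2)f$ in $(0,1)$, $f(1)=1$, has a solution $f_\varepsilon$ such that $f_\varepsilon/r$ extends to a function in $C^2([0,1])$, $0<f_\varepsilon<1$ in $(0,1)$ and $f_\varepsilon(0)=0$. If in addition $W''\ge0$ on $(-\infty,1]\setminus\{0\}$, then $f_\varepsilon'>0$ in $(0,1]$ and $f_\varepsilon$ is the unique solution of this problem with $f(|x|)\frac{x}{|x|}\in H^1(B^N,\mathbb R^N)$; in particular $f_\varepsilon$ is the unique minimizer of $I^{GL}_\varepsilon$ in $\mathcal B^{GL}$.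
   Context: $B^N$ is the open unit ball of $\mathbb R^N$, $r=|x|$. $I^{GL}_\varepsilon[f]=\frac12\int_0^1\big[(f')^2+\frac{N-1}{r^2}f^2+\frac1{\varepsilon^2}W(1-f^2)\big]r^{N-1}dr$ on $\mathcal B^{GL}=\{f: r^{\frac{N-1}2}f',\ r^{\frac{N-3}2}f\in L^2(0,1),\ f(1)=1\}$. *)

theory Defs
  imports "HOL-Analysis.Analysis"
begin

definition L2_on :: "'a::euclidean_space set \<Rightarrow> ('a \<Rightarrow> real) \<Rightarrow> bool" where
  "L2_on U h \<longleftrightarrow> h \<in> borel_measurable (lebesgue_on U)
      \<and> integrable (lebesgue_on U) (\<lambda>x. (h x)^2)"

definition test_fun1 :: "real set \<Rightarrow> (real \<Rightarrow> real) \<Rightarrow> bool" where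
  "test_fun1 U \<phi> \<longleftrightarrow> (\<forall>x. \<phi> differentiable (at x)) \<and> continuous_on UNIV (deriv \<phi>)
      \<and> compact (closure {x. \<phi> x \<noteq> 0}) \<and> closure {x. \<phi> x \<noteq> 0} \<subseteq> U"

definition weak_deriv1 :: "real set \<Rightarrow> (real \<Rightarrow> real) \<Rightarrow> (real \<Rightarrow> real) \<Rightarrow> bool" where
  "weak_deriv1 U f g \<longleftrightarrow> (\<forall>\<phi>. test_fun1 U \<phi> \<longrightarrow>
      integrable (lebesgue_on U) (\<lambda>x. f x * deriv \<phi> x)
    \<and> integrable (lebesgue_on U) (\<lambda>x. g x * \<phi> x)
    \<and> integral\<^sup>L (lebesgue_on U) (\<lambda>x. f x * deriv \<phi> x)
        = - integral\<^sup>L (lebesgue_on U) (\<lambda>x. g x * \<phi> x))"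

definition test_fun :: "(real^'n) set \<Rightarrow> (real^'n \<Rightarrow> real) \<Rightarrow> bool" where
  "test_fun U \<phi> \<longleftrightarrow> (\<forall>x. \<phi> differentiable (at x))
      \<and> (\<forall>j. continuous_on UNIV (\<lambda>x. frechet_derivative \<phi> (at x) (axis j 1)))
      \<and> compact (closure {x. \<phi> x \<noteq> 0}) \<and> closure {x. \<phi> x \<noteq> 0} \<subseteq> U"

definition weak_partial :: "(real^'n) set \<Rightarrow> 'n \<Rightarrow> (real^'n \<Rightarrow> real) \<Rightarrow> (real^'n \<Rightarrow> real) \<Rightarrow> bool" where
  "weak_partial U j u g \<longleftrightarrow> (\<forall>\<phi>. test_fun U \<phi> \<longrightarrow>
      integrable (lebesgue_on U) (\<lambda>x. u x * frechet_derivative \<phi> (at x) (axis j 1))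
    \<and> integrable (lebesgue_on U) (\<lambda>x. g x * \<phi> x)
    \<and> integral\<^sup>L (lebesgue_on U) (\<lambda>x. u x * frechet_derivative \<phi> (at x) (axis j 1))
        = - integral\<^sup>L (lebesgue_on U) (\<lambda>x. g x * \<phi> x))"

definition H1_scalar :: "(real^'n) set \<Rightarrow> (real^'n \<Rightarrow> real) \<Rightarrow> bool" where
  "H1_scalar U u \<longleftrightarrow> L2_on U u \<and> (\<forall>j. \<exists>g. L2_on U g \<and> weak_partial U j u g)"

definition H1_vec :: "(real^'n) set \<Rightarrow> (real^'n \<Rightarrow> real^'m) \<Rightarrow> bool" where
  "H1_vec U u \<longleftrightarrow> (\<forall>i. H1_scalar U (\<lambda>x. u x $ i))"

definition C2_on :: "real set \<Rightarrow> (real \<Rightarrow> real) \<Rightarrow> bool" where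
  "C2_on S g \<longleftrightarrow> (\<exists>g1 g2. (\<forall>x\<in>S. (g has_real_derivative g1 x) (at x within S)
      \<and> (g1 has_real_derivative g2 x) (at x within S)) \<and> continuous_on S g2)"

definition GL_solution :: "nat \<Rightarrow> (real \<Rightarrow> real) \<Rightarrow> real \<Rightarrow> (real \<Rightarrow> real) \<Rightarrow> bool" where
  "GL_solution N W' \<epsilon> f \<longleftrightarrow> continuous_on {0<..1} f \<and> f 1 = 1 \<and>
     (\<exists>f1 f2. \<forall>r\<in>{0<..<1}. (f has_real_derivative f1 r) (at r)
        \<and> (f1 has_real_derivative f2 r) (at r)
        \<and> f2 r + (real N - 1) / r * f1 r - (real N - 1) / r^2 * f r
            = - 1 / \<epsilon>^2 * W' (1 - (f r)^2) * f r)"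

definition B_GL :: "nat \<Rightarrow> (real \<Rightarrow> real) set" where
  "B_GL N = {f. continuous_on {0<..1} f \<and> f 1 = 1 \<and>
     (\<exists>f'. weak_deriv1 {0<..<1} f f'
        \<and> L2_on {0<..<1} (\<lambda>r. r powr ((real N - 1) / 2) * f' r)
        \<and> L2_on {0<..<1} (\<lambda>r. r powr ((real N - 3) / 2) * f r))}"

definition I_GL :: "nat \<Rightarrow> (real \<Rightarrow> real) \<Rightarrow> real \<Rightarrow> (real \<Rightarrow> real) \<Rightarrow> ennreal" where
  "I_GL N W \<epsilon> f = (let f' = (SOME g. weak_deriv1 {0<..<1} f g) in
     ennreal (1/2) * set_nn_integral lborel {0<..<1} (\<lambda>r. ennreal
       (((f' r)^2 + (real N - 1) / r^2 * (f r)^2 + 1 / \<epsilon>^2 * W (1 - (f r)^2)) * r ^ (N - 1))))"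

end

theory Submission
  imports Defs
begin

text \<open>
  Write \<open>f = r g\<close>. Then \<open>g\<close> is a radial solution in dimension \<open>N + 2\<close> of an equation without
  singular potential, and for every \<open>a\<close> there is exactly one regular solution with \<open>g(0) = a\<close>.
  Existence is a shooting argument: the least \<open>a\<close> for which \<open>f\<close> reaches the value 1 on \<open>[0,1]\<close> while
  staying positive reaches it exactly at \<open>r = 1\<close>, because 1 cannot be touched from below
  (\<open>f'' = (N-1)/r\<^sup>2 > 0\<close> at such a point).

  If \<open>W\<close> is convex, an energy identity shows that \<open>\<bar>h\<bar>\<close> has no interior local maximum for any
  solution \<open>h\<close> with \<open>\<bar>h(1)\<bar> = 1\<close>. Near 0 a solution is either \<open>O(r)\<close> or at least \<open>c r\<^bsup>1-N\<^esup>\<close>, and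
  the latter is not square integrable on the ball. So solutions in \<open>H\<^sup>1\<close> are positive and increasing,
  and a Wronskian comparison shows that two of them agree. For the minimisation, convexity of \<open>W\<close>
  and the substitution \<open>h = f w\<close> give \<open>I(h) - I(f) \<ge> (1/2) \<integral> r\<^bsup>N-1\<^esup> (h' - h f'/f)\<^sup>2 dr\<close>.
\<close>

text \<open>Throughout n = N - 1, \<open>q y\<close> stands for W'(1 - y^2) / \<epsilon>^2 and
  \<open>U y\<close> for W(1 - y^2) / (2 \<epsilon>^2), so the equation is f'' + n f' / r - n f /
  r^2 = - q(f) f. The function r solves the linear part, which is why f = r g removes the singular
  potential. For existence, W \<ge> 0 = W(0) enters through q(1) = 0: it allows a continuous cutoff
  of q outside [-1, 1], hence a global Lipschitz constant, and it decides the sign of f'' where f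
  would touch 1. Convexity of W says that q is antitone on [0, infinity). So q \<le> 0 beyond 1, the
  Wronskian of two positive solutions is monotone where they are ordered, and U, as a function of
  y^2, lies above its tangents. The tangent bound reduces the energy difference to the quadratic
  form with potential n / r^2 - q(f), for which f is a positive null solution; its Riccati function
  r^n f' / f completes the square. The price is a boundary term at 0, which finite energy makes
  small only along suitable radii. Competitors have only weak derivatives, so the fundamental
  theorem and the product rule are needed in that generality.\<close>

section \<open>Regular radial solutions\<close>

text \<open>For r > 0 this is r^(-m-1) times the integral of t^m \<phi>(t) over [0, r]; rescaling to
  a fixed interval keeps it meaningful and continuous at r = 0. A regular solution of g'' + m g' / r
  = - \<phi> has g' = - r times this mean.\<close>

definition radial_mean :: "nat \<Rightarrow> (real \<Rightarrow> real) \<Rightarrow> real \<Rightarrow> real" where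
  "radial_mean m \<phi> r = integral {0..1} (\<lambda>t. t ^ m * \<phi> (r * t))"

lemma continuous_on_radial_mean:
  assumes "continuous_on UNIV \<phi>"
  shows "continuous_on S (radial_mean m \<phi>)"
proof -
  have "continuous_on (UNIV \<times> cbox 0 1) (\<lambda>(r, t). t ^ m * \<phi> (r * t))"
    unfolding split_def
    by (intro continuous_intros continuous_on_compose2[OF assms]) auto
  then have "continuous_on UNIV (\<lambda>r. integral (cbox 0 1) (\<lambda>t. t ^ m * \<phi> (r * t)))"
    by (rule integral_continuous_on_param)
  then show ?thesis
    unfolding radial_mean_def box_real by (rule continuous_on_subset) simp
qed

lemma radial_mean_integrable:
  fixes \<phi> :: "real \<Rightarrow> real"
  assumes "continuous_on UNIV \<phi>"
  shows "(\<lambda>t. t ^ m * \<phi> (r * t)) integrable_on {0..1::real}"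
  by (intro integrable_continuous_real continuous_intros continuous_on_compose2[OF assms]) auto

lemma radial_mean_diff_le:
  assumes \<phi>: "continuous_on UNIV \<phi>" and \<psi>: "continuous_on UNIV \<psi>" and "0 \<le> r"
    and le: "\<And>t. 0 \<le> t \<Longrightarrow> t \<le> r \<Longrightarrow> \<bar>\<phi> t - \<psi> t\<bar> \<le> B"
  shows "\<bar>radial_mean m \<phi> r - radial_mean m \<psi> r\<bar> \<le> B"
proof -
  have B: "0 \<le> B" using le[of 0] \<open>0 \<le> r\<close> by simp
  have "radial_mean m \<phi> r - radial_mean m \<psi> r
      = integral {0..1} (\<lambda>t. t ^ m * \<phi> (r * t) - t ^ m * \<psi> (r * t))"
    unfolding radial_mean_def
    by (rule integral_diff[symmetric]) (intro radial_mean_integrable \<phi> \<psi>)+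
  moreover have "norm (integral {0..1} (\<lambda>t. t ^ m * \<phi> (r * t) - t ^ m * \<psi> (r * t))) \<le> B * (1 - 0)"
  proof (rule integral_bound)
    show "continuous_on {0..1} (\<lambda>t. t ^ m * \<phi> (r * t) - t ^ m * \<psi> (r * t))"
      by (intro continuous_intros continuous_on_compose2[OF \<phi>] continuous_on_compose2[OF \<psi>]) auto
    fix t :: real assume t: "t \<in> {0..1}"
    have "\<bar>\<phi> (r * t) - \<psi> (r * t)\<bar> \<le> B"
      using t \<open>0 \<le> r\<close> by (intro le) (auto intro: mult_left_le)
    moreover have "t ^ m \<le> 1" "0 \<le> t ^ m" using t by (auto intro: power_le_one)
    ultimately have "t ^ m * \<bar>\<phi> (r * t) - \<psi> (r * t)\<bar> \<le> 1 * B"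
      using B by (intro mult_mono) auto
    moreover have "t ^ m * \<phi> (r * t) - t ^ m * \<psi> (r * t) = t ^ m * (\<phi> (r * t) - \<psi> (r * t))"
      by (rule right_diff_distrib[symmetric])
    ultimately show "norm (t ^ m * \<phi> (r * t) - t ^ m * \<psi> (r * t)) \<le> B"
      using \<open>0 \<le> t ^ m\<close> by (simp add: abs_mult)
  qed simp
  ultimately show ?thesis by simp
qed

lemma radial_mean_zero: "radial_mean m (\<lambda>_. 0) r = 0"
  by (simp add: radial_mean_def)

lemma radial_mean_at_0: "radial_mean m \<phi> 0 = \<phi> 0 / (real m + 1)"
proof -
  have "((\<lambda>t. t ^ m) has_integral (1 ^ Suc m / real (Suc m) - 0 ^ Suc m / real (Suc m))) {0..1::real}"
  proof (rule fundamental_theorem_of_calculus)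
    fix x :: real
    have "((\<lambda>t. t ^ Suc m) has_real_derivative real (Suc m) * x ^ m) (at x within {0..1})"
      using DERIV_power[OF DERIV_ident[of "at x within {0..1}"], of "Suc m"] by (simp add: algebra_simps)
    then have "((\<lambda>t. t ^ Suc m / real (Suc m)) has_real_derivative real (Suc m) * x ^ m / real (Suc m))
        (at x within {0..1})"
      by (rule DERIV_cdivide)
    then show "((\<lambda>t. t ^ Suc m / real (Suc m)) has_vector_derivative x ^ m) (at x within {0..1})"
      unfolding has_real_derivative_iff_has_vector_derivative[symmetric]
      by (simp del: of_nat_Suc power_Suc)
  qed simp
  from has_integral_mult_left[OF this, of "\<phi> 0"]
  have "((\<lambda>t. t ^ m * \<phi> 0) has_integral (1 / (real m + 1) * \<phi> 0)) {0..1::real}"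
    by (simp add: add.commute)
  then show ?thesis
    unfolding radial_mean_def by (simp only: mult_zero_left integral_unique) simp
qed

lemma radial_mean_scale:
  assumes \<phi>: "continuous_on UNIV \<phi>" and r: "0 < r"
  shows "r ^ Suc m * radial_mean m \<phi> r = integral {0..r} (\<lambda>t. t ^ m * \<phi> t)"
proof -
  have int: "((\<lambda>t. t ^ m * \<phi> t) has_integral integral {0..r} (\<lambda>t. t ^ m * \<phi> t)) (cbox 0 r)"
    by (auto intro!: integrable_integral integrable_continuous_real continuous_intros
        continuous_on_subset[OF \<phi>])
  have "((\<lambda>t. (r * t) ^ m * \<phi> (r * t)) has_integral (integral {0..r} (\<lambda>t. t ^ m * \<phi> t) / r)) {0..1}"
    using has_integral_affinity'[OF int r, of 0] r by (simp add: field_simps)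
  then have "((\<lambda>t. r ^ m * (t ^ m * \<phi> (r * t))) has_integral (integral {0..r} (\<lambda>t. t ^ m * \<phi> t) / r)) {0..1}"
    by (simp add: power_mult_distrib mult.assoc)
  moreover have "((\<lambda>t. r ^ m * (t ^ m * \<phi> (r * t))) has_integral r ^ m * radial_mean m \<phi> r) {0..1}"
    unfolding radial_mean_def
    by (intro has_integral_mult_right integrable_integral radial_mean_integrable \<phi>)
  ultimately have "r ^ m * radial_mean m \<phi> r = integral {0..r} (\<lambda>t. t ^ m * \<phi> t) / r"
    by (rule has_integral_unique[symmetric])
  then show ?thesis using r by (simp add: field_simps)
qed

text \<open>Away from 0 this is the quotient rule for the integral divided by r^m. At 0 the
  difference quotient is the mean itself, so continuity of the mean suffices, and
  \<open>radial_mean_at_0\<close> makes the two formulas agree. It gives the second derivative of a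
  regular solution up to the origin.\<close>

lemma has_real_derivative_mult_radial_mean:
  assumes \<phi>: "continuous_on UNIV \<phi>" and r: "r \<in> {0..1}"
  shows "((\<lambda>r. r * radial_mean m \<phi> r) has_real_derivative \<phi> r - real m * radial_mean m \<phi> r)
    (at r within {0..1})"
proof (cases "r = 0")
  case True
  have "(radial_mean m \<phi> \<longlongrightarrow> radial_mean m \<phi> 0) (at 0 within {0..1})"
    using continuous_on_radial_mean[OF \<phi>, of "{0..1}" m] by (auto simp: continuous_on_def)
  then have "((\<lambda>y. (y * radial_mean m \<phi> y - 0) / (y - 0)) \<longlongrightarrow> radial_mean m \<phi> 0) (at 0 within {0..1})"
    by (rule Lim_transform_eventually) (auto simp: eventually_at_filter)
  moreover have "\<phi> 0 - real m * radial_mean m \<phi> 0 = radial_mean m \<phi> 0"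
    by (simp add: radial_mean_at_0 field_simps)
  ultimately show ?thesis
    using True by (simp add: has_field_derivative_iff)
next
  case False
  with r have r0: "0 < r" "r \<le> 1" by auto
  let ?I = "\<lambda>r. integral {0..r} (\<lambda>t. t ^ m * \<phi> t)"
  have I: "(?I has_real_derivative r ^ m * \<phi> r) (at r within {0..1})"
    by (rule integral_has_real_derivative)
      (use r in \<open>auto intro!: continuous_intros continuous_on_subset[OF \<phi>]\<close>)
  have "((\<lambda>r. ?I r / r ^ m) has_real_derivative
      (r ^ m * \<phi> r * r ^ m - ?I r * (real m * r ^ (m - 1))) / (r ^ m * r ^ m)) (at r within {0..1})"
    using r0 by (auto intro!: derivative_eq_intros I)
  also have "(r ^ m * \<phi> r * r ^ m - ?I r * (real m * r ^ (m - 1))) / (r ^ m * r ^ m)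
      = \<phi> r - real m * radial_mean m \<phi> r"
    unfolding radial_mean_scale[OF \<phi> r0(1), symmetric]
    using r0 by (cases m) (auto simp: field_simps)
  finally show ?thesis
  proof (rule has_field_derivative_transform_within[where d = r])
    fix x assume "x \<in> {0..1}" "dist x r < r"
    then have "0 < x" by (auto simp: dist_real_def)
    then show "?I x / x ^ m = x * radial_mean m \<phi> x"
      unfolding radial_mean_scale[OF \<phi> \<open>0 < x\<close>, symmetric] by simp
  qed (use r r0 in auto)
qed

section \<open>The initial value problem at the singular point as a fixed point\<close>

definition unit_clamp :: "real \<Rightarrow> real" where "unit_clamp x = max 0 (min 1 x)"

lemma unit_clamp [simp]: "0 \<le> unit_clamp x" "unit_clamp x \<le> 1" "x \<in> {0..1} \<Longrightarrow> unit_clamp x = x"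
  by (auto simp: unit_clamp_def)

lemma continuous_on_unit_clamp: "continuous_on S unit_clamp"
  unfolding unit_clamp_def by (intro continuous_intros)

text \<open>Clamping the argument embeds the continuous functions on [0, 1] into a complete metric
  type, where Banach's fixed point theorem applies.\<close>

lemma unit_clamp_compose_bcontfun:
  fixes F :: "real \<Rightarrow> real"
  assumes "continuous_on {0..1} F"
  shows "(\<lambda>x. F (unit_clamp x)) \<in> bcontfun"
proof -
  have "continuous_on UNIV (\<lambda>x. F (unit_clamp x))"
    by (rule continuous_on_compose2[OF assms continuous_on_unit_clamp]) auto
  moreover have "bounded (F ` {0..1})"
    by (intro compact_imp_bounded compact_continuous_image assms) auto
  then have "bounded (range (\<lambda>x. F (unit_clamp x)))"
    by (rule bounded_subset) auto
  ultimately show ?thesis by (simp add: bcontfun_def)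
qed

text \<open>Picard iteration in an exponentially weighted norm: the weight makes the integral
  operator a contraction with factor 1/2 on all of [0, 1] at once, whatever the initial value.
  Comparing the fixed points for a and b gives Lipschitz dependence on the initial value, and
  \<open>G0\<close> makes the zero function the fixed point for a = 0.\<close>

lemma radial_ivp_solution:
  fixes G :: "real \<Rightarrow> real \<Rightarrow> real" and m :: nat
  assumes G: "continuous_on UNIV (\<lambda>(t, x). G t x)" and "0 \<le> K"
    and G0: "\<And>t. G t 0 = 0"
    and lip: "\<And>t x y. t \<in> {0..1} \<Longrightarrow> \<bar>G t x - G t y\<bar> \<le> K * \<bar>x - y\<bar>"
  obtains g :: "real \<Rightarrow> real \<Rightarrow> real" and C
  where "0 < C" "\<And>a. continuous_on UNIV (g a)"
    "\<And>a r. r \<in> {0..1} \<Longrightarrow>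
      g a r = a - integral {0..r} (\<lambda>s. s * radial_mean m (\<lambda>t. G t (g a t)) s)"
    "\<And>a b r. r \<in> {0..1} \<Longrightarrow> \<bar>g a r - g b r\<bar> \<le> C * \<bar>a - b\<bar>"
    "\<And>r. g 0 r = 0"
proof -
  \<comment> \<open>Integrating K exp(l s) over [0, r] costs at most (K / l) exp(l r); this l makes
    K / l \<le> 1/2.\<close>
  define l where "l = 2 * K + 1"
  have l: "0 < l" using \<open>0 \<le> K\<close> by (simp add: l_def)
  define \<phi> where "\<phi> h t = G t (exp (l * t) * h t)" for h :: "real \<Rightarrow> real" and t
  have G2: "continuous_on UNIV (\<lambda>t. G t (h t))" if "continuous_on UNIV h" for h :: "real \<Rightarrow> real"
    using continuous_on_compose2[OF G continuous_on_Pair[OF continuous_on_id that]] by auto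
  have \<phi>: "continuous_on UNIV (\<phi> h)" if "continuous_on UNIV h" for h :: "real \<Rightarrow> real"
    unfolding \<phi>_def by (intro G2 continuous_intros that)
  define J where "J h r = integral {0..r} (\<lambda>s. s * radial_mean m (\<phi> h) s)" for h r
  \<comment> \<open>The fixed point is exp(-l t) g(t), so that the sup distance is the weighted
    distance of the solutions.\<close>
  define T where "T a h = Bcontfun (\<lambda>x. exp (- l * unit_clamp x) * (a - J (apply_bcontfun h) (unit_clamp x)))"
    for a and h :: "real \<Rightarrow>\<^sub>C real"
  have intg: "(\<lambda>s. s * radial_mean m (\<phi> h) s) integrable_on {0..r}"
    if "continuous_on UNIV h" for h :: "real \<Rightarrow> real" and r
    by (intro integrable_continuous_real continuous_intros continuous_on_radial_mean \<phi> that)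
  have T: "apply_bcontfun (T a h) x = exp (- l * unit_clamp x) * (a - J (apply_bcontfun h) (unit_clamp x))"
    for a x and h :: "real \<Rightarrow>\<^sub>C real"
  proof -
    have "continuous_on {0..1} (J (apply_bcontfun h))"
      unfolding J_def by (intro indefinite_integral_continuous_1 intg) auto
    then have "(\<lambda>x. exp (- l * unit_clamp x) * (a - J (apply_bcontfun h) (unit_clamp x))) \<in> bcontfun"
      by (intro unit_clamp_compose_bcontfun[where F = "\<lambda>r. exp (- l * r) * (a - J (apply_bcontfun h) r)"]
          continuous_intros) auto
    then show ?thesis unfolding T_def by (simp add: Bcontfun_inverse)
  qed
  have J: "\<bar>J (apply_bcontfun h) r - J (apply_bcontfun k) r\<bar> \<le> exp (l * r) * (dist h k / 2)"
    if r: "r \<in> {0..1}" for h k :: "real \<Rightarrow>\<^sub>C real" and r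
  proof -
    let ?h = "apply_bcontfun h" and ?k = "apply_bcontfun k"
    let ?D = "dist h k"
    have bd: "\<bar>radial_mean m (\<phi> ?h) s - radial_mean m (\<phi> ?k) s\<bar> \<le> K * (exp (l * s) * ?D)"
      if s: "s \<in> {0..1}" for s
    proof (rule radial_mean_diff_le)
      fix t assume t: "0 \<le> t" "t \<le> s"
      have "\<bar>\<phi> ?h t - \<phi> ?k t\<bar> \<le> K * \<bar>exp (l * t) * ?h t - exp (l * t) * ?k t\<bar>"
        unfolding \<phi>_def using t s by (intro lip) auto
      also have "\<bar>exp (l * t) * ?h t - exp (l * t) * ?k t\<bar> = exp (l * t) * \<bar>?h t - ?k t\<bar>"
        by (simp add: right_diff_distrib[symmetric] abs_mult)
      also have "exp (l * t) * \<bar>?h t - ?k t\<bar> \<le> exp (l * s) * ?D"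
        using t l dist_bounded[of h t k] by (intro mult_mono) (auto simp: dist_real_def)
      finally show "\<bar>\<phi> ?h t - \<phi> ?k t\<bar> \<le> K * (exp (l * s) * ?D)"
        using \<open>0 \<le> K\<close> by (simp add: mult_left_mono)
    qed (use s in \<open>auto intro!: \<phi>\<close>)
    have ie: "((\<lambda>s. K * (exp (l * s) * ?D)) has_integral
        (K * (exp (l * r) * ?D) / l - K * (exp (l * 0) * ?D) / l)) {0..r}"
      using r l by (intro fundamental_theorem_of_calculus)
        (auto intro!: derivative_eq_intros simp flip: has_real_derivative_iff_has_vector_derivative)
    have "J ?h r - J ?k r = integral {0..r} (\<lambda>s. s * radial_mean m (\<phi> ?h) s - s * radial_mean m (\<phi> ?k) s)"
      unfolding J_def by (rule integral_diff[symmetric]) (intro intg; simp)+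
    also have "norm \<dots> \<le> integral {0..r} (\<lambda>s. K * (exp (l * s) * ?D))"
    proof (rule integral_norm_bound_integral)
      fix s assume s: "s \<in> {0..r}"
      then have "\<bar>s\<bar> * \<bar>radial_mean m (\<phi> ?h) s - radial_mean m (\<phi> ?k) s\<bar> \<le> 1 * (K * (exp (l * s) * ?D))"
        using r by (intro mult_mono bd) auto
      then show "norm (s * radial_mean m (\<phi> ?h) s - s * radial_mean m (\<phi> ?k) s) \<le> K * (exp (l * s) * ?D)"
        by (simp add: right_diff_distrib[symmetric] abs_mult)
    qed (auto intro!: integrable_diff intg has_integral_integrable[OF ie])
    also have "\<dots> \<le> K * (exp (l * r) * ?D) / l"
      unfolding integral_unique[OF ie] using l \<open>0 \<le> K\<close> by simp
    also have "\<dots> = (K / l) * (exp (l * r) * ?D)" by simp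
    also have "\<dots> \<le> (1 / 2) * (exp (l * r) * ?D)"
      using l by (intro mult_right_mono) (auto simp: l_def field_simps)
    finally show ?thesis by simp
  qed
  have dT: "dist (T a h) (T b k) \<le> \<bar>a - b\<bar> + dist h k / 2" for a b and h k :: "real \<Rightarrow>\<^sub>C real"
  proof (rule dist_bound)
    fix x
    let ?r = "unit_clamp x"
    have "dist (T a h x) (T b k x) = exp (- l * ?r) * \<bar>(a - b) - (J h ?r - J k ?r)\<bar>"
    proof -
      have "exp (- l * ?r) * (a - J h ?r) - exp (- l * ?r) * (b - J k ?r)
          = exp (- l * ?r) * ((a - b) - (J h ?r - J k ?r))"
        by (simp only: right_diff_distrib[symmetric]) (simp add: algebra_simps)
      then show ?thesis unfolding T dist_real_def by (simp add: abs_mult)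
    qed
    also have "\<dots> \<le> exp (- l * ?r) * (\<bar>a - b\<bar> + exp (l * ?r) * (dist h k / 2))"
    proof (rule mult_left_mono)
      have "\<bar>J h ?r - J k ?r\<bar> \<le> exp (l * ?r) * (dist h k / 2)" by (rule J) auto
      then show "\<bar>(a - b) - (J h ?r - J k ?r)\<bar> \<le> \<bar>a - b\<bar> + exp (l * ?r) * (dist h k / 2)"
        by linarith
    qed simp
    also have "\<dots> = exp (- l * ?r) * \<bar>a - b\<bar> + dist h k / 2"
      by (simp add: distrib_left mult.assoc[symmetric] exp_add[symmetric])
    also have "\<dots> \<le> 1 * \<bar>a - b\<bar> + dist h k / 2"
      using l by (intro add_right_mono mult_right_mono) auto
    finally show "dist (T a h x) (T b k x) \<le> \<bar>a - b\<bar> + dist h k / 2" by simp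
  qed
  have "\<exists>!h. T a h = h" for a
  proof (rule banach_fix_type[where c = "1/2"])
    show "\<forall>h k. dist (T a h) (T a k) \<le> 1 / 2 * dist h k"
    proof (intro allI)
      show "dist (T a h) (T a k) \<le> 1 / 2 * dist h k" for h k
        using dT[of a h a k] by simp
    qed
  qed auto
  then obtain h where h: "\<And>a. T a (h a) = h a" by metis
  define g where "g a t = exp (l * t) * apply_bcontfun (h a) t" for a t
  show thesis
  \<comment> \<open>The contraction factor 1/2 costs a factor 2 in the dependence on
    \<open>a\<close>, and undoing the weight costs at most exp l.\<close>
  proof (rule that[of "2 * exp l" g])
    show "continuous_on UNIV (g a)" for a
      unfolding g_def by (intro continuous_intros) auto
    fix r :: real assume r: "r \<in> {0..1}"
    show "g a r = a - integral {0..r} (\<lambda>s. s * radial_mean m (\<lambda>t. G t (g a t)) s)" for a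
    proof -
      have "g a r = exp (l * r) * T a (h a) r" by (simp add: g_def h)
      also have "\<dots> = (exp (l * r) * exp (- l * r)) * (a - J (h a) r)"
        unfolding T using r by simp
      also have "\<dots> = a - J (h a) r" by (simp add: exp_add[symmetric])
      finally show ?thesis unfolding J_def \<phi>_def g_def .
    qed
    show "\<bar>g a r - g b r\<bar> \<le> 2 * exp l * \<bar>a - b\<bar>" for a b
    proof -
      have "dist (h a) (h b) \<le> \<bar>a - b\<bar> + dist (h a) (h b) / 2"
        using dT[of a "h a" b "h b"] by (simp add: h)
      then have d: "\<bar>h a r - h b r\<bar> \<le> 2 * \<bar>a - b\<bar>"
        using dist_bounded[of "h a" r "h b"] by (simp add: dist_real_def)
      have "\<bar>g a r - g b r\<bar> = exp (l * r) * \<bar>h a r - h b r\<bar>"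
        by (simp add: g_def right_diff_distrib[symmetric] abs_mult)
      also have "\<dots> \<le> exp l * (2 * \<bar>a - b\<bar>)"
        using r l d by (intro mult_mono) auto
      finally show ?thesis by simp
    qed
    next
    define Z where "Z = (const_bcontfun 0 :: real \<Rightarrow>\<^sub>C real)"
    have Z: "apply_bcontfun Z = (\<lambda>_. 0)" by (simp add: Z_def const_bcontfun.rep_eq)
    have "\<phi> (\<lambda>_. 0) = (\<lambda>_. 0)" by (simp add: \<phi>_def[abs_def] G0)
    then have "T 0 Z = Z"
      by (intro bcontfun_eqI) (simp add: T J_def radial_mean_zero Z)
    then have "dist (h 0) Z \<le> dist (h 0) Z / 2" using dT[of 0 "h 0" 0 Z] by (simp add: h)
    then have "h 0 = Z" by simp
    then show "g 0 r = 0" for r by (simp add: g_def Z)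
  qed simp
qed

text \<open>Gronwall for E = y^2 + y1^2: the bound |E'| \<le> K E makes E exp(K r) nondecreasing and
  E exp(-K r) nonincreasing, so the zero of E at \<open>c\<close> spreads to both sides.\<close>

lemma linear_ode_zero:
  fixes y y1 y2 :: "real \<Rightarrow> real"
  assumes y: "\<And>r. r \<in> {a..b} \<Longrightarrow> (y has_real_derivative y1 r) (at r within {a..b})"
    and y1: "\<And>r. r \<in> {a..b} \<Longrightarrow> (y1 has_real_derivative y2 r) (at r within {a..b})"
    and bd: "\<And>r. r \<in> {a..b} \<Longrightarrow> \<bar>y2 r\<bar> \<le> C * (\<bar>y r\<bar> + \<bar>y1 r\<bar>)"
    and c: "c \<in> {a..b}" "y c = 0" "y1 c = 0" and r: "r \<in> {a..b}"
  shows "y r = 0"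
proof -
  define E where "E r = (y r)\<^sup>2 + (y1 r)\<^sup>2" for r
  define E' where "E' r = 2 * y r * y1 r + 2 * y1 r * y2 r" for r
  \<comment> \<open>One E bounds 2 |y y1|, and 3 |C| E bounds 2 |y1 y2|.\<close>
  define K where "K = 1 + 3 * \<bar>C\<bar>"
  have E: "(E has_real_derivative E' r) (at r within {a..b})" if "r \<in> {a..b}" for r
    unfolding E_def E'_def using that
    by (auto intro!: derivative_eq_intros y y1 simp: power2_eq_square)
  have E0: "0 \<le> E r" for r by (simp add: E_def)
  have E'bd: "\<bar>E' r\<bar> \<le> K * E r" if "r \<in> {a..b}" for r
  proof -
    have 1: "2 * \<bar>y r\<bar> * \<bar>y1 r\<bar> \<le> E r"
      using zero_le_power2[of "\<bar>y r\<bar> - \<bar>y1 r\<bar>"] unfolding E_def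
      by (simp add: power2_diff)
    have "\<bar>y2 r\<bar> \<le> \<bar>C\<bar> * (\<bar>y r\<bar> + \<bar>y1 r\<bar>)"
      using bd[OF that] by (meson abs_ge_self abs_ge_zero add_nonneg_nonneg mult_right_mono order_trans)
    then have "2 * \<bar>y1 r\<bar> * \<bar>y2 r\<bar> \<le> 2 * \<bar>y1 r\<bar> * (\<bar>C\<bar> * (\<bar>y r\<bar> + \<bar>y1 r\<bar>))"
      by (intro mult_left_mono) auto
    also have "\<dots> = \<bar>C\<bar> * (2 * \<bar>y r\<bar> * \<bar>y1 r\<bar>) + \<bar>C\<bar> * (2 * (\<bar>y1 r\<bar> * \<bar>y1 r\<bar>))"
      by (simp add: algebra_simps)
    also have "\<dots> \<le> \<bar>C\<bar> * E r + \<bar>C\<bar> * (2 * E r)"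
      using 1 by (intro add_mono mult_left_mono) (auto simp: E_def power2_eq_square)
    finally have 2: "2 * \<bar>y1 r\<bar> * \<bar>y2 r\<bar> \<le> 3 * \<bar>C\<bar> * E r" by (simp add: mult_ac)
    have "\<bar>E' r\<bar> \<le> 2 * \<bar>y r\<bar> * \<bar>y1 r\<bar> + 2 * \<bar>y1 r\<bar> * \<bar>y2 r\<bar>"
      unfolding E'_def by (rule order_trans[OF abs_triangle_ineq]) (simp add: abs_mult)
    with 1 2 show ?thesis by (simp add: K_def distrib_right)
  qed
  have Ec: "E c = 0" by (simp add: E_def c)
  have Eat: "(E has_real_derivative E' x) (at x)" if "a < x" "x < b" for x
    using E[of x] that by (simp add: at_within_Icc_at)
  have Econt: "continuous_on {a..b} E"
    using E by (rule DERIV_continuous_on)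
  have "E r = 0"
  proof (cases "r \<le> c")
    case True
    have "E r * exp (K * r) \<le> E c * exp (K * c)"
    proof (rule DERIV_nonneg_imp_increasing_open[where f = "\<lambda>x. E x * exp (K * x)"])
      fix x assume x: "r < x" "x < c"
      then have xab: "a < x" "x < b" using r c by auto
      have "((\<lambda>x. E x * exp (K * x)) has_real_derivative (E' x + K * E x) * exp (K * x)) (at x)"
        by (auto intro!: derivative_eq_intros Eat[OF xab] simp: algebra_simps)
      moreover have "0 \<le> (E' x + K * E x) * exp (K * x)"
        using E'bd[of x] xab by (intro mult_nonneg_nonneg) auto
      ultimately show "\<exists>d. ((\<lambda>x. E x * exp (K * x)) has_real_derivative d) (at x) \<and> 0 \<le> d" by blast
    qed (use True r c in \<open>auto intro!: continuous_intros continuous_on_subset[OF Econt]\<close>)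
    then have "E r * exp (K * r) \<le> 0" by (simp add: Ec)
    then show ?thesis using E0[of r] by (simp add: mult_le_0_iff)
  next
    case False
    have "E r * exp (- K * r) \<le> E c * exp (- K * c)"
    proof (rule DERIV_nonpos_imp_decreasing_open[where f = "\<lambda>x. E x * exp (- K * x)"])
      fix x assume x: "c < x" "x < r"
      then have xab: "a < x" "x < b" using r c by auto
      have "((\<lambda>x. E x * exp (- K * x)) has_real_derivative (E' x - K * E x) * exp (- K * x)) (at x)"
        by (auto intro!: derivative_eq_intros Eat[OF xab] simp: algebra_simps)
      moreover have "(E' x - K * E x) * exp (- K * x) \<le> 0"
        using E'bd[of x] xab by (intro mult_nonpos_nonneg) auto
      ultimately show "\<exists>d. ((\<lambda>x. E x * exp (- K * x)) has_real_derivative d) (at x) \<and> d \<le> 0" by blast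
    qed (use False r c in \<open>auto intro!: continuous_intros continuous_on_subset[OF Econt]\<close>)
    then have "E r * exp (- K * r) \<le> 0" by (simp add: Ec)
    then show ?thesis using E0[of r] by (simp add: mult_le_0_iff)
  qed
  then show ?thesis by (simp add: E_def add_nonneg_eq_0_iff)
qed

text \<open>Since 1 - y^2 never exceeds 1, data given on the half-line up to 1 become even functions
  on the whole line. \<open>q_1\<close> is W'(0) = 0, which holds because 0 is an interior minimum
  point of W.\<close>

locale GL_potential =
  fixes n :: nat and q q' U :: "real \<Rightarrow> real"
  assumes n_pos: "1 \<le> n"
    and q_deriv: "\<And>y. (q has_real_derivative q' y) (at y)"
    and q'_cont: "continuous_on UNIV q'"
    and U_deriv: "\<And>y. (U has_real_derivative - (q y * y)) (at y)"
    and q_even: "\<And>y. q (- y) = q y"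
    and U_even: "\<And>y. U (- y) = U y"
    and q_1: "q 1 = 0"
begin

lemma q_abs: "q \<bar>y\<bar> = q y" and U_abs: "U \<bar>y\<bar> = U y"
  using q_even[of y] U_even[of y] by (simp_all add: abs_if)

lemma q_cont: "continuous_on S q" and U_cont: "continuous_on S U"
  using q_deriv U_deriv DERIV_isCont continuous_at_imp_continuous_on by blast+

lemma q_bounded_Lipschitz:
  obtains M where "0 < M" "\<And>y. \<bar>y\<bar> \<le> 1 \<Longrightarrow> \<bar>q y\<bar> \<le> M"
    "\<And>x y. \<bar>x\<bar> \<le> 1 \<Longrightarrow> \<bar>y\<bar> \<le> 1 \<Longrightarrow> \<bar>q x - q y\<bar> \<le> M * \<bar>x - y\<bar>"
proof -
  have "bounded (q ` {-1..1})" "bounded (q' ` {-1..1})"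
    by (intro compact_imp_bounded compact_continuous_image q_cont continuous_on_subset[OF q'_cont]; simp)+
  then obtain A B where A: "\<And>y. y \<in> {-1..1} \<Longrightarrow> \<bar>q y\<bar> \<le> A" and B: "\<And>y. y \<in> {-1..1} \<Longrightarrow> \<bar>q' y\<bar> \<le> B"
    unfolding bounded_iff by (metis imageI real_norm_def)
  define M where "M = max 1 (max A B)"
  show thesis
  proof (rule that[of M])
    show "0 < M" by (simp add: M_def)
    show "\<bar>q y\<bar> \<le> M" if "\<bar>y\<bar> \<le> 1" for y
    proof -
      have "\<bar>q y\<bar> \<le> A" using that by (intro A) (auto simp: abs_le_iff)
      then show ?thesis by (simp add: M_def)
    qed
    show "\<bar>q x - q y\<bar> \<le> M * \<bar>x - y\<bar>" if "\<bar>x\<bar> \<le> 1" "\<bar>y\<bar> \<le> 1" for x y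
    proof -
      have "norm (q x - q y) \<le> M * norm (x - y)"
      proof (rule field_differentiable_bound[of "{-1..1}"])
        show "(q has_field_derivative q' z) (at z within {-1..1})" for z
          using q_deriv by (rule has_field_derivative_at_within)
        show "norm (q' z) \<le> M" if "z \<in> {-1..1}" for z
          using B[OF that] by (simp add: M_def)
      qed (use that in auto)
      then show ?thesis by simp
    qed
  qed
qed

text \<open>Cutting the argument at -1 and 1 makes the coefficient bounded and Lipschitz, and 0
  where |y| \<ge> 1. The profile found by shooting stays in [0, 1], so it does not see the
  cutoff.\<close>

definition qt :: "real \<Rightarrow> real" where "qt y = q (max (- 1) (min 1 y))"

lemma qt_eq: "\<bar>y\<bar> \<le> 1 \<Longrightarrow> qt y = q y"
  by (auto simp: qt_def max_def min_def intro!: arg_cong[where f = q])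

lemma qt_outside: "1 \<le> \<bar>y\<bar> \<Longrightarrow> qt y = 0"
  using q_even[of 1] q_1 by (auto simp: qt_def max_def min_def abs_if split: if_splits)

lemma qt_cont: "continuous_on S qt"
  unfolding qt_def by (intro continuous_on_compose2[OF q_cont[of UNIV]] continuous_intros) auto

text \<open>The nonlinearity multiplies a Lipschitz factor by an unbounded x. The scaling by t saves
  the estimate: the Lipschitz constant of the factor brings out a t, and |t y| \<le> 1 absorbs the
  remaining y.\<close>

lemma qt_bounded_Lipschitz:
  obtains M K where "0 < M" "0 \<le> K" "\<And>y. \<bar>qt y\<bar> \<le> M"
    "\<And>t x y. t \<in> {0..1} \<Longrightarrow> \<bar>qt (t * x) * x - qt (t * y) * y\<bar> \<le> K * \<bar>x - y\<bar>"
proof -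
  obtain M where M: "0 < M" "\<And>y. \<bar>y\<bar> \<le> 1 \<Longrightarrow> \<bar>q y\<bar> \<le> M"
    "\<And>x y. \<bar>x\<bar> \<le> 1 \<Longrightarrow> \<bar>y\<bar> \<le> 1 \<Longrightarrow> \<bar>q x - q y\<bar> \<le> M * \<bar>x - y\<bar>"
    by (rule q_bounded_Lipschitz) blast
  have b: "\<bar>qt y\<bar> \<le> M" for y
    unfolding qt_def by (intro M) auto
  have l: "\<bar>qt x - qt y\<bar> \<le> M * \<bar>x - y\<bar>" for x y
  proof -
    have "\<bar>qt x - qt y\<bar> \<le> M * \<bar>max (- 1) (min 1 x) - max (- 1) (min 1 y)\<bar>"
      unfolding qt_def by (intro M) auto
    also have "\<dots> \<le> M * \<bar>x - y\<bar>"
      using M(1) by (intro mult_left_mono) auto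
    finally show ?thesis .
  qed
  have aux: "\<bar>qt (t * x) * x - qt (t * y) * y\<bar> \<le> 2 * M * \<bar>x - y\<bar>"
    if t: "t \<in> {0..1}" and y: "\<bar>t * y\<bar> \<le> 1" for t x y
  proof -
    have "\<bar>qt (t * x) - qt (t * y)\<bar> * \<bar>y\<bar> \<le> (M * \<bar>t * x - t * y\<bar>) * \<bar>y\<bar>"
      by (intro mult_right_mono l) auto
    also have "\<dots> = (M * \<bar>x - y\<bar>) * \<bar>t * y\<bar>"
      using t by (simp add: right_diff_distrib[symmetric] abs_mult)
    also have "\<dots> \<le> (M * \<bar>x - y\<bar>) * 1"
      using M(1) y by (intro mult_left_mono) auto
    finally have 1: "\<bar>(qt (t * x) - qt (t * y)) * y\<bar> \<le> M * \<bar>x - y\<bar>" by (simp add: abs_mult)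
    have 2: "\<bar>qt (t * x) * (x - y)\<bar> \<le> M * \<bar>x - y\<bar>"
      unfolding abs_mult by (intro mult_right_mono b) auto
    have "qt (t * x) * x - qt (t * y) * y = qt (t * x) * (x - y) + (qt (t * x) - qt (t * y)) * y"
      by (simp add: algebra_simps)
    with 1 2 show ?thesis by linarith
  qed
  have "\<bar>qt (t * x) * x - qt (t * y) * y\<bar> \<le> 2 * M * \<bar>x - y\<bar>" if t: "t \<in> {0..1}" for t x y
  proof -
    \<comment> \<open>One small argument is enough for \<open>aux\<close>, after exchanging x and y
      if necessary; if both are at least 1, both terms vanish.\<close>
    consider "\<bar>t * y\<bar> \<le> 1" | "\<bar>t * x\<bar> \<le> 1" | "1 \<le> \<bar>t * x\<bar>" "1 \<le> \<bar>t * y\<bar>" by linarith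
    then show ?thesis
    proof cases
      case 1 with aux t show ?thesis by blast
    next
      case 2 with aux[of t x y] t show ?thesis using aux[of t x y] by (metis abs_minus_commute aux)
    next
      case 3 with M(1) show ?thesis by (simp add: qt_outside)
    qed
  qed
  with M(1) b show thesis by (intro that[of M "2 * M"]) auto
qed

end

section \<open>Shooting\<close>

text \<open>If c > 0, then f1, which vanishes at the maximum, is positive just to the right of x,
  and f would increase there.\<close>

lemma second_derivative_local_max:
  fixes f f1 :: "real \<Rightarrow> real"
  assumes f: "\<And>y. \<bar>x - y\<bar> < d \<Longrightarrow> (f has_real_derivative f1 y) (at y)"
    and f1: "(f1 has_real_derivative c) (at x)"
    and d: "0 < d" and max: "\<And>y. \<bar>x - y\<bar> < d \<Longrightarrow> f y \<le> f x"
  shows "c \<le> 0"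
proof (rule ccontr)
  assume "\<not> c \<le> 0"
  then obtain e where e: "0 < e" "\<And>h. 0 < h \<Longrightarrow> h < e \<Longrightarrow> f1 x < f1 (x + h)"
    using DERIV_pos_inc_right[OF f1] by auto
  have "f1 x = 0"
    by (rule DERIV_local_max[OF f[of x] d]) (use max d in auto)
  define b where "b = x + min d e / 2"
  have b: "x < b" "b - x < d" "b - x < e" using d e(1) by (auto simp: b_def)
  have "f x < f b"
  proof (rule DERIV_pos_imp_increasing_open[OF b(1)])
    fix y assume y: "x < y" "y < b"
    have "0 < f1 y" using e(2)[of "y - x"] y b \<open>f1 x = 0\<close> by simp
    moreover have "(f has_real_derivative f1 y) (at y)" using y b by (intro f) auto
    ultimately show "\<exists>l. (f has_real_derivative l) (at y) \<and> 0 < l" by blast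
  next
    have "(f has_real_derivative f1 y) (at y within {x..b})" if "y \<in> {x..b}" for y
      by (rule has_field_derivative_at_within, rule f) (use that b in auto)
    then show "continuous_on {x..b} f" by (rule DERIV_continuous_on)
  qed
  moreover have "f b \<le> f x" using b by (intro max) auto
  ultimately show False by simp
qed

context GL_potential begin

text \<open>The functions k and s encode regularity at the origin: g' = r k and g'' = s with k and s
  continuous on [0, 1], so g'/r stays bounded and g is C2 up to 0.\<close>

lemma shooting:
  obtains g k s :: "real \<Rightarrow> real" where
    "\<And>r. r \<in> {0..1} \<Longrightarrow> (g has_real_derivative r * k r) (at r within {0..1})"
    "\<And>r. r \<in> {0..1} \<Longrightarrow> ((\<lambda>r. r * k r) has_real_derivative s r) (at r within {0..1})"
    "continuous_on {0..1} k" "continuous_on {0..1} s"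
    "\<And>r. r \<in> {0..1} \<Longrightarrow> r * s r + real (n + 2) * (r * k r) = - (q (r * g r) * (r * g r))"
    "\<And>r. r \<in> {0..1} \<Longrightarrow> 0 < g r" "\<And>r. r \<in> {0<..<1} \<Longrightarrow> r * g r < 1" "g 1 = 1"
proof -
  have abs_diff_le: "\<bar>u - v - w\<bar> \<le> \<bar>u\<bar> + \<bar>v\<bar> + \<bar>w\<bar>" for u v w :: real by linarith
  obtain M K where M: "0 < M" "\<And>y. \<bar>qt y\<bar> \<le> M" and K: "0 \<le> K"
    "\<And>t x y. t \<in> {0..1} \<Longrightarrow> \<bar>qt (t * x) * x - qt (t * y) * y\<bar> \<le> K * \<bar>x - y\<bar>"
    by (rule qt_bounded_Lipschitz) blast
  define m where "m = n + 2"
  have Gc: "continuous_on UNIV (\<lambda>(t, x). qt (t * x) * x)"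
    unfolding split_def by (intro continuous_intros continuous_on_compose2[OF qt_cont[of UNIV]]) auto
  obtain g C where C: "0 < C" and gc: "\<And>a. continuous_on UNIV (g a)"
    and g_eq: "\<And>a r. r \<in> {0..1} \<Longrightarrow>
      g a r = a - integral {0..r} (\<lambda>s. s * radial_mean m (\<lambda>t. qt (t * g a t) * g a t) s)"
    and g_lip: "\<And>a b r. r \<in> {0..1} \<Longrightarrow> \<bar>g a r - g b r\<bar> \<le> C * \<bar>a - b\<bar>"
    and g0: "\<And>r. g 0 r = 0"
    by (rule radial_ivp_solution[OF Gc K(1), where m = m]) (use K(2) in auto)
  define \<phi> where "\<phi> a t = qt (t * g a t) * g a t" for a t
  have \<phi>: "continuous_on S (\<phi> a)" for a S
    unfolding \<phi>_def
    by (intro continuous_intros continuous_on_compose2[OF qt_cont[of UNIV]] continuous_on_subset[OF gc]) auto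
  define k where "k a r = - radial_mean m (\<phi> a) r" for a r
  define s where "s a r = - (\<phi> a r - real m * radial_mean m (\<phi> a) r)" for a r
  have kc: "continuous_on S (k a)" for a S
    unfolding k_def by (intro continuous_intros continuous_on_radial_mean \<phi>)
  have sc: "continuous_on S (s a)" for a S
    unfolding s_def by (intro continuous_intros continuous_on_radial_mean \<phi>)
  have g_at_0: "g a 0 = a" for a using g_eq[of 0 a] by simp
  have g': "(g a has_real_derivative r * k a r) (at r within {0..1})" if r: "r \<in> {0..1}" for a r
  proof -
    have "((\<lambda>r. integral {0..r} (\<lambda>s. s * radial_mean m (\<phi> a) s)) has_real_derivative
        r * radial_mean m (\<phi> a) r) (at r within {0..1})"
      by (rule integral_has_real_derivative) (use r in \<open>auto intro!: continuous_intros continuous_on_radial_mean \<phi>\<close>)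
    then have "((\<lambda>r. a - integral {0..r} (\<lambda>s. s * radial_mean m (\<phi> a) s)) has_real_derivative
        r * k a r) (at r within {0..1})"
      by (auto intro!: derivative_eq_intros simp: k_def)
    then show ?thesis
      by (rule has_field_derivative_transform_within[where d = 1]) (use r g_eq in \<open>auto simp: \<phi>_def[abs_def]\<close>)
  qed
  have k': "((\<lambda>r. r * k a r) has_real_derivative s a r) (at r within {0..1})" if r: "r \<in> {0..1}" for a r
    using DERIV_minus[OF has_real_derivative_mult_radial_mean[OF \<phi> r, of m a]]
    by (simp add: k_def s_def)
  have eq: "r * s a r + real m * (r * k a r) = - (qt (r * g a r) * (r * g a r))" for a r
    by (simp add: k_def s_def \<phi>_def algebra_simps)
  define f where "f a r = r * g a r" for a r
  define f1 where "f1 a r = g a r + r * (r * k a r)" for a r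
  define f2 where "f2 a r = 2 * (r * k a r) + r * s a r" for a r
  have f': "(f a has_real_derivative f1 a r) (at r within {0..1})" if r: "r \<in> {0..1}" for a r
    unfolding f_def f1_def using r by (auto intro!: derivative_eq_intros g')
  have f1': "(f1 a has_real_derivative f2 a r) (at r within {0..1})" if r: "r \<in> {0..1}" for a r
    unfolding f1_def f2_def
    using DERIV_add[OF g'[OF r, of a] DERIV_mult[OF DERIV_ident k'[OF r, of a]]] by (simp add: algebra_simps)
  have feq: "f2 a r + real n / r * f1 a r - real n / r\<^sup>2 * f a r = - (qt (f a r) * f a r)"
    if "0 < r" for a r
  proof -
    have "f2 a r + real n / r * f1 a r - real n / r\<^sup>2 * f a r = r * s a r + real m * (r * k a r)"
      using that by (simp add: f_def f1_def f2_def m_def field_simps power2_eq_square)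
    then show ?thesis by (simp add: eq f_def)
  qed

  \<comment> \<open>At an interior zero of a nonnegative g also g' vanishes, so f = r g has zero
    Cauchy data there. Uniqueness on [\<rho>, r], where the coefficients are bounded, makes f vanish
    for every small \<rho> > 0, against g(0) = a > 0.\<close>
  have pos: "0 < g a r"
    if "0 < a" "T \<in> {0..1}" "0 < g a T" "\<forall>r\<in>{0..T}. 0 \<le> g a r" "r \<in> {0..T}" for a T r
  proof (rule ccontr)
    assume "\<not> 0 < g a r"
    with that have gr: "g a r = 0" by force
    with that g_at_0[of a] have r: "0 < r" "r < T" by (auto simp: less_le)
    have "r * k a r = 0"
    proof (rule DERIV_local_min)
      show "(g a has_real_derivative r * k a r) (at r)"
        using g'[of r a] r that by (simp add: at_within_Icc_at)
      show "0 < min r (T - r)" using r by simp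
      show "\<forall>y. \<bar>r - y\<bar> < min r (T - r) \<longrightarrow> g a r \<le> g a y"
        using that gr by (auto simp: abs_less_iff)
    qed
    then have fr: "f a r = 0" "f1 a r = 0" using gr by (auto simp: f_def f1_def)
    have fz: "f a \<rho> = 0" if \<rho>: "0 < \<rho>" "\<rho> < r" for \<rho>
    proof (rule linear_ode_zero[where y = "f a" and c = r and a = \<rho> and b = r])
      fix x assume x: "x \<in> {\<rho>..r}"
      then have x01: "x \<in> {0..1}" "0 < x" using \<rho> r \<open>T \<in> {0..1}\<close> by auto
      have sub: "{\<rho>..r} \<subseteq> {0..1}" using \<rho> r \<open>T \<in> {0..1}\<close> by auto
      show "(f a has_real_derivative f1 a x) (at x within {\<rho>..r})"
        using DERIV_subset[OF f'[OF x01(1)] sub] .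
      show "(f1 a has_real_derivative f2 a x) (at x within {\<rho>..r})"
        using DERIV_subset[OF f1'[OF x01(1)] sub] .
      have "f2 a x = real n / x\<^sup>2 * f a x - qt (f a x) * f a x - real n / x * f1 a x"
        using feq[OF x01(2), of a] by simp
      then have "\<bar>f2 a x\<bar> \<le> \<bar>real n / x\<^sup>2 * f a x\<bar> + \<bar>qt (f a x) * f a x\<bar> + \<bar>real n / x * f1 a x\<bar>"
        using abs_diff_le[of "real n / x\<^sup>2 * f a x"] by (simp only:)
      also have "\<dots> \<le> real n / \<rho>\<^sup>2 * \<bar>f a x\<bar> + M * \<bar>f a x\<bar> + real n / \<rho> * \<bar>f1 a x\<bar>"
        unfolding abs_mult
        by (intro add_mono mult_right_mono M) (use x \<rho> in \<open>auto intro!: divide_left_mono power_mono\<close>)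
      also have "\<dots> \<le> (real n / \<rho>\<^sup>2 + M + real n / \<rho>) * (\<bar>f a x\<bar> + \<bar>f1 a x\<bar>)"
        using \<rho> M(1) by (simp add: algebra_simps)
      finally show "\<bar>f2 a x\<bar> \<le> (real n / \<rho>\<^sup>2 + M + real n / \<rho>) * (\<bar>f a x\<bar> + \<bar>f1 a x\<bar>)" .
    qed (use \<rho> fr in auto)
    have "isCont (g a) 0" using gc[of a] by (simp add: continuous_on_eq_continuous_at)
    then have "\<forall>\<^sub>F x in at 0. 0 < g a x"
      unfolding isCont_def g_at_0 using \<open>0 < a\<close> by (rule order_tendstoD)
    then obtain d where d: "0 < d" "\<And>x. x \<noteq> 0 \<Longrightarrow> \<bar>x\<bar> < d \<Longrightarrow> 0 < g a x"
      unfolding eventually_at dist_real_def by auto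
    define e where "e = min d r / 2"
    have e: "0 < e" "e < r" "e < d" using d(1) r by (auto simp: e_def)
    then have "0 < g a e" by (intro d) auto
    moreover have "g a e = 0" using fz[of e] e by (auto simp: f_def)
    ultimately show False by simp
  qed

  \<comment> \<open>The slopes whose profile reaches 1 while g is still nonnegative. Weak
    inequalities keep the condition closed; \<open>pos\<close> recovers strict positivity.\<close>
  define A where "A = {a. 0 < a \<and> (\<exists>T\<in>{0..1}. 1 \<le> T * g a T \<and> (\<forall>r\<in>{0..T}. 0 \<le> g a r))}"
  \<comment> \<open>Comparison with the zero solution bounds g by C a, so the deviation from the
    initial value is proportional to \<open>a\<close> and relatively small near 0.\<close>
  have g_close: "\<bar>g a r - a\<bar> \<le> M * C * a * r" if "0 < a" "r \<in> {0..1}" for a r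
  proof -
    have bd: "\<bar>radial_mean m (\<phi> a) s\<bar> \<le> M * (C * a)" if "s \<in> {0..1}" for s
    proof -
      have "\<bar>radial_mean m (\<phi> a) s - radial_mean m (\<lambda>_. 0) s\<bar> \<le> M * (C * a)"
      proof (rule radial_mean_diff_le)
        fix t assume "0 \<le> t" "t \<le> s"
        then have "\<bar>g a t - g 0 t\<bar> \<le> C * \<bar>a - 0\<bar>" using that by (intro g_lip) auto
        then have "\<bar>qt (t * g a t)\<bar> * \<bar>g a t\<bar> \<le> M * (C * a)"
          using M C \<open>0 < a\<close> by (intro mult_mono) (auto simp: g0)
        then show "\<bar>\<phi> a t - 0\<bar> \<le> M * (C * a)" by (simp add: \<phi>_def abs_mult)
      qed (use that \<phi> in auto)
      then show ?thesis by (simp add: radial_mean_zero)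
    qed
    have "g a r - a = - integral {0..r} (\<lambda>s. s * radial_mean m (\<phi> a) s)"
      using g_eq[OF that(2), of a] by (simp add: \<phi>_def[abs_def])
    moreover have "norm (integral {0..r} (\<lambda>s. s * radial_mean m (\<phi> a) s)) \<le> (M * (C * a)) * (r - 0)"
    proof (rule integral_bound)
      fix s assume "s \<in> {0..r}"
      then have "\<bar>s\<bar> * \<bar>radial_mean m (\<phi> a) s\<bar> \<le> 1 * (M * (C * a))"
        using that by (intro mult_mono bd) auto
      then show "norm (s * radial_mean m (\<phi> a) s) \<le> M * (C * a)" by (simp add: abs_mult)
    qed (use that in \<open>auto intro!: continuous_intros continuous_on_radial_mean \<phi>\<close>)
    ultimately show ?thesis by (simp add: mult.assoc)
  qed
  have "A \<noteq> {}"
  proof -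
    \<comment> \<open>On [0, r] the deviation is at most half the initial value; with slope 2 / r
      this keeps g above 1 / r, and the profile has reached 1 at r.\<close>
    define r where "r = min 1 (1 / (2 * M * C))"
    have r: "0 < r" "r \<le> 1" using M C by (auto simp: r_def)
    have rMC: "M * C * r \<le> 1 / 2"
    proof -
      have "M * C * r \<le> M * C * (1 / (2 * M * C))"
        using M C by (intro mult_left_mono) (auto simp: r_def)
      then show ?thesis using M C by simp
    qed
    have ge: "1 / r \<le> g (2 / r) x" if x: "x \<in> {0..r}" for x
    proof -
      have "M * C * (2 / r) * x \<le> M * C * (2 / r) * r"
        using x r M C by (intro mult_left_mono) auto
      also have "\<dots> = (M * C * r) * (2 / r)" by simp
      also have "\<dots> \<le> 1 / 2 * (2 / r)" using rMC r by (intro mult_right_mono) auto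
      finally have "M * C * (2 / r) * x \<le> 1 / r" by simp
      moreover have "\<bar>g (2 / r) x - 2 / r\<bar> \<le> M * C * (2 / r) * x"
        using x r by (intro g_close) auto
      moreover have "2 / r = 1 / r + 1 / r" by simp
      ultimately show ?thesis by linarith
    qed
    have "1 \<le> r * g (2 / r) r" using ge[of r] r by (simp add: field_simps)
    moreover have "0 \<le> g (2 / r) x" if "x \<in> {0..r}" for x
      using ge[OF that] r by (meson divide_nonneg_nonneg less_imp_le order_trans zero_le_one)
    ultimately have "2 / r \<in> A" using r by (auto simp: A_def intro!: bexI[of _ r])
    then show ?thesis by blast
  qed
  then obtain a1 where a1: "a1 \<in> A" by blast
  have gj: "continuous_on (UNIV \<times> {0..1}) (\<lambda>x. g (fst x) (snd x))"
    unfolding continuous_on_def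
  proof
    fix x :: "real \<times> real" assume x: "x \<in> UNIV \<times> {0..1}"
    let ?F = "at x within UNIV \<times> {0..1}"
    have "((\<lambda>y. C * \<bar>fst y - fst x\<bar>) \<longlongrightarrow> C * \<bar>fst x - fst x\<bar>) ?F"
      by (intro tendsto_intros)
    then have "((\<lambda>y. C * \<bar>fst y - fst x\<bar>) \<longlongrightarrow> 0) ?F" by simp
    then have "((\<lambda>y. g (fst y) (snd y) - g (fst x) (snd y)) \<longlongrightarrow> 0) ?F"
      by (rule Lim_null_comparison[rotated]) (auto simp: eventually_at_filter intro!: always_eventually g_lip)
    moreover have "((\<lambda>y. g (fst x) (snd y)) \<longlongrightarrow> g (fst x) (snd x)) ?F"
      using gc[of "fst x"] by (intro isCont_tendsto_compose[where g = "g (fst x)"] tendsto_intros)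
        (simp add: continuous_on_eq_continuous_at)
    ultimately have "((\<lambda>y. (g (fst y) (snd y) - g (fst x) (snd y)) + g (fst x) (snd y))
        \<longlongrightarrow> 0 + g (fst x) (snd x)) ?F"
      by (rule tendsto_add)
    then show "((\<lambda>y. g (fst y) (snd y)) \<longlongrightarrow> g (fst x) (snd x)) ?F" by simp
  qed
  define B where "B = {0..a1} \<times> {0..1::real}"
  \<comment> \<open>Pairs of a slope and a radius at which 1 is reached. Nonnegativity on the moving
    interval [0, t] is parametrised by \<tau> in [0, 1], which displays D as an intersection of
    closed sets; compactness then yields a least slope.\<close>
  define D where "D = {x \<in> B. 1 \<le> snd x * g (fst x) (snd x)}
    \<inter> (\<Inter>\<tau>\<in>{0..1}. {x \<in> B. 0 \<le> g (fst x) (\<tau> * snd x)})"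
  have "compact B" unfolding B_def by (intro compact_Times) auto
  have Bc: "continuous_on B (\<lambda>x. g (fst x) (\<tau> * snd x))" if "\<tau> \<in> {0..1}" for \<tau>
  proof -
    have "continuous_on B (\<lambda>x. (fst x, \<tau> * snd x))" by (intro continuous_intros)
    moreover have "(\<lambda>x. (fst x, \<tau> * snd x)) ` B \<subseteq> UNIV \<times> {0..1}"
      using that by (auto simp: B_def intro: mult_le_one)
    ultimately show ?thesis
      using continuous_on_compose2[OF gj, of B "\<lambda>x. (fst x, \<tau> * snd x)"] by simp
  qed
  have "closed D" unfolding D_def
    by (intro closed_Int closed_INT ballI continuous_on_closed_Collect_le continuous_intros Bc
        compact_imp_closed[OF \<open>compact B\<close>]) (use Bc[of 1] in auto)
  then have "compact (B \<inter> D)" by (intro compact_Int_closed \<open>compact B\<close>)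
  moreover have "B \<inter> D = D" by (auto simp: D_def)
  ultimately have "compact D" by simp
  have D_iff: "(b, t) \<in> D" if "b \<in> {0..a1}" "t \<in> {0..1}" "1 \<le> t * g b t" "\<forall>r\<in>{0..t}. 0 \<le> g b r" for b t
    using that by (auto simp: D_def B_def mult_left_le_one_le)
  have AD: "\<exists>t. (b, t) \<in> D" if b: "b \<in> A" "b \<le> a1" for b
  proof -
    obtain t where t: "0 < b" "t \<in> {0..1}" "1 \<le> t * g b t" "\<forall>r\<in>{0..t}. 0 \<le> g b r"
      using b(1) unfolding A_def by blast
    then have "(b, t) \<in> D" using b(2) by (intro D_iff) auto
    then show ?thesis ..
  qed
  obtain t1 where "(a1, t1) \<in> D" using AD[OF a1] by blast
  then obtain x where x: "x \<in> D" "\<And>y. y \<in> D \<Longrightarrow> fst x \<le> fst y"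
    using continuous_attains_inf[OF \<open>compact D\<close> _ continuous_on_fst[OF continuous_on_id]] by blast
  define a T where "a = fst x" "T = snd x"
  have T: "T \<in> {0..1}" "1 \<le> T * g a T" and a_le: "0 \<le> a" "a \<le> a1"
    using x(1) by (auto simp: D_def B_def a_T_def)
  have "a \<noteq> 0" using T g0 by auto
  with a_le have a: "0 < a" by simp
  have T0: "0 < T" using T by (cases "T = 0") auto
  have gnn: "\<forall>r\<in>{0..T}. 0 \<le> g a r"
  proof
    fix r assume r: "r \<in> {0..T}"
    then have "r / T \<in> {0..1}" using T0 by auto
    with x(1) have "0 \<le> g (fst x) (r / T * snd x)" unfolding D_def by blast
    then show "0 \<le> g a r" using T0 by (simp add: a_T_def)
  qed
  have "0 < g a T" using T T0 zero_less_mult_pos[of T "g a T"] by linarith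
  have gp: "0 < g a r" if "r \<in> {0..T}" for r
    by (rule pos[OF a T(1) \<open>0 < g a T\<close> gnn that])
  have A_min: "a \<le> b" if bA: "b \<in> A" for b
  proof (cases "b \<le> a1")
    case True
    then obtain t where "(b, t) \<in> D" using AD[OF bA True] by blast
    with x(2) show ?thesis by (force simp: a_T_def)
  qed (use a_le in auto)
  \<comment> \<open>A strict excess over 1 would survive a small decrease of the slope, by Lipschitz
    dependence, against the minimality of \<open>a\<close>.\<close>
  have le1: "r * g a r \<le> 1" if r: "r \<in> {0..1}" and pos_r: "\<forall>x\<in>{0..r}. 0 < g a x" for r
  proof (rule ccontr)
    assume "\<not> r * g a r \<le> 1"
    then have gt: "0 < r * g a r - 1" by simp
    obtain x0 where x0: "x0 \<in> {0..r}" "\<And>y. y \<in> {0..r} \<Longrightarrow> g a x0 \<le> g a y"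
    proof -
      have "{0..r} \<noteq> {}" using r by simp
      with continuous_attains_inf[OF compact_Icc _ continuous_on_subset[OF gc[of a] subset_UNIV]]
      show thesis using that by blast
    qed
    \<comment> \<open>The smaller of two margins: the minimum of g on [0, r], and the excess of the
      profile over 1.\<close>
    define \<mu> where "\<mu> = min (g a x0) (r * g a r - 1)"
    have \<mu>: "0 < \<mu>" using x0 pos_r gt by (auto simp: \<mu>_def)
    \<comment> \<open>A decrease of at most \<mu> / C moves g by at most \<mu>; the bound a / 2
      keeps the new slope positive.\<close>
    define b where "b = a - min (a / 2) (\<mu> / C)"
    have "0 < min (a / 2) (\<mu> / C)" using a \<mu> C by simp
    moreover have "min (a / 2) (\<mu> / C) \<le> a / 2" by (rule min.cobounded1)
    ultimately have b: "0 < b" "b < a" using a unfolding b_def by linarith+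
    have "C * \<bar>b - a\<bar> \<le> C * (\<mu> / C)"
    proof (rule mult_left_mono)
      show "\<bar>b - a\<bar> \<le> \<mu> / C" using b min.cobounded2[of "a / 2" "\<mu> / C"] unfolding b_def by linarith
    qed (use C in simp)
    then have Cb: "C * \<bar>b - a\<bar> \<le> \<mu>" using C by simp
    have near: "\<bar>g b y - g a y\<bar> \<le> \<mu>" if "y \<in> {0..r}" for y
      using g_lip[of y b a] that r Cb by auto
    have "0 \<le> g b y" if "y \<in> {0..r}" for y
      using near[OF that] x0(2)[OF that] by (auto simp: \<mu>_def)
    moreover have "r * (g a r - g b r) \<le> 1 * \<mu>"
    proof -
      have "r * (g a r - g b r) \<le> r * \<mu>" using near[of r] r by (intro mult_left_mono) auto
      also have "\<dots> \<le> 1 * \<mu>" using r \<mu> by (intro mult_right_mono) auto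
      finally show ?thesis .
    qed
    then have "1 \<le> r * g b r" by (simp add: \<mu>_def right_diff_distrib)
    ultimately have "b \<in> A" using b r by (auto simp: A_def)
    with A_min b show False by force
  qed
  \<comment> \<open>Since g stays positive slightly beyond t, \<open>le1\<close> holds there too,
    and f has a local maximum at t with f' = 0 and f'' \<le> 0. But the truncated coefficient
    vanishes at the value 1, so the equation gives f'' = n / t^2 > 0.\<close>
  have no_early: False if t: "0 < t" "t < 1" "t * g a t = 1" "\<forall>x\<in>{0..t}. 0 < g a x" for t
  proof -
    have "isCont (g a) t" using gc[of a] by (simp add: continuous_on_eq_continuous_at)
    then have "\<forall>\<^sub>F x in at t. 0 < g a x"
      unfolding isCont_def by (rule order_tendstoD(1)) (use t in auto)
    then obtain d where d: "0 < d" "\<And>x. x \<noteq> t \<Longrightarrow> \<bar>x - t\<bar> < d \<Longrightarrow> 0 < g a x"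
      unfolding eventually_at dist_real_def by auto
    define e where "e = min d (min t (1 - t))"
    have e: "0 < e" using d t by (simp add: e_def)
    have in01: "0 < y" "y < 1" if "\<bar>t - y\<bar> < e" for y
      using that by (auto simp: e_def abs_less_iff)
    have f_at: "(f a has_real_derivative f1 a y) (at y)" if "\<bar>t - y\<bar> < e" for y
      using f'[of y a] in01[OF that] by (simp add: at_within_Icc_at)
    have f_max: "f a y \<le> f a t" if y: "\<bar>t - y\<bar> < e" for y
    proof -
      have "0 < g a x" if x: "x \<in> {0..y}" for x
      proof (cases "x \<le> t")
        case True with t x show ?thesis by auto
      next
        case False with x y d(2)[of x] show ?thesis by (auto simp: e_def)
      qed
      then have "y * g a y \<le> 1" using in01[OF y] by (intro le1) auto
      then show ?thesis using t by (simp add: f_def)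
    qed
    have f1_at: "(f1 a has_real_derivative f2 a t) (at t)"
      using f1'[of t a] t by (simp add: at_within_Icc_at)
    have "f2 a t \<le> 0"
      by (rule second_derivative_local_max[where d = e, OF _ f1_at e]) (erule f_at, erule f_max)
    moreover have "f1 a t = 0"
      by (rule DERIV_local_max[OF f_at e]) (use e f_max in auto)
    moreover have "f a t = 1" using t by (simp add: f_def)
    ultimately have "- (real n / t\<^sup>2) \<ge> 0"
      using feq[OF t(1), of a] by (simp add: qt_outside)
    moreover have "0 < real n / t\<^sup>2" using t n_pos by simp
    ultimately show False by simp
  qed
  have "T * g a T = 1" using le1[OF T(1)] gp T by force
  then have "T = 1" using no_early[of T] gp T T0 by force
  show thesis
  proof (rule that[of "g a" "k a" "s a"])
    fix r :: real assume r: "r \<in> {0..1}"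
    show gr: "0 < g a r" using gp r \<open>T = 1\<close> by blast
    have "r * g a r \<le> 1" using le1[OF r] gp r \<open>T = 1\<close> by auto
    then have "qt (r * g a r) = q (r * g a r)" using gr r by (intro qt_eq) simp
    then show "r * s a r + real (n + 2) * (r * k a r) = - (q (r * g a r) * (r * g a r))"
      using eq[of r a] by (simp add: m_def)
  next
    fix r :: real assume r: "r \<in> {0<..<1}"
    have "r * g a r \<le> 1" using le1[of r] gp r \<open>T = 1\<close> by auto
    moreover have "r * g a r \<noteq> 1" using no_early[of r] gp r \<open>T = 1\<close> by auto
    ultimately show "r * g a r < 1" by simp
  qed (use g' k' kc sc \<open>T * g a T = 1\<close> \<open>T = 1\<close> in auto)
qed

end

section \<open>Qualitative behaviour of solutions\<close>

context GL_potential begin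

definition solves :: "(real \<Rightarrow> real) \<Rightarrow> (real \<Rightarrow> real) \<Rightarrow> (real \<Rightarrow> real) \<Rightarrow> bool" where
  "solves h h1 h2 \<longleftrightarrow> (\<forall>r\<in>{0<..<1}. (h has_real_derivative h1 r) (at r) \<and>
     (h1 has_real_derivative h2 r) (at r) \<and>
     h2 r + real n / r * h1 r - real n / r\<^sup>2 * h r = - (q (h r) * h r))"

lemma solvesD:
  assumes "solves h h1 h2" "0 < r" "r < 1"
  shows "(h has_real_derivative h1 r) (at r)" "(h1 has_real_derivative h2 r) (at r)"
    "h2 r = real n / r\<^sup>2 * h r - real n / r * h1 r - q (h r) * h r"
proof -
  from assms have "(h has_real_derivative h1 r) (at r) \<and> (h1 has_real_derivative h2 r) (at r) \<and>
     h2 r + real n / r * h1 r - real n / r\<^sup>2 * h r = - (q (h r) * h r)"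
    unfolding solves_def by auto
  then show "(h has_real_derivative h1 r) (at r)" "(h1 has_real_derivative h2 r) (at r)"
    "h2 r = real n / r\<^sup>2 * h r - real n / r * h1 r - q (h r) * h r" by auto
qed

lemma solves_minus:
  assumes "solves h h1 h2"
  shows "solves (\<lambda>r. - h r) (\<lambda>r. - h1 r) (\<lambda>r. - h2 r)"
  unfolding solves_def
proof (intro ballI conjI)
  fix r :: real assume "r \<in> {0<..<1}"
  then have r: "0 < r" "r < 1" by auto
  note D = solvesD[OF assms r]
  show "((\<lambda>r. - h r) has_real_derivative - h1 r) (at r)"
    "((\<lambda>r. - h1 r) has_real_derivative - h2 r) (at r)"
    using DERIV_minus[OF D(1)] DERIV_minus[OF D(2)] .
  show "- h2 r + real n / r * - h1 r - real n / r\<^sup>2 * - h r = - (q (- h r) * - h r)"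
    using D(3) by (simp add: q_even)
qed

text \<open>The correction term \<open>(h\<^sup>2(r\<^sub>0) - h\<^sup>2) / r\<^sup>2\<close> makes the energy
  nonincreasing as long as the amplitude \<open>\<bar>h r\<^sub>0\<bar>\<close> is not exceeded.\<close>

lemma amplitude_not_regained:
  assumes h: "solves h h1 h2" and r0: "0 < r0" "r0 < s" "s < 1"
    and h1: "h1 r0 = 0" and nz: "h r0 \<noteq> 0"
    and le: "\<And>r. r \<in> {r0..s} \<Longrightarrow> \<bar>h r\<bar> \<le> \<bar>h r0\<bar>" and hs: "\<bar>h s\<bar> = \<bar>h r0\<bar>"
  shows False
proof -
  define F where "F r = (h1 r)\<^sup>2 / 2 - U (h r) + real n / 2 * (((h r0)\<^sup>2 - (h r)\<^sup>2) / r\<^sup>2)" for r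
  define F' where "F' r = - (real n / r * (h1 r)\<^sup>2 + real n * ((h r0)\<^sup>2 - (h r)\<^sup>2) / r ^ 3)" for r
  have F: "(F has_real_derivative F' r) (at r)" if r: "r0 \<le> r" "r \<le> s" for r
  proof -
    have r': "0 < r" "r < 1" using r r0 by auto
    note D = solvesD[OF h r']
    have alg: "2 * a * (N / r\<^sup>2 * x - N / r * a - Q * x) / 2 + Q * x * a
        + N / 2 * ((- (2 * x * a) * r\<^sup>2 - m * (2 * r)) / (r\<^sup>2 * r\<^sup>2)) = - (N / r * a\<^sup>2 + N * m / r ^ 3)"
      if "r \<noteq> 0" for a N x Q m r :: real
      using that by (simp add: divide_simps power2_eq_square power3_eq_cube) algebra
    have d1: "((\<lambda>r. (h1 r)\<^sup>2 / 2) has_real_derivative 2 * h1 r * h2 r / 2) (at r)"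
      by (auto intro!: derivative_eq_intros D)
    have d2: "((\<lambda>r. U (h r)) has_real_derivative - (q (h r) * h r * h1 r)) (at r)"
      using DERIV_chain'[OF D(1) U_deriv] by simp
    have d3: "((\<lambda>r. ((h r0)\<^sup>2 - (h r)\<^sup>2) / r\<^sup>2) has_real_derivative
        (- (2 * h r * h1 r) * r\<^sup>2 - ((h r0)\<^sup>2 - (h r)\<^sup>2) * (2 * r)) / (r\<^sup>2 * r\<^sup>2)) (at r)"
      using r' by (auto intro!: derivative_eq_intros D)
    have "(F has_real_derivative 2 * h1 r * h2 r / 2 + q (h r) * h r * h1 r
        + real n / 2 * ((- (2 * h r * h1 r) * r\<^sup>2 - ((h r0)\<^sup>2 - (h r)\<^sup>2) * (2 * r)) / (r\<^sup>2 * r\<^sup>2))) (at r)"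
      unfolding F_def using DERIV_add[OF DERIV_diff[OF d1 d2] DERIV_cmult[OF d3, of "real n / 2"]] by simp
    also have "2 * h1 r * h2 r / 2 + q (h r) * h r * h1 r
        + real n / 2 * ((- (2 * h r * h1 r) * r\<^sup>2 - ((h r0)\<^sup>2 - (h r)\<^sup>2) * (2 * r)) / (r\<^sup>2 * r\<^sup>2)) = F' r"
      unfolding D(3) F'_def by (rule alg) (use r' in simp)
    finally show ?thesis .
  qed
  have sq: "(h r)\<^sup>2 \<le> (h r0)\<^sup>2" if "r \<in> {r0..s}" for r
    using le[OF that] by (simp add: abs_le_square_iff)
  have F'_le: "real n / r * (h1 r)\<^sup>2 \<ge> 0" "real n * ((h r0)\<^sup>2 - (h r)\<^sup>2) / r ^ 3 \<ge> 0" if "r \<in> {r0..s}" for r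
    using sq[OF that] that r0 by auto
  have dec: "F b \<le> F a" if "r0 \<le> a" "a \<le> b" "b \<le> s" for a b
  proof (rule DERIV_nonpos_imp_nonincreasing[OF that(2)])
    fix x assume "a \<le> x" "x \<le> b"
    with that have "x \<in> {r0..s}" by auto
    with F[of x] F'_le[of x] show "\<exists>y. (F has_real_derivative y) (at x) \<and> y \<le> 0"
      by (auto simp: F'_def intro!: exI[of _ "F' x"])
  qed
  \<comment> \<open>At r0 and at s the correction term vanishes and the potential terms agree, while
    the kinetic term is 0 at r0. So F cannot have decreased, and being nonincreasing it is
    constant.\<close>
  have "U (h s) = U (h r0)"
    by (metis hs U_abs)
  moreover have "(h s)\<^sup>2 = (h r0)\<^sup>2" using hs by (metis power2_abs)
  ultimately have Fs: "F r0 \<le> F s" by (simp add: F_def h1)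
  have F'0: "F' r = 0" if r: "r0 < r" "r < s" for r
  proof (rule ccontr)
    assume "F' r \<noteq> 0"
    with F'_le[of r] r have "F' r < 0" by (auto simp: F'_def)
    from DERIV_neg_dec_right[OF F this] r obtain d
      where d: "0 < d" "\<And>e. 0 < e \<Longrightarrow> e < d \<Longrightarrow> F (r + e) < F r" by auto
    define e where "e = min d (s - r) / 2"
    have e: "0 < e" "e < d" "r + e \<le> s" using d(1) r by (auto simp: e_def min_def field_simps)
    have "F s \<le> F (r + e)" using r e by (intro dec) auto
    moreover have "F r \<le> F r0" using r by (intro dec) auto
    ultimately show False using d(2)[of e] e Fs by linarith
  qed
  have flat: "h1 r = 0" "\<bar>h r\<bar> = \<bar>h r0\<bar>" if r: "r0 < r" "r < s" for r
  proof -
    have "real n / r * (h1 r)\<^sup>2 = 0" "real n * ((h r0)\<^sup>2 - (h r)\<^sup>2) / r ^ 3 = 0"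
    proof -
      have "real n / r * (h1 r)\<^sup>2 + real n * ((h r0)\<^sup>2 - (h r)\<^sup>2) / r ^ 3 = 0"
        using F'0[OF r] unfolding F'_def by (simp only: neg_equal_0_iff_equal)
      moreover have "r \<in> {r0..s}" using r by simp
      ultimately show "real n / r * (h1 r)\<^sup>2 = 0" "real n * ((h r0)\<^sup>2 - (h r)\<^sup>2) / r ^ 3 = 0"
        using add_nonneg_eq_0_iff[OF F'_le] by blast+
    qed
    then have "h1 r = 0" "(h r0)\<^sup>2 = (h r)\<^sup>2" using r r0 n_pos by auto
    then show "h1 r = 0" "\<bar>h r\<bar> = \<bar>h r0\<bar>" by (auto simp flip: real_sqrt_abs)
  qed
  \<comment> \<open>A solution of constant nonzero modulus forces q(h r0) = n / r^2 on a whole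
    interval, although n / r^2 is strictly decreasing.\<close>
  have qn: "q (h r0) = real n / r\<^sup>2" if r: "r0 < r" "r < s" for r
  proof -
    have r': "0 < r" "r < 1" using r r0 by auto
    note D = solvesD[OF h r']
    have "((\<lambda>_. 0) has_real_derivative h2 r) (at r)"
      by (rule has_field_derivative_transform_within_open[OF D(2), where S = "{r0<..<s}"])
        (use r flat in auto)
    then have "h2 r = 0" by (rule DERIV_unique) simp
    with D(3) flat[OF r] have "real n / r\<^sup>2 * h r = q (h r) * h r" by simp
    moreover have "h r \<noteq> 0" using flat(2)[OF r] nz by auto
    ultimately have "real n / r\<^sup>2 = q (h r)" using mult_right_cancel by blast
    moreover have "q (h r) = q (h r0)"
      by (metis flat(2)[OF r] q_abs)
    ultimately show ?thesis by simp
  qed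
  define a b where "a = (2 * r0 + s) / 3" and "b = (r0 + 2 * s) / 3"
  have ab: "r0 < a" "a < b" "b < s" using r0 by (auto simp: a_def b_def)
  then have "a\<^sup>2 < b\<^sup>2" using r0 by (intro power_strict_mono) auto
  then have "real n / b\<^sup>2 < real n / a\<^sup>2"
    using ab r0 n_pos by (intro divide_strict_left_mono) auto
  moreover have "q (h r0) = real n / a\<^sup>2" "q (h r0) = real n / b\<^sup>2" using ab by (auto intro!: qn)
  ultimately show False by linarith
qed

end

locale GL_convex_potential = GL_potential +
  assumes q_antimono: "\<And>x y. 0 \<le> x \<Longrightarrow> x \<le> y \<Longrightarrow> q y \<le> q x"
begin

lemma q_nonpos: "1 \<le> y \<Longrightarrow> q y \<le> 0"
  using q_antimono[of 1 y] q_1 by simp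

text \<open>At such a point h'' \<le> 0, while the equation makes h'' at least n h / r^2 > 0,
  because q is nonpositive beyond 1.\<close>

lemma no_local_max_above_1:
  assumes h: "solves h h1 h2" and r0: "0 < r0" "r0 < 1"
    and d: "0 < d" "\<And>y. \<bar>r0 - y\<bar> < d \<Longrightarrow> h y \<le> h r0" and ge: "1 \<le> h r0"
  shows False
proof -
  define e where "e = min d (min r0 (1 - r0))"
  have e: "0 < e" using d r0 by (simp add: e_def)
  have in01: "0 < y" "y < 1" if "\<bar>r0 - y\<bar> < e" for y
    using that by (auto simp: e_def abs_less_iff)
  have "h1 r0 = 0"
    by (rule DERIV_local_max[OF solvesD(1)[OF h r0] d(1)]) (use d in auto)
  moreover have "h2 r0 \<le> 0"
  proof (rule second_derivative_local_max[where f = h and ?f1.0 = h1 and d = e and x = r0])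
    show "(h has_real_derivative h1 y) (at y)" if "\<bar>r0 - y\<bar> < e" for y
      using in01[OF that] by (rule solvesD(1)[OF h])
    show "h y \<le> h r0" if "\<bar>r0 - y\<bar> < e" for y
      using that by (intro d(2)) (simp add: e_def)
  qed (fact solvesD(2)[OF h r0] e)+
  moreover have "0 < real n / r0\<^sup>2 * h r0" using r0 n_pos ge by simp
  moreover have "q (h r0) * h r0 \<le> 0" using q_nonpos[OF ge] ge by (intro mult_nonpos_nonneg) auto
  ultimately show False using solvesD(3)[OF h r0] by simp
qed

text \<open>The maximum has value below 1 by \<open>no_local_max_above_1\<close>, but the modulus
  must reach 1 at the endpoint. So the amplitude is regained, and its first return contradicts
  \<open>amplitude_not_regained\<close>.\<close>

lemma no_local_max_pos:
  assumes h: "solves h h1 h2" and hc: "continuous_on {0<..1} h" and h_1: "\<bar>h 1\<bar> = 1"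
    and r0: "0 < r0" "r0 < 1" and pos: "0 < h r0"
    and d: "0 < d" "\<And>y. \<bar>r0 - y\<bar> < d \<Longrightarrow> \<bar>h y\<bar> \<le> \<bar>h r0\<bar>"
  shows False
proof -
  have le: "h y \<le> h r0" if "\<bar>r0 - y\<bar> < d" for y
    using d(2)[OF that] pos by simp
  have h10: "h1 r0 = 0"
    by (rule DERIV_local_max[OF solvesD(1)[OF h r0] d(1)]) (use le in auto)
  have lt1: "h r0 < 1"
    using no_local_max_above_1[OF h r0 d(1) le] by force
  define e where "e = min d (1 - r0)"
  have e: "0 < e" "e \<le> d" "e \<le> 1 - r0" using d(1) r0 by (auto simp: e_def)
  \<comment> \<open>Starting the search at b > r0 prevents the first return from being r0 itself; up
    to b the amplitude bound comes from the local maximum.\<close>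
  define b where "b = r0 + e / 2"
  have b: "r0 < b" "b < 1" "b - r0 < d" using e d(1) r0 by (auto simp: b_def)
  define S where "S = {r \<in> {b..1}. \<bar>h r\<bar> = h r0}"
  have ac: "continuous_on {b..1} (\<lambda>r. \<bar>h r\<bar>)"
    using b r0 by (intro continuous_intros continuous_on_subset[OF hc]) auto
  have "\<bar>h b\<bar> \<le> h r0" using d(2)[of b] b pos by simp
  then have "\<exists>x. b \<le> x \<and> x \<le> 1 \<and> \<bar>h x\<bar> = h r0"
    using b h_1 lt1 ac by (intro IVT') auto
  then have "S \<noteq> {}" by (auto simp: S_def)
  moreover have "compact S"
  proof -
    have "closed S"
      unfolding S_def by (rule continuous_closed_preimage_constant[OF ac]) simp
    then have "compact ({b..1} \<inter> S)" by (intro compact_Int_closed) simp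
    moreover have "{b..1} \<inter> S = S" by (auto simp: S_def)
    ultimately show ?thesis by simp
  qed
  ultimately obtain s where s: "s \<in> S" "\<And>t. t \<in> S \<Longrightarrow> s \<le> t"
    using compact_attains_inf[of S] by blast
  show False
  proof (rule amplitude_not_regained[OF h r0(1), of s])
    show "r0 < s" using s b by (auto simp: S_def)
    show "s < 1" using s h_1 lt1 by (cases "s = 1") (auto simp: S_def)
    show "\<bar>h s\<bar> = \<bar>h r0\<bar>" using s pos by (auto simp: S_def)
    show "\<bar>h r\<bar> \<le> \<bar>h r0\<bar>" if r: "r \<in> {r0..s}" for r
    proof (cases "r < b")
      case True
      with r b show ?thesis by (intro d) auto
    next
      case False
      show ?thesis
      proof (rule ccontr)
        assume "\<not> \<bar>h r\<bar> \<le> \<bar>h r0\<bar>"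
        then have gt: "h r0 < \<bar>h r\<bar>" using pos by simp
        have "\<exists>x. b \<le> x \<and> x \<le> r \<and> \<bar>h x\<bar> = h r0"
          using False \<open>\<bar>h b\<bar> \<le> h r0\<close> gt r s
          by (intro IVT' continuous_on_subset[OF ac]) (auto simp: S_def)
        then obtain x where x: "b \<le> x" "x \<le> r" "\<bar>h x\<bar> = h r0" by blast
        then have "x \<in> S" using r s by (auto simp: S_def)
        with s(2) x r have "r = s" by force
        with gt s show False by (auto simp: S_def)
      qed
    qed
  qed (use h10 pos in auto)
qed

lemma no_local_max:
  assumes h: "solves h h1 h2" and hc: "continuous_on {0<..1} h" and h_1: "\<bar>h 1\<bar> = 1"
    and r0: "0 < r0" "r0 < 1" and nz: "h r0 \<noteq> 0"
    and d: "0 < d" "\<And>y. \<bar>r0 - y\<bar> < d \<Longrightarrow> \<bar>h y\<bar> \<le> \<bar>h r0\<bar>"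
  shows False
proof (cases "0 < h r0")
  case True
  then show ?thesis using no_local_max_pos[OF h hc h_1 r0 _ d] by blast
next
  case False
  with nz have "0 < - h r0" by simp
  then show ?thesis
    using no_local_max_pos[OF solves_minus[OF h] continuous_on_minus[OF hc] _ r0 _ d(1)] h_1 d(2) by simp
qed

text \<open>The limit 0 at the origin excludes a maximum at a left end a close to 0. Hence |h s| >
  |h r| would put a maximum of |h| over [a, r] into the interior, which \<open>no_local_max\<close>
  forbids.\<close>

lemma abs_solution_mono:
  assumes h: "solves h h1 h2" and hc: "continuous_on {0<..1} h" and h_1: "\<bar>h 1\<bar> = 1"
    and lim: "(h \<longlongrightarrow> 0) (at_right 0)" and sr: "0 < s" "s \<le> r" "r \<le> 1"
  shows "\<bar>h s\<bar> \<le> \<bar>h r\<bar>"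
proof (rule ccontr)
  assume "\<not> \<bar>h s\<bar> \<le> \<bar>h r\<bar>"
  then have gt: "\<bar>h r\<bar> < \<bar>h s\<bar>" by simp
  have "\<forall>\<^sub>F x in at_right 0. \<bar>h x\<bar> < \<bar>h s\<bar>"
    using tendsto_rabs[OF lim] by (rule order_tendstoD) (use gt in auto)
  then obtain e where e: "0 < e" "\<And>y. 0 < y \<Longrightarrow> y < e \<Longrightarrow> \<bar>h y\<bar> < \<bar>h s\<bar>"
    unfolding eventually_at_right_field by auto
  define a where "a = min e s / 2"
  have a: "0 < a" "a < e" "a < s" using e(1) sr by (auto simp: a_def min_def)
  have ac: "continuous_on {a..r} (\<lambda>x. \<bar>h x\<bar>)"
    using a sr by (intro continuous_intros continuous_on_subset[OF hc]) auto
  have "{a..r} \<noteq> {}" using a sr by simp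
  then obtain x where x: "x \<in> {a..r}" "\<And>y. y \<in> {a..r} \<Longrightarrow> \<bar>h y\<bar> \<le> \<bar>h x\<bar>"
    using continuous_attains_sup[OF compact_Icc _ ac] by blast
  have "\<bar>h s\<bar> \<le> \<bar>h x\<bar>" using a sr by (intro x) auto
  with gt e(2)[OF a(1,2)] have "x \<noteq> a" "x \<noteq> r" "h x \<noteq> 0" by auto
  with x have xar: "a < x" "x < r" by auto
  show False
  proof (rule no_local_max[OF h hc h_1])
    show "0 < x" "x < 1" using xar a sr by auto
    show "0 < min (x - a) (r - x)" using xar by simp
    show "\<bar>h y\<bar> \<le> \<bar>h x\<bar>" if "\<bar>x - y\<bar> < min (x - a) (r - x)" for y
      using that by (intro x) (auto simp: abs_less_iff)
  qed (fact \<open>h x \<noteq> 0\<close>)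
qed

text \<open>A zero z would, by monotonicity of |h|, make h vanish on all of (0, z]. Then the Cauchy
  data at z / 2 are zero and uniqueness propagates the zero to the right, against h 1 = 1.\<close>

lemma solution_pos:
  assumes h: "solves h h1 h2" and hc: "continuous_on {0<..1} h" and h_1: "h 1 = 1"
    and lim: "(h \<longlongrightarrow> 0) (at_right 0)" and r: "0 < r" "r \<le> 1"
  shows "0 < h r"
proof (rule ccontr)
  assume "\<not> 0 < h r"
  note mono = abs_solution_mono[OF h hc _ lim]
  obtain M where M: "0 < M" "\<And>y. \<bar>y\<bar> \<le> 1 \<Longrightarrow> \<bar>q y\<bar> \<le> M"
    by (rule q_bounded_Lipschitz) blast
  have "\<exists>z. r \<le> z \<and> z \<le> 1 \<and> h z = 0"
    using \<open>\<not> 0 < h r\<close> r h_1 by (intro IVT' continuous_on_subset[OF hc]) auto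
  then obtain z where rz: "r \<le> z" and z: "z \<le> 1" "h z = 0" by blast
  then have z: "0 < z" "z \<le> 1" "h z = 0" using r by auto
  have zero: "h y = 0" if "0 < y" "y \<le> z" for y
    using mono[of y z] that z h_1 by auto
  have z2: "0 < z / 2" "z / 2 < 1" using z by auto
  have h10: "h1 (z / 2) = 0"
  proof (rule DERIV_local_max[OF solvesD(1)[OF h z2], of "z / 2"])
    show "\<forall>y. \<bar>z / 2 - y\<bar> < z / 2 \<longrightarrow> h y \<le> h (z / 2)"
    proof (intro allI impI)
      fix y assume "\<bar>z / 2 - y\<bar> < z / 2"
      then have "0 < y" "y \<le> z" by linarith+
      then show "h y \<le> h (z / 2)" using zero[of y] zero[of "z / 2"] z by simp
    qed
  qed (use z in simp)
  \<comment> \<open>The contradiction is sought at a radius b < 1 with h b = 1/2, since the equation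
    is available only in the open interval.\<close>
  have "\<exists>b. z \<le> b \<and> b \<le> 1 \<and> h b = 1 / 2"
    using z h_1 by (intro IVT' continuous_on_subset[OF hc]) auto
  then obtain b where b: "z \<le> b" "b \<le> 1" "h b = 1 / 2" by blast
  with h_1 have "b < 1" by (cases "b = 1") auto
  have "h b = 0"
  proof (rule linear_ode_zero[where y = h and a = "z / 2" and b = b and c = "z / 2"])
    fix x assume x: "x \<in> {z/2..b}"
    then have x01: "0 < x" "x < 1" using z2 \<open>b < 1\<close> by auto
    note D = solvesD[OF h x01]
    show "(h has_real_derivative h1 x) (at x within {z/2..b})"
      using D(1) by (rule has_field_derivative_at_within)
    show "(h1 has_real_derivative h2 x) (at x within {z/2..b})"
      using D(2) by (rule has_field_derivative_at_within)
    have tri: "\<bar>u - v - w\<bar> \<le> \<bar>u\<bar> + \<bar>v\<bar> + \<bar>w\<bar>" for u v w :: real by linarith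
    have coef: "A * u + B * v + K * u \<le> (A + K + B) * (u + v)"
      if "0 \<le> A" "0 \<le> B" "0 \<le> K" "0 \<le> u" "0 \<le> v" for A B K u v :: real
      using that by (simp add: algebra_simps)
    have hx: "\<bar>h x\<bar> \<le> 1" using mono[of x 1] x01 h_1 by auto
    have "\<bar>h2 x\<bar> \<le> \<bar>real n / x\<^sup>2 * h x\<bar> + \<bar>real n / x * h1 x\<bar> + \<bar>q (h x) * h x\<bar>"
      unfolding D(3) by (rule tri)
    also have "\<dots> \<le> real n / (z/2)\<^sup>2 * \<bar>h x\<bar> + real n / (z/2) * \<bar>h1 x\<bar> + M * \<bar>h x\<bar>"
      unfolding abs_mult
    proof (intro add_mono mult_right_mono M hx)
      have "real n / x\<^sup>2 \<le> real n / (z/2)\<^sup>2" "real n / x \<le> real n / (z/2)"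
        by (rule divide_left_mono; use x z2 in \<open>auto intro: power_mono simp del: power_divide\<close>)+
      then show "\<bar>real n / x\<^sup>2\<bar> \<le> real n / (z/2)\<^sup>2" "\<bar>real n / x\<bar> \<le> real n / (z/2)"
        using x01 by auto
    qed auto
    also have "\<dots> \<le> (real n / (z/2)\<^sup>2 + M + real n / (z/2)) * (\<bar>h x\<bar> + \<bar>h1 x\<bar>)"
      by (rule coef) (use z2 M(1) in auto)
    finally show "\<bar>h2 x\<bar> \<le> (real n / (z/2)\<^sup>2 + M + real n / (z/2)) * (\<bar>h x\<bar> + \<bar>h1 x\<bar>)" .
  qed (use b z zero[of "z/2"] h10 in auto)
  with b show False by simp
qed

end

section \<open>Regular or singular behaviour at the origin\<close>

lemma mult_divide_double: "A * (e / (2 * A)) = e / 2" if "0 < A" for A e :: real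
  using that by simp
context GL_potential begin

text \<open>\<open>Z = r\<^bsup>n+2\<^esup> (h/r)'\<close>, so \<open>Z\<close> decides between the regular and
  the singular behaviour of \<open>h\<close> at the origin.\<close>

lemma flux_derivative:
  assumes h: "solves h h1 h2" and r: "0 < r" "r < 1"
  shows "((\<lambda>r. r ^ Suc n * h1 r - r ^ n * h r) has_real_derivative - (r ^ Suc n * (q (h r) * h r))) (at r)"
    "((\<lambda>r. h r / r) has_real_derivative (r ^ Suc n * h1 r - r ^ n * h r) / r ^ (n + 2)) (at r)"
proof -
  note D = solvesD[OF h r]
  obtain k where k: "n = Suc k" using n_pos by (cases n) auto
  have e1: "((\<lambda>r. r ^ Suc n * h1 r - r ^ n * h r) has_real_derivative
      (real (Suc n) * r ^ n * h1 r + r ^ Suc n * h2 r) - (real n * r ^ (n - 1) * h r + r ^ n * h1 r)) (at r)"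
    by (auto intro!: derivative_eq_intros D simp del: power_Suc simp: algebra_simps)
  have "(real (Suc n) * r ^ n * h1 r + r ^ Suc n * h2 r) - (real n * r ^ (n - 1) * h r + r ^ n * h1 r)
      = - (r ^ Suc n * (q (h r) * h r))"
    unfolding D(3) k using r by (simp add: field_simps power2_eq_square)
  with e1 show "((\<lambda>r. r ^ Suc n * h1 r - r ^ n * h r) has_real_derivative - (r ^ Suc n * (q (h r) * h r))) (at r)"
    by simp
  have "((\<lambda>r. h r / r) has_real_derivative (h1 r * r - h r * 1) / (r * r)) (at r)"
    using r by (auto intro!: derivative_eq_intros D)
  moreover have "(h1 r * r - h r * 1) / (r * r) = (r ^ Suc n * h1 r - r ^ n * h r) / r ^ (n + 2)"
    using r by (simp add: field_simps)
  ultimately show "((\<lambda>r. h r / r) has_real_derivative (r ^ Suc n * h1 r - r ^ n * h r) / r ^ (n + 2)) (at r)"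
    by simp
qed

text \<open>Integrate (h / r)' = Z / r^(n+2) \<ge> c / r^(n+2) from s to r1: h / s is at most a
  constant minus c / ((n+1) s^(n+1)). The function V carries out this integration as a monotonicity
  statement. For c > 0, h is driven to minus infinity like s^(-n).\<close>

lemma flux_pos_singular:
  assumes h: "solves h h1 h2" and r1: "0 < r1" "r1 < 1"
    and Z: "\<And>s. 0 < s \<Longrightarrow> s \<le> r1 \<Longrightarrow> c \<le> s ^ Suc n * h1 s - s ^ n * h s"
  obtains B where "0 \<le> B" "\<And>s. 0 < s \<Longrightarrow> s \<le> r1 \<Longrightarrow> s ^ n * h s \<le> B * s - c / real (Suc n)"
proof -
  define V where "V s = h s / s + c / real (Suc n) * inverse (s ^ Suc n)" for s
  have V: "V s \<le> V r1" if s: "0 < s" "s \<le> r1" for s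
  proof (rule DERIV_nonneg_imp_nondecreasing[OF s(2)])
    fix x assume x: "s \<le> x" "x \<le> r1"
    then have x01: "0 < x" "x < 1" using s r1 by auto
    have "((\<lambda>s. inverse (s ^ Suc n)) has_real_derivative
        - (inverse (x ^ Suc n) * (real (Suc n) * x ^ n) * inverse (x ^ Suc n))) (at x)"
      using x01 by (auto intro!: derivative_eq_intros simp del: power_Suc of_nat_Suc)
    from DERIV_add[OF flux_derivative(2)[OF h x01] DERIV_cmult[OF this, of "c / real (Suc n)"]]
    have "(V has_real_derivative (x ^ Suc n * h1 x - x ^ n * h x) / x ^ (n + 2)
        + c / real (Suc n) * - (inverse (x ^ Suc n) * (real (Suc n) * x ^ n) * inverse (x ^ Suc n))) (at x)"
      unfolding V_def .
    also have "(x ^ Suc n * h1 x - x ^ n * h x) / x ^ (n + 2)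
        + c / real (Suc n) * - (inverse (x ^ Suc n) * (real (Suc n) * x ^ n) * inverse (x ^ Suc n))
        = ((x ^ Suc n * h1 x - x ^ n * h x) - c) / x ^ (n + 2)"
      using x01 by (simp add: field_simps del: of_nat_Suc)
    finally have "(V has_real_derivative ((x ^ Suc n * h1 x - x ^ n * h x) - c) / x ^ (n + 2)) (at x)" .
    moreover have "0 \<le> ((x ^ Suc n * h1 x - x ^ n * h x) - c) / x ^ (n + 2)"
      using Z[of x] x x01 by (intro divide_nonneg_pos) auto
    ultimately show "\<exists>y. (V has_real_derivative y) (at x) \<and> 0 \<le> y" by blast
  qed
  show thesis
  proof (rule that[of "\<bar>V r1\<bar>"])
    fix s assume s: "0 < s" "s \<le> r1"
    have "V s * s ^ Suc n \<le> \<bar>V r1\<bar> * s ^ Suc n"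
      using V[OF s] s by (intro mult_right_mono) auto
    also have "V s * s ^ Suc n = s ^ n * h s + c / real (Suc n)"
      using s by (simp add: V_def field_simps del: of_nat_Suc)
    also have "\<bar>V r1\<bar> * s ^ Suc n \<le> \<bar>V r1\<bar> * (s * 1)"
      using s r1 unfolding power_Suc by (intro mult_left_mono power_le_one) auto
    finally show "s ^ n * h s \<le> \<bar>V r1\<bar> * s - c / real (Suc n)" by simp
  qed simp
qed

text \<open>On [s, r] the flux varies by at most M r^(n+2). If it exceeded this amount at r, it
  would stay above some c > 0 all the way to the origin, and \<open>flux_pos_singular\<close> would
  make h unbounded.\<close>

lemma bounded_solution_flux_le:
  assumes h: "solves h h1 h2" and bd: "\<And>r. 0 < r \<Longrightarrow> r < 1 \<Longrightarrow> \<bar>h r\<bar> \<le> 1"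
    and M: "0 < M" "\<And>y. \<bar>y\<bar> \<le> 1 \<Longrightarrow> \<bar>q y\<bar> \<le> M" and r: "0 < r" "r < 1"
  shows "r ^ Suc n * h1 r - r ^ n * h r \<le> M * r ^ (n + 2)"
proof (rule ccontr)
  let ?Z = "\<lambda>r. r ^ Suc n * h1 r - r ^ n * h r"
  define c where "c = ?Z r - M * r ^ (n + 2)"
  assume "\<not> ?Z r \<le> M * r ^ (n + 2)"
  then have c: "0 < c" by (simp add: c_def)
  have "c \<le> ?Z s" if s: "0 < s" "s \<le> r" for s
  proof -
    have "\<bar>?Z r - ?Z s\<bar> \<le> (M * r ^ Suc n) * \<bar>r - s\<bar>"
    proof -
      have "norm (?Z r - ?Z s) \<le> (M * r ^ Suc n) * norm (r - s)"
      proof (rule field_differentiable_bound[of "{s..r}"])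
        fix z assume z: "z \<in> {s..r}"
        then have z01: "0 < z" "z < 1" using s r by auto
        show "(?Z has_field_derivative - (z ^ Suc n * (q (h z) * h z))) (at z within {s..r})"
          using flux_derivative(1)[OF h z01] by (rule has_field_derivative_at_within)
        have "z ^ Suc n * (\<bar>q (h z)\<bar> * \<bar>h z\<bar>) \<le> r ^ Suc n * (M * 1)"
          using z z01 bd[OF z01] M by (intro mult_mono power_mono) auto
        then show "norm (- (z ^ Suc n * (q (h z) * h z))) \<le> M * r ^ Suc n"
          using z01 by (simp add: abs_mult mult.commute)
      qed (use s in auto)
      then show ?thesis by simp
    qed
    moreover have "(M * r ^ Suc n) * \<bar>r - s\<bar> \<le> (M * r ^ Suc n) * r"
      using s r M(1) by (intro mult_left_mono) auto
    moreover have "(M * r ^ Suc n) * r = M * r ^ (n + 2)" by simp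
    ultimately show ?thesis unfolding c_def by linarith
  qed
  then obtain B where B: "0 \<le> B" "\<And>s. 0 < s \<Longrightarrow> s \<le> r \<Longrightarrow> s ^ n * h s \<le> B * s - c / real (Suc n)"
    using flux_pos_singular[OF h r, of c] by blast
  define e where "e = c / real (Suc n)"
  have e: "0 < e" using c by (simp add: e_def)
  \<comment> \<open>Small enough that (B + 1) s \<le> e / 2, which separates the lower bound -s of
    s^n h from its upper bound B s - e.\<close>
  define s where "s = min r (e / (2 * (B + 1)))"
  have s: "0 < s" "s \<le> r" using r e B(1) by (auto simp: s_def)
  have "(B + 1) * s \<le> (B + 1) * (e / (2 * (B + 1)))"
    using B(1) by (intro mult_left_mono) (auto simp: s_def)
  also have "\<dots> = e / 2" using B(1) by (intro mult_divide_double) simp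
  finally have Bs: "(B + 1) * s \<le> e / 2" .
  have "s ^ n \<le> s"
    using power_decreasing[OF n_pos, of s] s r by simp
  moreover have "\<bar>s ^ n * h s\<bar> \<le> s ^ n * 1"
    unfolding abs_mult using s r bd[of s] by (intro mult_mono) auto
  ultimately have "- s \<le> s ^ n * h s" by linarith
  moreover have "s ^ n * h s \<le> B * s - e" using B(2)[OF s] unfolding e_def .
  moreover have "(B + 1) * s = B * s + s" by (simp add: distrib_right)
  ultimately show False using Bs e by linarith
qed

text \<open>Applied to h and to -h, the flux bound says |(h / r)'| \<le> M, so h / r differs by at
  most M from its value at 1/2. The derivative h1 is recovered from the flux and h / r.\<close>

lemma bounded_solution_regular:
  assumes h: "solves h h1 h2" and bd: "\<And>r. 0 < r \<Longrightarrow> r < 1 \<Longrightarrow> \<bar>h r\<bar> \<le> 1"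
  obtains C where "0 < C" "\<And>r. 0 < r \<Longrightarrow> r < 1 \<Longrightarrow> \<bar>h r\<bar> \<le> C * r"
    "\<And>r. 0 < r \<Longrightarrow> r < 1 \<Longrightarrow> \<bar>h1 r\<bar> \<le> C"
proof -
  obtain M where M: "0 < M" "\<And>y. \<bar>y\<bar> \<le> 1 \<Longrightarrow> \<bar>q y\<bar> \<le> M"
    by (rule q_bounded_Lipschitz) blast
  let ?Z = "\<lambda>r. r ^ Suc n * h1 r - r ^ n * h r"
  have Z: "\<bar>?Z r\<bar> \<le> M * r ^ (n + 2)" if r: "0 < r" "r < 1" for r
    using bounded_solution_flux_le[OF h bd M r] bounded_solution_flux_le[OF solves_minus[OF h] _ M r] bd
    by (simp add: abs_le_iff)
  have Zq: "\<bar>?Z r / r ^ (n + 2)\<bar> \<le> M" if r: "0 < r" "r < 1" for r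
    using Z[OF r] r by (simp add: abs_divide pos_divide_le_eq)
  have le: "\<bar>h r / r\<bar> \<le> M + 2" if r: "0 < r" "r < 1" for r
  proof -
    have "norm (h r / r - h (1/2) / (1/2)) \<le> M * norm (r - 1/2)"
    proof (rule field_differentiable_bound[of "{0<..<1}"])
      fix z :: real assume "z \<in> {0<..<1}"
      then have z: "0 < z" "z < 1" by auto
      show "((\<lambda>r. h r / r) has_field_derivative ?Z z / z ^ (n + 2)) (at z within {0<..<1})"
        using flux_derivative(2)[OF h z] by (rule has_field_derivative_at_within)
      show "norm (?Z z / z ^ (n + 2)) \<le> M" using Zq[OF z] by simp
    qed (use r in auto)
    also have "\<dots> \<le> M * 1" using r M(1) by (intro mult_left_mono) auto
    finally have "\<bar>h r / r - h (1/2) / (1/2)\<bar> \<le> M" by simp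
    moreover have "\<bar>h (1/2)\<bar> \<le> 1" by (rule bd) auto
    moreover from this have "\<bar>h (1/2) / (1/2)\<bar> \<le> 2" by simp
    moreover have "\<bar>u\<bar> \<le> M + 2" if "\<bar>u - v\<bar> \<le> M" "\<bar>v\<bar> \<le> 2" for u v :: real
      using that by linarith
    ultimately show ?thesis by blast
  qed
  show thesis
  \<comment> \<open>|h / r| is at most M + 2, and |h1| at most M more.\<close>
  proof (rule that[of "2 * M + 2"])
    fix r :: real assume r: "0 < r" "r < 1"
    have "\<bar>h r\<bar> \<le> (M + 2) * r" using le[OF r] r by (simp add: abs_divide pos_divide_le_eq)
    also have "\<dots> \<le> (2 * M + 2) * r" using r M(1) by (intro mult_right_mono) auto
    finally show "\<bar>h r\<bar> \<le> (2 * M + 2) * r" .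
    have "h1 r = (?Z r / r ^ (n + 2)) * r + h r / r" using r by (simp add: field_simps)
    also have "\<bar>\<dots>\<bar> \<le> \<bar>?Z r / r ^ (n + 2)\<bar> * r + \<bar>h r / r\<bar>"
      using r by (intro order_trans[OF abs_triangle_ineq]) (simp add: abs_mult)
    also have "\<dots> \<le> M * 1 + (M + 2)"
      using r M(1) Zq[OF r] le[OF r] by (intro add_mono mult_mono) auto
    finally show "\<bar>h1 r\<bar> \<le> 2 * M + 2" by simp
  qed (use M in auto)
qed

end

section \<open>Growth of unbounded solutions, comparison of bounded ones, strict
  monotonicity\<close>

context GL_convex_potential begin

text \<open>Without local maxima above 1, a value h r1 > 1 forces h > h r1 on all of (0, r1), hence
  h1 r1 \<le> 0 and a negative flux at r1. Above 1 the flux is nondecreasing in r, so towards the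
  origin it stays at least that negative, and \<open>flux_pos_singular\<close> applies to
  -h.\<close>

lemma unbounded_solution_singular_pos:
  assumes h: "solves h h1 h2" and hc: "continuous_on {0<..1} h" and h_1: "h 1 \<le> 1"
    and r1: "0 < r1" "r1 < 1" "1 < h r1"
  obtains c \<delta> where "0 < c" "0 < \<delta>" "\<delta> < 1" "\<And>s. 0 < s \<Longrightarrow> s < \<delta> \<Longrightarrow> c \<le> s ^ n * h s"
proof -
  have gt: "h r1 < h s" if s: "0 < s" "s < r1" for s
  proof (rule ccontr)
    assume le: "\<not> h r1 < h s"
    have "continuous_on {s..1} h" using s by (intro continuous_on_subset[OF hc]) auto
    moreover have "{s..1} \<noteq> {}" using s r1 by simp
    ultimately obtain x where x: "x \<in> {s..1}" "\<And>y. y \<in> {s..1} \<Longrightarrow> h y \<le> h x"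
      using continuous_attains_sup[OF compact_Icc] by blast
    have "h r1 \<le> h x" using s r1 by (intro x) auto
    obtain y where y: "s < y" "y < 1" "h r1 \<le> h y" "\<And>z. z \<in> {s..1} \<Longrightarrow> h z \<le> h y"
    proof (cases "x = s")
      case True
      then have "\<And>z. z \<in> {s..1} \<Longrightarrow> h z \<le> h r1" using x le by force
      then show thesis using that[of r1] s r1 by auto
    next
      case False
      moreover have "x \<noteq> 1" using \<open>h r1 \<le> h x\<close> r1 h_1 by auto
      ultimately show thesis using that[of x] x \<open>h r1 \<le> h x\<close> by force
    qed
    show False
    proof (rule no_local_max_above_1[OF h])
      show "0 < y" "y < 1" using y s by auto
      show "0 < min (y - s) (1 - y)" using y by simp
      show "h z \<le> h y" if "\<bar>y - z\<bar> < min (y - s) (1 - y)" for z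
        using that by (intro y) (auto simp: abs_less_iff)
      show "1 \<le> h y" using y r1 by simp
    qed
  qed
  let ?Z = "\<lambda>r. r ^ Suc n * h1 r - r ^ n * h r"
  have "h1 r1 \<le> 0"
  proof (rule ccontr)
    assume "\<not> h1 r1 \<le> 0"
    then obtain d where d: "0 < d" "\<And>e. 0 < e \<Longrightarrow> e < d \<Longrightarrow> h (r1 - e) < h r1"
      using DERIV_pos_inc_left[OF solvesD(1)[OF h r1(1,2)]] by auto
    define e where "e = min d r1 / 2"
    have "0 < e" "e < d" "e < r1" using d(1) r1 by (auto simp: e_def min_def)
    with d(2)[of e] gt[of "r1 - e"] show False by simp
  qed
  then have "r1 ^ Suc n * h1 r1 \<le> 0" using r1 by (intro mult_nonneg_nonpos) auto
  moreover have "0 < r1 ^ n * h r1" using r1 by simp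
  ultimately have Zr1: "0 < - ?Z r1" by linarith
  have Z: "- ?Z r1 \<le> s ^ Suc n * - h1 s - s ^ n * - h s" if s: "0 < s" "s \<le> r1" for s
  proof -
    have "?Z s \<le> ?Z r1"
    proof (rule DERIV_nonneg_imp_nondecreasing[OF s(2)])
      fix x assume x: "s \<le> x" "x \<le> r1"
      then have x01: "0 < x" "x < 1" using s r1 by auto
      have "1 \<le> h x" using gt[of x] r1 x x01 by (cases "x = r1") auto
      then have "q (h x) * h x \<le> 0" using q_nonpos by (intro mult_nonpos_nonneg) auto
      then have "0 \<le> - (x ^ Suc n * (q (h x) * h x))"
        using x01 mult_nonneg_nonpos[of "x ^ Suc n"] by simp
      with flux_derivative(1)[OF h x01]
      show "\<exists>y. (?Z has_real_derivative y) (at x) \<and> 0 \<le> y" by blast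
    qed
    then show ?thesis by simp
  qed
  obtain B where B: "0 \<le> B"
    "\<And>s. 0 < s \<Longrightarrow> s \<le> r1 \<Longrightarrow> s ^ n * - h s \<le> B * s - (- ?Z r1) / real (Suc n)"
    using flux_pos_singular[OF solves_minus[OF h] r1(1,2), of "- ?Z r1"] Z by blast
  define c where "c = (- ?Z r1) / real (Suc n)"
  have c: "0 < c" using Zr1 by (simp add: c_def)
  show thesis
  \<comment> \<open>The error term B s is at most c / 2 below this radius, which leaves half of
    c.\<close>
  proof (rule that[of "c / 2" "min r1 (c / (2 * (B + 1)))"])
    fix s assume s: "0 < s" "s < min r1 (c / (2 * (B + 1)))"
    have "(B + 1) * s \<le> (B + 1) * (c / (2 * (B + 1)))"
      using B(1) s by (intro mult_left_mono) auto
    also have "\<dots> = c / 2" using B(1) by (intro mult_divide_double) simp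
    finally have "(B + 1) * s \<le> c / 2" .
    moreover have "s ^ n * - h s \<le> B * s - c" using B(2)[of s] s unfolding c_def by simp
    moreover have "(B + 1) * s = B * s + s" by (simp add: distrib_right)
    ultimately show "c / 2 \<le> s ^ n * h s" using s(1) by simp
  qed (use c r1 B(1) in auto)
qed

text \<open>J is the weighted Wronskian, and (h / f)' = J / (r^n f^2). Where h > f the Wronskian is
  nondecreasing and must be negative, since otherwise h / f could not return to 1 at r = 1. So h > f
  spreads to the left with J bounded away from 0, while the linear bounds at the origin force J to
  tend to 0.\<close>

lemma positive_solution_le:
  assumes f: "solves f f1 f2" and h: "solves h h1 h2"
    and fc: "continuous_on {0<..1} f" and hc: "continuous_on {0<..1} h"
    and f_1: "f 1 = 1" and h_1: "h 1 = 1"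
    and fpos: "\<And>r. 0 < r \<Longrightarrow> r < 1 \<Longrightarrow> 0 < f r" and hpos: "\<And>r. 0 < r \<Longrightarrow> r < 1 \<Longrightarrow> 0 < h r"
    and fbd: "\<And>r. 0 < r \<Longrightarrow> r < 1 \<Longrightarrow> \<bar>f r\<bar> \<le> C * r \<and> \<bar>f1 r\<bar> \<le> C"
    and hbd: "\<And>r. 0 < r \<Longrightarrow> r < 1 \<Longrightarrow> \<bar>h r\<bar> \<le> C * r \<and> \<bar>h1 r\<bar> \<le> C"
    and r: "0 < r" "r < 1"
  shows "h r \<le> f r"
proof (rule ccontr)
  assume "\<not> h r \<le> f r"
  then have gt: "f r < h r" by simp
  define J where "J r = r ^ n * (h1 r * f r - f1 r * h r)" for r
  have J: "(J has_real_derivative r ^ n * ((q (f r) - q (h r)) * (f r * h r))) (at r)"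
    if r: "0 < r" "r < 1" for r
  proof -
    note F = solvesD[OF f r] and H = solvesD[OF h r]
    obtain k where k: "n = Suc k" using n_pos by (cases n) auto
    have "(J has_real_derivative real n * r ^ (n - 1) * (h1 r * f r - f1 r * h r)
        + r ^ n * ((h2 r * f r + h1 r * f1 r) - (f2 r * h r + f1 r * h1 r))) (at r)"
      unfolding J_def by (auto intro!: derivative_eq_intros F H simp: algebra_simps)
    also have "real n * r ^ (n - 1) * (h1 r * f r - f1 r * h r)
        + r ^ n * ((h2 r * f r + h1 r * f1 r) - (f2 r * h r + f1 r * h1 r))
        = r ^ n * ((q (f r) - q (h r)) * (f r * h r))"
      unfolding F(3) H(3) k using r by (simp add: field_simps)
    finally show ?thesis .
  qed
  have w: "((\<lambda>r. h r / f r) has_real_derivative J r / (r ^ n * (f r)\<^sup>2)) (at r)"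
    if r: "0 < r" "r < 1" for r
  proof -
    have "((\<lambda>r. h r / f r) has_real_derivative (h1 r * f r - h r * f1 r) / (f r * f r)) (at r)"
      using fpos[OF r] by (auto intro!: derivative_eq_intros solvesD(1)[OF f r] solvesD(1)[OF h r])
    moreover have "(h1 r * f r - h r * f1 r) / (f r * f r) = J r / (r ^ n * (f r)\<^sup>2)"
      using r fpos[OF r] by (simp add: J_def power2_eq_square field_simps)
    ultimately show ?thesis by simp
  qed
  have wc: "continuous_on {a..b} (\<lambda>r. h r / f r)" if "0 < a" "b \<le> 1" for a b
  proof (intro continuous_on_divide)
    show "continuous_on {a..b} h" "continuous_on {a..b} f"
      using that by (auto intro: continuous_on_subset[OF hc] continuous_on_subset[OF fc])
    show "\<forall>x\<in>{a..b}. f x \<noteq> 0"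
      using fpos f_1 that by (metis atLeastAtMost_iff less_eq_real_def less_le_trans less_irrefl
          order_trans zero_neq_one)
  qed
  \<comment> \<open>The point where antitonicity of q, that is convexity of W, decides the
    sign.\<close>
  have J'_nonneg: "0 \<le> x ^ n * ((q (f x) - q (h x)) * (f x * h x))" if x: "0 < x" "x < 1" "f x < h x" for x
    using x fpos[of x] hpos[of x] q_antimono[of "f x" "h x"] by (intro mult_nonneg_nonneg) auto
  \<comment> \<open>If J were nonnegative at x, then h / f would be nondecreasing up to the first b
    with h b \<le> f b, which exists because both functions are 1 at 1; but h / f exceeds 1 at x and
    is at most 1 at b.\<close>
  have Jneg: "J x < 0" if x: "0 < x" "x < 1" "f x < h x" for x
  proof (rule ccontr)
    assume "\<not> J x < 0"
    then have Jx: "0 \<le> J x" by simp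
    define S where "S = {y \<in> {x..1}. h y - f y \<le> 0}"
    have "continuous_on {x..1} (\<lambda>y. h y - f y)"
      using x by (intro continuous_intros continuous_on_subset[OF hc] continuous_on_subset[OF fc]) auto
    then have "closed S" unfolding S_def by (intro continuous_on_closed_Collect_le[OF _ continuous_on_const]) auto
    then have "compact ({x..1} \<inter> S)" by (intro compact_Int_closed) simp
    moreover have "{x..1} \<inter> S = S" by (auto simp: S_def)
    moreover have "1 \<in> S" using x f_1 h_1 by (auto simp: S_def)
    ultimately obtain b where b: "b \<in> S" "\<And>t. t \<in> S \<Longrightarrow> b \<le> t"
      using compact_attains_inf[of S] by auto
    have xb: "x < b" "b \<le> 1" using b(1) x by (auto simp: S_def less_le)
    have gt: "f y < h y" if "x \<le> y" "y < b" for y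
      using b(2)[of y] that xb by (force simp: S_def)
    have Jn: "0 \<le> J y" if y: "x \<le> y" "y < b" for y
    proof -
      have "J x \<le> J y"
      proof (rule DERIV_nonneg_imp_nondecreasing[OF y(1)])
        fix z assume z: "x \<le> z" "z \<le> y"
        then have "0 < z" "z < 1" "f z < h z" using x y xb gt[of z] by auto
        with J[of z] J'_nonneg[of z] show "\<exists>l. (J has_real_derivative l) (at z) \<and> 0 \<le> l" by blast
      qed
      with Jx show ?thesis by simp
    qed
    have "h x / f x \<le> h b / f b"
    proof (rule DERIV_nonneg_imp_increasing_open[where f = "\<lambda>r. h r / f r"])
      fix y assume y: "x < y" "y < b"
      then have y01: "0 < y" "y < 1" using x xb by auto
      have "0 \<le> J y / (y ^ n * (f y)\<^sup>2)" using Jn[of y] y y01 by simp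
      with w[OF y01] show "\<exists>l. ((\<lambda>r. h r / f r) has_real_derivative l) (at y) \<and> 0 \<le> l" by blast
    qed (use xb x wc in auto)
    moreover have "1 < h x / f x" using x fpos[of x] by simp
    moreover have "h b / f b \<le> 1"
    proof -
      have "0 < f b" using fpos[of b] f_1 xb x by (cases "b = 1") auto
      then show ?thesis using b(1) by (simp add: S_def)
    qed
    ultimately show False by simp
  qed
  \<comment> \<open>Otherwise let a be the last point before r with h \<le> f. On (a, r) the
    quotient h / f decreases by \<open>Jneg\<close>, so it would be above 1 at a already.\<close>
  have wgt: "f s < h s" if s: "0 < s" "s < r" for s
  proof (rule ccontr)
    assume "\<not> f s < h s"
    define S where "S = {y \<in> {s..r}. h y - f y \<le> 0}"
    have "continuous_on {s..r} (\<lambda>y. h y - f y)"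
      using s r by (intro continuous_intros continuous_on_subset[OF hc] continuous_on_subset[OF fc]) auto
    then have "closed S" unfolding S_def by (intro continuous_on_closed_Collect_le[OF _ continuous_on_const]) auto
    then have "compact ({s..r} \<inter> S)" by (intro compact_Int_closed) simp
    moreover have "{s..r} \<inter> S = S" by (auto simp: S_def)
    moreover have "s \<in> S" using \<open>\<not> f s < h s\<close> s by (auto simp: S_def)
    ultimately obtain a where a: "a \<in> S" "\<And>t. t \<in> S \<Longrightarrow> t \<le> a"
      using compact_attains_sup[of S] by auto
    have ar: "s \<le> a" "a < r" using a(1) gt by (auto simp: S_def less_le)
    have "h a / f a \<ge> h r / f r"
    proof (rule DERIV_nonpos_imp_decreasing_open[where f = "\<lambda>r. h r / f r"])
      fix y assume y: "a < y" "y < r"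
      then have y01: "0 < y" "y < 1" using s r ar by auto
      have "f y < h y" using a(2)[of y] y ar by (force simp: S_def)
      then have "J y < 0" using Jneg y01 by blast
      moreover have "0 < y ^ n * (f y)\<^sup>2" using y01 fpos[OF y01] by simp
      ultimately have "J y / (y ^ n * (f y)\<^sup>2) \<le> 0" by (simp add: divide_neg_pos less_imp_le)
      with w[OF y01] show "\<exists>l. ((\<lambda>r. h r / f r) has_real_derivative l) (at y) \<and> l \<le> 0" by blast
    qed (use ar s r wc in auto)
    moreover have "1 < h r / f r" using gt fpos[OF r] by simp
    moreover have "h a / f a \<le> 1" using a(1) fpos[of a] ar s r by (simp add: S_def)
    ultimately show False by simp
  qed
  have Jr: "J r < 0" using Jneg r gt by blast
  have JJ: "J s \<le> J r" if s: "0 < s" "s \<le> r" for s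
  proof (rule DERIV_nonneg_imp_nondecreasing[OF s(2)])
    fix x assume x: "s \<le> x" "x \<le> r"
    then have "0 < x" "x < 1" "f x < h x" using s r wgt[of x] gt by (auto simp: le_less)
    with J[of x] J'_nonneg[of x] show "\<exists>l. (J has_real_derivative l) (at x) \<and> 0 \<le> l" by blast
  qed
  have C: "0 \<le> C" using fbd[OF r] by linarith
  have Jbd: "\<bar>J s\<bar> \<le> 2 * C\<^sup>2 * s" if s: "0 < s" "s < 1" for s
  proof -
    have "\<bar>h1 s * f s\<bar> \<le> C * (C * s)" "\<bar>f1 s * h s\<bar> \<le> C * (C * s)"
      unfolding abs_mult using fbd[OF s] hbd[OF s] C by (auto intro!: mult_mono)
    then have "\<bar>h1 s * f s - f1 s * h s\<bar> \<le> 2 * C\<^sup>2 * s"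
      by (simp add: power2_eq_square)
    then have "s ^ n * \<bar>h1 s * f s - f1 s * h s\<bar> \<le> 1 * (2 * C\<^sup>2 * s)"
      using s by (intro mult_mono power_le_one) auto
    then show ?thesis using s by (simp add: J_def abs_mult)
  qed
  \<comment> \<open>At this radius |J| is at most - J r / 2, although J s \<le> J r < 0.\<close>
  define s where "s = min r (- J r / (2 * (2 * C\<^sup>2 + 1)))"
  have s: "0 < s" "s \<le> r" using r Jr by (auto simp: s_def intro!: divide_neg_pos add_nonneg_pos)
  have "(2 * C\<^sup>2 + 1) * s \<le> (2 * C\<^sup>2 + 1) * (- J r / (2 * (2 * C\<^sup>2 + 1)))"
    by (intro mult_left_mono) (auto simp: s_def)
  also have "\<dots> = - J r / 2"
    by (intro mult_divide_double add_nonneg_pos) auto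
  finally have "(2 * C\<^sup>2 + 1) * s \<le> - J r / 2" .
  with Jbd[of s] JJ[OF s] s r Jr show False by (simp add: distrib_right)
qed

end

lemma tendsto_0_linear_bound:
  fixes h :: "real \<Rightarrow> real"
  assumes "\<And>r. 0 < r \<Longrightarrow> r < 1 \<Longrightarrow> \<bar>h r\<bar> \<le> C * r"
  shows "(h \<longlongrightarrow> 0) (at_right 0)"
proof (rule Lim_null_comparison)
  show "\<forall>\<^sub>F r in at_right 0. norm (h r) \<le> C * r"
    using assms by (auto simp: eventually_at_right_field intro!: exI[of _ 1])
  have "((\<lambda>r. C * r) \<longlongrightarrow> C * 0) (at_right 0)" by (intro tendsto_intros)
  then show "((\<lambda>r. C * r) \<longlongrightarrow> 0) (at_right 0)" by simp
qed

context GL_convex_potential begin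

lemma bounded_solution_props:
  assumes h: "solves h h1 h2" and hc: "continuous_on {0<..1} h" and h_1: "h 1 = 1"
    and bd: "\<And>r. 0 < r \<Longrightarrow> r < 1 \<Longrightarrow> \<bar>h r\<bar> \<le> 1"
  shows "\<And>r. 0 < r \<Longrightarrow> r \<le> 1 \<Longrightarrow> 0 < h r"
    and "\<And>s r. 0 < s \<Longrightarrow> s \<le> r \<Longrightarrow> r \<le> 1 \<Longrightarrow> h s \<le> h r"
proof -
  obtain C where "\<And>r. 0 < r \<Longrightarrow> r < 1 \<Longrightarrow> \<bar>h r\<bar> \<le> C * r"
    by (rule bounded_solution_regular[OF h], erule (1) bd) (rule that; assumption)
  then have lim: "(h \<longlongrightarrow> 0) (at_right 0)" by (rule tendsto_0_linear_bound)
  show pos: "0 < h r" if "0 < r" "r \<le> 1" for r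
    by (rule solution_pos[OF h hc h_1 lim that])
  show "h s \<le> h r" if "0 < s" "s \<le> r" "r \<le> 1" for s r
    using abs_solution_mono[OF h hc _ lim that] pos[of s] pos[of r] that h_1 by simp
qed

lemma bounded_solution_unique:
  assumes f: "solves f f1 f2" and h: "solves h h1 h2"
    and fc: "continuous_on {0<..1} f" and hc: "continuous_on {0<..1} h"
    and f_1: "f 1 = 1" and h_1: "h 1 = 1"
    and fbd: "\<And>r. 0 < r \<Longrightarrow> r < 1 \<Longrightarrow> \<bar>f r\<bar> \<le> 1"
    and hbd: "\<And>r. 0 < r \<Longrightarrow> r < 1 \<Longrightarrow> \<bar>h r\<bar> \<le> 1"
    and r: "0 < r" "r \<le> 1"
  shows "h r = f r"
proof (cases "r = 1")
  case True
  then show ?thesis using f_1 h_1 by simp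
next
  case False
  then have r1: "0 < r" "r < 1" using r by auto
  obtain A where A: "\<And>r. 0 < r \<Longrightarrow> r < 1 \<Longrightarrow> \<bar>f r\<bar> \<le> A * r" "\<And>r. 0 < r \<Longrightarrow> r < 1 \<Longrightarrow> \<bar>f1 r\<bar> \<le> A"
    by (rule bounded_solution_regular[OF f], erule (1) fbd) (rule that; assumption)
  obtain B where B: "\<And>r. 0 < r \<Longrightarrow> r < 1 \<Longrightarrow> \<bar>h r\<bar> \<le> B * r" "\<And>r. 0 < r \<Longrightarrow> r < 1 \<Longrightarrow> \<bar>h1 r\<bar> \<le> B"
    by (rule bounded_solution_regular[OF h], erule (1) hbd) (rule that; assumption)
  define C where "C = max A B"
  have fC: "\<bar>f r\<bar> \<le> C * r \<and> \<bar>f1 r\<bar> \<le> C" if r: "0 < r" "r < 1" for r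
  proof -
    have "A \<le> C" by (simp add: C_def)
    then have "A * r \<le> C * r" using r by (intro mult_right_mono) auto
    with A[OF r] \<open>A \<le> C\<close> show ?thesis by linarith
  qed
  have hC: "\<bar>h r\<bar> \<le> C * r \<and> \<bar>h1 r\<bar> \<le> C" if r: "0 < r" "r < 1" for r
  proof -
    have "B \<le> C" by (simp add: C_def)
    then have "B * r \<le> C * r" using r by (intro mult_right_mono) auto
    with B[OF r] \<open>B \<le> C\<close> show ?thesis by linarith
  qed
  have fp: "0 < f r" if "0 < r" "r < 1" for r
    by (rule bounded_solution_props(1)[OF f fc f_1 fbd]) (use that in auto)
  have hp: "0 < h r" if "0 < r" "r < 1" for r
    by (rule bounded_solution_props(1)[OF h hc h_1 hbd]) (use that in auto)
  show ?thesis
    using positive_solution_le[OF f h fc hc f_1 h_1 fp hp fC hC r1]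
      positive_solution_le[OF h f hc fc h_1 f_1 hp fp hC fC r1] by simp
qed

lemma unbounded_solution_singular:
  assumes h: "solves h h1 h2" and hc: "continuous_on {0<..1} h" and h_1: "h 1 = 1"
    and r1: "0 < r1" "r1 < 1" "1 < \<bar>h r1\<bar>"
  obtains c \<delta> where "0 < c" "0 < \<delta>" "\<delta> < 1" "\<And>s. 0 < s \<Longrightarrow> s < \<delta> \<Longrightarrow> c \<le> s ^ n * \<bar>h s\<bar>"
proof (cases "0 < h r1")
  case True
  with r1 have "1 < h r1" by simp
  then obtain c \<delta> where c: "0 < c" "0 < \<delta>" "\<delta> < 1" "\<And>s. 0 < s \<Longrightarrow> s < \<delta> \<Longrightarrow> c \<le> s ^ n * h s"
    using unbounded_solution_singular_pos[OF h hc _ r1(1,2)] h_1 by auto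
  show thesis
  proof (rule that[OF c(1-3)])
    fix s assume s: "0 < s" "s < \<delta>"
    have "s ^ n * h s \<le> s ^ n * \<bar>h s\<bar>" using s by (intro mult_left_mono) auto
    with c(4)[OF s] show "c \<le> s ^ n * \<bar>h s\<bar>" by simp
  qed
next
  case False
  with r1 have "1 < - h r1" by simp
  moreover have "- h 1 \<le> 1" using h_1 by simp
  ultimately obtain c \<delta> where c: "0 < c" "0 < \<delta>" "\<delta> < 1" "\<And>s. 0 < s \<Longrightarrow> s < \<delta> \<Longrightarrow> c \<le> s ^ n * - h s"
    using unbounded_solution_singular_pos[OF solves_minus[OF h] continuous_on_minus[OF hc] _ r1(1,2)] by blast
  show thesis
  proof (rule that[OF c(1-3)])
    fix s assume s: "0 < s" "s < \<delta>"
    have "s ^ n * - h s \<le> s ^ n * \<bar>h s\<bar>" using s by (intro mult_left_mono) auto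
    with c(4)[OF s] show "c \<le> s ^ n * \<bar>h s\<bar>" by simp
  qed
qed

text \<open>Monotonicity gives only f1 \<ge> 0. With \<kappa> = n / r^2 - q(f) one has (r^n f1)' =
  r^n \<kappa> f. An interior zero of f1 is a minimum of f1, so \<kappa> vanishes there; it then
  turns negative and pushes f1 below 0. At r = 1, \<kappa> = n > 0, so r^n f1 arrives strictly
  increasing from nonnegative values.\<close>

lemma profile_derivative_pos:
  assumes F: "\<And>r. r \<in> {0<..1} \<Longrightarrow> (f has_real_derivative f1 r) (at r within {0..1})"
    and F1: "\<And>r. r \<in> {0<..1} \<Longrightarrow> (f1 has_real_derivative f2 r) (at r within {0..1})"
    and eq: "\<And>r. r \<in> {0<..1} \<Longrightarrow> f2 r + real n / r * f1 r - real n / r\<^sup>2 * f r = - (q (f r) * f r)"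
    and f_1: "f 1 = 1" and f01: "\<And>r. r \<in> {0<..<1} \<Longrightarrow> 0 < f r \<and> f r < 1"
    and r0: "r0 \<in> {0<..1}"
  shows "0 < f1 r0"
proof -
  have at: "(f has_real_derivative f1 r) (at r)" "(f1 has_real_derivative f2 r) (at r)"
    if "0 < r" "r < 1" for r
    using F[of r] F1[of r] that by (auto simp: at_within_Icc_at)
  have f: "solves f f1 f2" unfolding solves_def using at eq by auto
  have fc: "continuous_on {0<..1} f"
    by (rule DERIV_continuous_on[OF DERIV_subset[OF F]]) auto
  have mono: "f s \<le> f r" if "0 < s" "s \<le> r" "r \<le> 1" for s r
  proof (rule bounded_solution_props(2)[OF f fc f_1 _ that])
    show "\<bar>f r\<bar> \<le> 1" if "0 < r" "r < 1" for r using f01[of r] that by auto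
  qed
  have fpos: "0 < f r" if "r \<in> {0<..1}" for r
    using f01[of r] f_1 that by (cases "r = 1") auto
  have nn: "0 \<le> f1 r" if r: "r \<in> {0<..1}" for r
  proof (rule ccontr)
    assume "\<not> 0 \<le> f1 r"
    then obtain d where d: "0 < d" "\<And>e. 0 < e \<Longrightarrow> r - e \<in> {0..1} \<Longrightarrow> e < d \<Longrightarrow> f r < f (r - e)"
      using has_real_derivative_neg_dec_left[OF F[OF r]] by auto
    define e where "e = min d r / 2"
    have "0 < e" "e < d" "e < r" using d(1) r by (auto simp: e_def min_def)
    with d(2)[of e] mono[of "r - e" r] r show False by auto
  qed
  have "f1 r0 \<noteq> 0"
  proof
    assume z: "f1 r0 = 0"
    define \<kappa> where "\<kappa> r = real n / r\<^sup>2 - q (f r)" for r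
    have Y: "((\<lambda>r. r ^ n * f1 r) has_real_derivative r ^ n * (\<kappa> r * f r)) (at r)"
      if r: "0 < r" "r < 1" for r
    proof -
      obtain k where k: "n = Suc k" using n_pos by (cases n) auto
      have "((\<lambda>r. r ^ n * f1 r) has_real_derivative real n * r ^ (n - 1) * f1 r + r ^ n * f2 r) (at r)"
        by (auto intro!: derivative_eq_intros at[OF r])
      also have "real n * r ^ (n - 1) * f1 r + r ^ n * f2 r = r ^ n * (\<kappa> r * f r)"
        unfolding solvesD(3)[OF f r] k \<kappa>_def using r by (simp add: field_simps)
      finally show ?thesis .
    qed
    show False
    proof (cases "r0 = 1")
      case False
      then have r: "0 < r0" "r0 < 1" using r0 by auto
      have "f2 r0 = 0"
      proof (rule DERIV_local_min[OF at(2)[OF r], of "min r0 (1 - r0)"])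
        show "\<forall>y. \<bar>r0 - y\<bar> < min r0 (1 - r0) \<longrightarrow> f1 r0 \<le> f1 y"
        proof (intro allI impI)
          fix y assume "\<bar>r0 - y\<bar> < min r0 (1 - r0)"
          then have "y \<in> {0<..1}" by (auto simp: abs_less_iff)
          with z nn show "f1 r0 \<le> f1 y" by simp
        qed
      qed (use r in simp)
      then have "real n / r0\<^sup>2 * f r0 = q (f r0) * f r0" using eq[OF r0] z by simp
      moreover have "f r0 \<noteq> 0" using fpos[OF r0] by simp
      ultimately have "real n / r0\<^sup>2 = q (f r0)" using mult_right_cancel by blast
      then have k0: "\<kappa> r0 = 0" by (simp add: \<kappa>_def)
      \<comment> \<open>Since f1 vanishes at r0, only the derivative of n / r^2 survives, and it is
        negative.\<close>
      have "(\<kappa> has_real_derivative real n * - (inverse (r0\<^sup>2) * (2 * r0) * inverse (r0\<^sup>2)) - f1 r0 * q' (f r0)) (at r0)"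
        unfolding \<kappa>_def divide_inverse using r
        by (auto intro!: derivative_eq_intros DERIV_chain'[OF at(1)[OF r] q_deriv])
      moreover have "real n * - (inverse (r0\<^sup>2) * (2 * r0) * inverse (r0\<^sup>2)) - f1 r0 * q' (f r0) < 0"
        using r n_pos z by simp
      ultimately obtain d where d: "0 < d" "\<And>e. 0 < e \<Longrightarrow> e < d \<Longrightarrow> \<kappa> (r0 + e) < \<kappa> r0"
        using DERIV_neg_dec_right by blast
      define e where "e = min d (1 - r0) / 2"
      have e: "0 < e" "e < d" "r0 + e < 1" using d(1) r by (auto simp: e_def min_def field_simps)
      have "(r0 + e) ^ n * f1 (r0 + e) < r0 ^ n * f1 r0"
      proof (rule DERIV_neg_imp_decreasing_open[where f = "\<lambda>r. r ^ n * f1 r"])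
        fix x assume x: "r0 < x" "x < r0 + e"
        then have x01: "0 < x" "x < 1" using r e by auto
        have "\<kappa> x < 0" using d(2)[of "x - r0"] x e k0 by simp
        then have "x ^ n * (\<kappa> x * f x) < 0"
          using x01 fpos[of x] by (simp add: mult_pos_neg mult_neg_pos)
        with Y[OF x01] show "\<exists>y. ((\<lambda>r. r ^ n * f1 r) has_real_derivative y) (at x) \<and> y < 0" by blast
      next
        have "isCont (\<lambda>r. r ^ n * f1 r) x" if "x \<in> {r0..r0 + e}" for x
          using that r e by (intro DERIV_isCont[OF Y]) auto
        then show "continuous_on {r0..r0 + e} (\<lambda>r. r ^ n * f1 r)"
          by (auto intro: continuous_at_imp_continuous_on)
      qed (use e in simp)
      then have "(r0 + e) ^ n * f1 (r0 + e) < 0" using z by simp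
      moreover have "0 \<le> (r0 + e) ^ n * f1 (r0 + e)"
        using nn[of "r0 + e"] r e by (intro mult_nonneg_nonneg) auto
      ultimately show False by simp
    next
      case True
      have fc: "continuous_on {1/2..1} f"
        by (rule continuous_on_subset[OF fc]) auto
      have "continuous_on {1/2..1} \<kappa>"
        unfolding \<kappa>_def by (intro continuous_intros fc continuous_on_compose2[OF q_cont[of UNIV]]) auto
      then have "(\<kappa> \<longlongrightarrow> \<kappa> 1) (at 1 within {1/2..1})" by (auto simp: continuous_on_def)
      moreover have "0 < \<kappa> 1" using n_pos by (simp add: \<kappa>_def f_1 q_1)
      ultimately have "\<forall>\<^sub>F x in at 1 within {1/2..1}. 0 < \<kappa> x" by (rule order_tendstoD)
      then obtain d where d: "0 < d" "\<And>x. x \<in> {1/2..1} \<Longrightarrow> x \<noteq> 1 \<Longrightarrow> \<bar>x - 1\<bar> < d \<Longrightarrow> 0 < \<kappa> x"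
        unfolding eventually_at dist_real_def by auto
      define a where "a = 1 - min d (1/2) / 2"
      have a: "1/2 < a" "a < 1" "1 - a < d" using d(1) by (auto simp: a_def min_def field_simps)
      have "a ^ n * f1 a < 1 ^ n * f1 1"
      proof (rule DERIV_pos_imp_increasing_open[where f = "\<lambda>r. r ^ n * f1 r"])
        fix x assume x: "a < x" "x < 1"
        then have x01: "0 < x" "x < 1" using a by auto
        have "0 < \<kappa> x" using d(2)[of x] x a by simp
        then have "0 < x ^ n * (\<kappa> x * f x)" using x01 fpos[of x] by simp
        with Y[OF x01] show "\<exists>y. ((\<lambda>r. r ^ n * f1 r) has_real_derivative y) (at x) \<and> 0 < y" by blast
      next
        have "continuous_on {a..1} f1"
          by (rule DERIV_continuous_on[OF DERIV_subset[OF F1]]) (use a in auto)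
        then show "continuous_on {a..1} (\<lambda>r. r ^ n * f1 r)" by (intro continuous_intros)
      qed (rule a)
      moreover have "0 \<le> a ^ n * f1 a" using nn[of a] a by simp
      ultimately show False using z True by simp
    qed
  qed
  with nn[OF r0] show ?thesis by simp
qed

end

section \<open>Weak derivatives\<close>

lemma has_real_derivative_along:
  fixes \<psi> :: "'a::euclidean_space \<Rightarrow> real"
  assumes "(\<psi> has_derivative \<psi>') (at (x + t *\<^sub>R v))"
  shows "((\<lambda>t. \<psi> (x + t *\<^sub>R v)) has_real_derivative \<psi>' v) (at t)"
proof -
  have "((\<lambda>t. x + t *\<^sub>R v) has_derivative (\<lambda>s. s *\<^sub>R v)) (at t)"
    by (auto intro!: derivative_eq_intros)
  from has_derivative_compose[OF this assms]
  have "((\<lambda>t. \<psi> (x + t *\<^sub>R v)) has_derivative (\<lambda>s. \<psi>' (s *\<^sub>R v))) (at t)" .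
  moreover have "(\<lambda>s. \<psi>' (s *\<^sub>R v)) = (*) (\<psi>' v)"
    using has_derivative_bounded_linear[OF assms] by (auto simp: linear_simps)
  ultimately show ?thesis by (simp add: has_field_derivative_def)
qed

lemma integrable_continuous_compact_support:
  fixes \<psi> :: "'a::euclidean_space \<Rightarrow> real"
  assumes "continuous_on UNIV \<psi>" "compact K" "\<And>x. x \<notin> K \<Longrightarrow> \<psi> x = 0"
  shows "integrable lborel \<psi>"
proof -
  have "integrable lborel (\<lambda>x. indicator K x *\<^sub>R \<psi> x)"
    by (intro borel_integrable_compact assms continuous_on_subset[OF assms(1)]) auto
  moreover have "(\<lambda>x. indicator K x *\<^sub>R \<psi> x) = \<psi>"
    using assms(3) by (auto simp: indicator_def fun_eq_iff)
  ultimately show ?thesis by simp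
qed

text \<open>Translation invariance makes the integral of every difference quotient vanish; dominated
  convergence passes to the derivative. This gives the divergence theorem needed here without
  iterated integrals.\<close>

lemma integral_directional_derivative_eq_0:
  fixes \<psi> :: "'a::euclidean_space \<Rightarrow> real"
  assumes \<psi>: "\<And>x. (\<psi> has_derivative \<psi>' x) (at x)" and \<psi>'c: "continuous_on UNIV (\<lambda>x. \<psi>' x v)"
    and K: "compact K" "\<And>x. x \<notin> K \<Longrightarrow> \<psi> x = 0"
  shows "integral\<^sup>L lborel (\<lambda>x. \<psi>' x v) = 0"
proof -
  have \<psi>c: "continuous_on UNIV \<psi>"
    using \<psi> by (meson continuous_at_imp_continuous_on has_derivative_continuous)
  have \<psi>i: "integrable lborel \<psi>"
    by (rule integrable_continuous_compact_support[OF \<psi>c K])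
  define t where "t k = inverse (real (Suc k))" for k
  have t: "0 < t k" "t k \<le> 1" for k by (auto simp: t_def field_simps)
  have t0: "t \<longlonglongrightarrow> 0" unfolding t_def by (rule LIMSEQ_inverse_real_of_nat)
  define D where "D k x = (\<psi> (x + t k *\<^sub>R v) - \<psi> x) / t k" for k x
  have zero: "\<psi>' x v = 0" if "x \<notin> K" for x
  proof -
    have "open (- K)" using K(1) by (simp add: compact_imp_closed open_Compl)
    then have "((\<lambda>_. 0) has_derivative \<psi>' x) (at x)"
      by (rule has_derivative_transform_within_open[OF \<psi>]) (use that K in auto)
    then have "\<psi>' x = (\<lambda>_. 0)" using has_derivative_unique has_derivative_const by blast
    then show ?thesis by simp
  qed
  obtain B where B: "\<And>x. x \<in> K \<Longrightarrow> \<bar>\<psi>' x v\<bar> \<le> B"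
    using compact_imp_bounded[OF compact_continuous_image[OF continuous_on_subset[OF \<psi>'c] K(1)]]
    unfolding bounded_iff by auto
  have Bd: "\<bar>\<psi>' x v\<bar> \<le> \<bar>B\<bar>" for x
    using B[of x] zero[of x] by (cases "x \<in> K") auto
  \<comment> \<open>K swept backwards along v by at most 1; since the increments are at most 1, it
    contains the supports of all difference quotients.\<close>
  define L where "L = (\<lambda>(x, s). x - s *\<^sub>R v) ` (K \<times> {0..1})"
  have L: "compact L" unfolding L_def split_def
    by (intro compact_continuous_image continuous_intros compact_Times K) auto
  have KL: "x + s *\<^sub>R v \<notin> K" if "x \<notin> L" "s \<in> {0..1}" for x s
  proof
    assume "x + s *\<^sub>R v \<in> K"
    then have "(x + s *\<^sub>R v) - s *\<^sub>R v \<in> L"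
      unfolding L_def using that(2) by (intro image_eqI[of _ _ "(x + s *\<^sub>R v, s)"]) auto
    with that(1) show False by simp
  qed
  have D_le: "\<bar>D k x\<bar> \<le> indicator L x *\<^sub>R \<bar>B\<bar>" for k x
  proof (cases "x \<in> L")
    case True
    have "norm (\<psi> (x + t k *\<^sub>R v) - \<psi> (x + 0 *\<^sub>R v)) \<le> \<bar>B\<bar> * norm (t k - 0)"
    proof (rule field_differentiable_bound[of UNIV "\<lambda>s. \<psi> (x + s *\<^sub>R v)"])
      show "((\<lambda>s. \<psi> (x + s *\<^sub>R v)) has_field_derivative \<psi>' (x + s *\<^sub>R v) v) (at s within UNIV)" for s
        using has_real_derivative_along[OF \<psi>] by simp
    qed (use Bd in auto)
    then show ?thesis using True t[of k] by (simp add: D_def pos_divide_le_eq)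
  next
    case False
    then have "\<psi> x = 0" "\<psi> (x + t k *\<^sub>R v) = 0"
      using KL[of x 0] KL[of x "t k"] K(2) t[of k] by auto
    then show ?thesis using False by (simp add: D_def)
  qed
  have D_lim: "(\<lambda>k. D k x) \<longlonglongrightarrow> \<psi>' x v" for x
  proof -
    have "((\<lambda>s. \<psi> (x + s *\<^sub>R v)) has_real_derivative \<psi>' x v) (at 0)"
      using has_real_derivative_along[of \<psi> "\<psi>' x" x 0 v] \<psi>[of x] by simp
    then have "((\<lambda>s. (\<psi> (x + s *\<^sub>R v) - \<psi> x) / s) \<longlongrightarrow> \<psi>' x v) (at 0)"
      by (simp add: DERIV_def)
    moreover have "filterlim t (at 0) sequentially"
      using t0 t(1) by (auto simp: filterlim_at intro!: always_eventually less_imp_neq[symmetric])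
    ultimately show ?thesis
      unfolding D_def by (rule filterlim_compose)
  qed
  have shift: "integrable lborel (\<lambda>x. \<psi> (x + c))" "integral\<^sup>L lborel (\<lambda>x. \<psi> (x + c)) = integral\<^sup>L lborel \<psi>" for c
  proof -
    have m: "(+) c \<in> borel_measurable borel" "\<psi> \<in> borel_measurable borel"
      using \<psi>c by (auto intro: borel_measurable_continuous_onI)
    have "integrable (distr lborel borel ((+) c)) \<psi>" using \<psi>i by (simp add: lborel_distr_plus)
    then show "integrable lborel (\<lambda>x. \<psi> (x + c))"
      using m by (subst (asm) integrable_distr_eq) (auto simp: add.commute)
    have "integral\<^sup>L lborel \<psi> = integral\<^sup>L (distr lborel borel ((+) c)) \<psi>" by (simp add: lborel_distr_plus)
    also have "\<dots> = integral\<^sup>L lborel (\<lambda>x. \<psi> (x + c))"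
      using m by (subst integral_distr) (auto simp: add.commute)
    finally show "integral\<^sup>L lborel (\<lambda>x. \<psi> (x + c)) = integral\<^sup>L lborel \<psi>" ..
  qed
  have D0: "integral\<^sup>L lborel (D k) = 0" for k
    unfolding D_def using \<psi>i shift by simp
  have "(\<lambda>k. integral\<^sup>L lborel (D k)) \<longlonglongrightarrow> integral\<^sup>L lborel (\<lambda>x. \<psi>' x v)"
  proof (rule integral_dominated_convergence)
    show "(\<lambda>x. \<psi>' x v) \<in> borel_measurable lborel"
      using borel_measurable_continuous_onI[OF \<psi>'c] by simp
    show "D k \<in> borel_measurable lborel" for k
    proof -
      have "continuous_on UNIV (D k)"
        unfolding D_def using t(1)[of k]
        by (intro continuous_intros continuous_on_compose2[OF \<psi>c] \<psi>c) auto
      from borel_measurable_continuous_onI[OF this] show ?thesis by simp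
    qed
    show "integrable lborel (\<lambda>x. indicator L x *\<^sub>R \<bar>B\<bar>)"
      by (intro borel_integrable_compact L continuous_intros)
  qed (use D_lim D_le in auto)
  then show ?thesis using D0 by (simp add: LIMSEQ_const_iff)
qed

text \<open>Moves integrals from the restricted Lebesgue measure of the definitions to
  \<open>lborel\<close>, where translation and continuity arguments are carried out.\<close>

lemma integral_lebesgue_on_continuous_extension:
  fixes a b :: "'a::euclidean_space \<Rightarrow> real"
  assumes V: "open V" and b: "continuous_on UNIV b" "integrable lborel b"
    and eq: "\<And>x. x \<in> V \<Longrightarrow> a x = b x" "\<And>x. x \<notin> V \<Longrightarrow> b x = 0"
  shows "integrable (lebesgue_on V) a" "integral\<^sup>L (lebesgue_on V) a = integral\<^sup>L lborel b"
proof -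
  have ind: "(\<lambda>x. indicator V x *\<^sub>R a x) = b"
    using eq by (auto simp: indicator_def fun_eq_iff)
  have V': "V \<inter> space lebesgue \<in> sets lebesgue" using V by auto
  have m: "b \<in> borel_measurable lborel" using b by auto
  show "integrable (lebesgue_on V) a"
    using V' b(2) m by (simp add: integrable_restrict_space ind[unfolded real_scaleR_def] integrable_completion)
  show "integral\<^sup>L (lebesgue_on V) a = integral\<^sup>L lborel b"
    using V' m by (simp add: integral_restrict_space ind[unfolded real_scaleR_def] integral_completion)
qed

text \<open>The product of u and \<phi>, extended by 0 outside V, is differentiable everywhere with
  continuous derivative along v: V and the complement of the compact support are open and cover the
  space. Its derivative integrates to 0.\<close>

lemma integral_by_parts_test_function:
  fixes u \<phi> :: "'a::euclidean_space \<Rightarrow> real"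
  assumes V: "open V" and u: "\<And>x. x \<in> V \<Longrightarrow> (u has_derivative u' x) (at x)"
    and u'c: "continuous_on V (\<lambda>x. u' x v)"
    and \<phi>: "\<And>x. (\<phi> has_derivative \<phi>' x) (at x)" and \<phi>'c: "continuous_on UNIV (\<lambda>x. \<phi>' x v)"
    and K: "compact (closure {x. \<phi> x \<noteq> 0})" "closure {x. \<phi> x \<noteq> 0} \<subseteq> V"
  shows "integrable (lebesgue_on V) (\<lambda>x. u x * \<phi>' x v)"
    "integrable (lebesgue_on V) (\<lambda>x. u' x v * \<phi> x)"
    "integral\<^sup>L (lebesgue_on V) (\<lambda>x. u x * \<phi>' x v) = - integral\<^sup>L (lebesgue_on V) (\<lambda>x. u' x v * \<phi> x)"
proof -
  define K where "K = closure {x. \<phi> x \<noteq> 0}"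
  note K = K[folded K_def]
  have oK: "open (- K)" by (simp add: K_def open_Compl)
  have \<phi>0: "\<phi> x = 0" if "x \<notin> K" for x
    using that closure_subset[of "{x. \<phi> x \<noteq> 0}"] by (auto simp: K_def)
  have \<phi>'0: "\<phi>' x v = 0" if "x \<notin> K" for x
  proof -
    have "((\<lambda>_. 0) has_derivative \<phi>' x) (at x)"
      by (rule has_derivative_transform_within_open[OF \<phi> oK]) (use that \<phi>0 in auto)
    then have "\<phi>' x = (\<lambda>_. 0)" using has_derivative_unique has_derivative_const by blast
    then show ?thesis by simp
  qed
  define a where "a x = (if x \<in> V then u x * \<phi>' x v else 0)" for x
  define b where "b x = (if x \<in> V then u' x v * \<phi> x else 0)" for x
  have uc: "continuous_on V u"
    using u by (meson continuous_at_imp_continuous_on has_derivative_continuous)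
  have \<phi>c: "continuous_on UNIV \<phi>"
    using \<phi> by (meson continuous_at_imp_continuous_on has_derivative_continuous)
  have VK: "V \<union> - K = UNIV" using K by auto
  have ac: "continuous_on UNIV a"
  proof -
    have "continuous_on V (\<lambda>x. u x * \<phi>' x v)"
      by (intro continuous_intros uc continuous_on_subset[OF \<phi>'c]) auto
    then have "continuous_on V a" by (rule continuous_on_eq) (simp add: a_def)
    moreover have "continuous_on (- K) a"
      by (rule continuous_on_eq[OF continuous_on_const[of _ 0]]) (use \<phi>'0 in \<open>auto simp: a_def\<close>)
    ultimately show ?thesis using continuous_on_open_Un[OF V oK, of a] VK by simp
  qed
  have bc: "continuous_on UNIV b"
  proof -
    have "continuous_on V (\<lambda>x. u' x v * \<phi> x)"
      by (intro continuous_intros u'c continuous_on_subset[OF \<phi>c]) auto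
    then have "continuous_on V b" by (rule continuous_on_eq) (simp add: b_def)
    moreover have "continuous_on (- K) b"
      by (rule continuous_on_eq[OF continuous_on_const[of _ 0]]) (use \<phi>0 in \<open>auto simp: b_def\<close>)
    ultimately show ?thesis using continuous_on_open_Un[OF V oK, of b] VK by simp
  qed
  have ai: "integrable lborel a"
    by (rule integrable_continuous_compact_support[OF ac K(1)]) (simp add: a_def \<phi>'0)
  have bi: "integrable lborel b"
    by (rule integrable_continuous_compact_support[OF bc K(1)]) (simp add: b_def \<phi>0)
  define \<psi> where "\<psi> x = (if x \<in> V then u x * \<phi> x else 0)" for x
  define \<psi>' where "\<psi>' x h = (if x \<in> V then u x * \<phi>' x h + u' x h * \<phi> x else 0)" for x h
  have \<psi>: "(\<psi> has_derivative \<psi>' x) (at x)" for x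
  proof (cases "x \<in> V")
    case True
    have "((\<lambda>x. u x * \<phi> x) has_derivative (\<lambda>h. u x * \<phi>' x h + u' x h * \<phi> x)) (at x)"
      by (rule has_derivative_mult[OF u[OF True] \<phi>])
    then have "(\<psi> has_derivative (\<lambda>h. u x * \<phi>' x h + u' x h * \<phi> x)) (at x)"
      by (rule has_derivative_transform_within_open[OF _ V True]) (simp add: \<psi>_def)
    then show ?thesis using True by (simp add: \<psi>'_def[abs_def])
  next
    case False
    then have x: "x \<in> - K" using K by auto
    have "((\<lambda>x. 0) has_derivative (\<lambda>h. 0)) (at x)" by simp
    then have "(\<psi> has_derivative (\<lambda>h. 0)) (at x)"
      by (rule has_derivative_transform_within_open[OF _ oK x]) (use \<phi>0 in \<open>auto simp: \<psi>_def\<close>)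
    then show ?thesis using False by (simp add: \<psi>'_def[abs_def])
  qed
  have eq: "(\<lambda>x. \<psi>' x v) = (\<lambda>x. a x + b x)" by (auto simp: \<psi>'_def a_def b_def)
  have "integral\<^sup>L lborel (\<lambda>x. \<psi>' x v) = 0"
  proof (rule integral_directional_derivative_eq_0[OF \<psi> _ K(1)])
    show "continuous_on UNIV (\<lambda>x. \<psi>' x v)"
      unfolding eq by (intro continuous_intros ac bc)
  qed (simp add: \<psi>_def \<phi>0)
  then have "integral\<^sup>L lborel (\<lambda>x. a x + b x) = 0" unfolding eq .
  then have ab: "integral\<^sup>L lborel a = - integral\<^sup>L lborel b"
    using ai bi by simp
  note A = integral_lebesgue_on_continuous_extension[OF V ac ai, of "\<lambda>x. u x * \<phi>' x v"]
  note B = integral_lebesgue_on_continuous_extension[OF V bc bi, of "\<lambda>x. u' x v * \<phi> x"]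
  show "integrable (lebesgue_on V) (\<lambda>x. u x * \<phi>' x v)" by (rule A) (auto simp: a_def)
  show "integrable (lebesgue_on V) (\<lambda>x. u' x v * \<phi> x)" by (rule B) (auto simp: b_def)
  show "integral\<^sup>L (lebesgue_on V) (\<lambda>x. u x * \<phi>' x v) = - integral\<^sup>L (lebesgue_on V) (\<lambda>x. u' x v * \<phi> x)"
    using A(2) B(2) ab by (simp add: a_def b_def)
qed

lemma weak_partial_C1:
  fixes u :: "real^'n \<Rightarrow> real"
  assumes "open V" "\<And>x. x \<in> V \<Longrightarrow> (u has_derivative u' x) (at x)"
    and "continuous_on V (\<lambda>x. u' x (axis j 1))"
  shows "weak_partial V j u (\<lambda>x. u' x (axis j 1))"
  unfolding weak_partial_def
proof (intro allI impI)
  fix \<phi> assume \<phi>: "test_fun V \<phi>"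
  show "integrable (lebesgue_on V) (\<lambda>x. u x * frechet_derivative \<phi> (at x) (axis j 1)) \<and>
    integrable (lebesgue_on V) (\<lambda>x. u' x (axis j 1) * \<phi> x) \<and>
    integral\<^sup>L (lebesgue_on V) (\<lambda>x. u x * frechet_derivative \<phi> (at x) (axis j 1))
      = - integral\<^sup>L (lebesgue_on V) (\<lambda>x. u' x (axis j 1) * \<phi> x)"
    using integral_by_parts_test_function[OF assms, where \<phi> = \<phi> and \<phi>' = "\<lambda>x. frechet_derivative \<phi> (at x)"] \<phi>
    by (auto simp: test_fun_def frechet_derivative_works)
qed

lemma weak_deriv1_C1:
  assumes V: "open V" and u: "\<And>x. x \<in> V \<Longrightarrow> (u has_real_derivative u' x) (at x)"
    and u'c: "continuous_on V u'"
  shows "weak_deriv1 V u u'"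
  unfolding weak_deriv1_def
proof (intro allI impI)
  fix \<phi> assume \<phi>: "test_fun1 V \<phi>"
  have \<phi>': "(\<phi> has_derivative (*) (deriv \<phi> x)) (at x)" for x
    using \<phi> unfolding test_fun1_def
    by (metis DERIV_deriv_iff_real_differentiable has_field_derivative_def)
  show "integrable (lebesgue_on V) (\<lambda>x. u x * deriv \<phi> x) \<and>
    integrable (lebesgue_on V) (\<lambda>x. u' x * \<phi> x) \<and>
    integral\<^sup>L (lebesgue_on V) (\<lambda>x. u x * deriv \<phi> x) = - integral\<^sup>L (lebesgue_on V) (\<lambda>x. u' x * \<phi> x)"
    using integral_by_parts_test_function[OF V, of u "\<lambda>x. (*) (u' x)" 1 \<phi> "\<lambda>x. (*) (deriv \<phi> x)"]
      u u'c \<phi> \<phi>' by (auto simp: test_fun1_def has_field_derivative_def)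
qed

section \<open>Square integrability and radial fields on the ball\<close>

lemma L2_on_cong:
  assumes "\<And>x. x \<in> V \<Longrightarrow> a x = b x"
  shows "L2_on V a \<longleftrightarrow> L2_on V b"
proof -
  have eq: "\<And>x. x \<in> space (lebesgue_on V) \<Longrightarrow> a x = b x"
    using assms by (simp add: space_restrict_space)
  have "a \<in> borel_measurable (lebesgue_on V) \<longleftrightarrow> b \<in> borel_measurable (lebesgue_on V)"
    by (rule measurable_cong[OF eq])
  moreover have "integrable (lebesgue_on V) (\<lambda>x. (a x)\<^sup>2) \<longleftrightarrow> integrable (lebesgue_on V) (\<lambda>x. (b x)\<^sup>2)"
    by (rule Bochner_Integration.integrable_cong) (use eq in auto)
  ultimately show ?thesis by (simp add: L2_on_def)
qed

lemma L2_on_continuous: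
  fixes w :: "'a::euclidean_space \<Rightarrow> real"
  assumes "compact C" "continuous_on C w" "V \<in> lmeasurable" "V \<subseteq> C"
  shows "L2_on V w"
proof -
  obtain B where B: "\<And>x. x \<in> C \<Longrightarrow> \<bar>w x\<bar> \<le> B"
    using compact_imp_bounded[OF compact_continuous_image[OF assms(2,1)]]
    unfolding bounded_iff by auto
  have m: "w \<in> borel_measurable (lebesgue_on V)"
    using assms continuous_on_subset
    by (intro continuous_imp_measurable_on_sets_lebesgue) (auto simp: fmeasurableD)
  interpret finite_measure "lebesgue_on V"
    using assms(3) by (rule finite_measure_lebesgue_on)
  have "integrable (lebesgue_on V) (\<lambda>x. (w x)\<^sup>2)"
  proof (rule integrable_const_bound[where B = "B\<^sup>2"])
    show "AE x in lebesgue_on V. norm ((w x)\<^sup>2) \<le> B\<^sup>2"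
    proof (rule AE_I2)
      fix x assume "x \<in> space (lebesgue_on V)"
      then have "\<bar>w x\<bar> \<le> B" using assms(4) by (intro B) (auto simp: space_restrict_space)
      then have "\<bar>w x\<bar>\<^sup>2 \<le> B\<^sup>2" by (intro power_mono) auto
      then show "norm ((w x)\<^sup>2) \<le> B\<^sup>2" by simp
    qed
  qed (use m in measurable)
  with m show ?thesis by (simp add: L2_on_def)
qed

text \<open>Writing g' = r k cancels the 1 / |x| from differentiating the norm, so the formula
  extends to the origin. There the derivative is g 0 times the coordinate, because g(|h|) tends to g
  0.\<close>

lemma has_derivative_radial_component:
  fixes g k :: "real \<Rightarrow> real" and x :: "real^'n"
  assumes g: "\<And>r. r \<in> {0..1} \<Longrightarrow> (g has_real_derivative r * k r) (at r within {0..1})"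
    and x: "x \<in> ball 0 1"
  shows "((\<lambda>x. g (norm x) * x $ i) has_derivative
    (\<lambda>h. g (norm x) * h $ i + k (norm x) * (x \<bullet> h) * x $ i)) (at x)"
proof (cases "x = 0")
  case False
  then have r: "0 < norm x" "norm x < 1" using x by auto
  have "(g has_real_derivative norm x * k (norm x)) (at (norm x))"
    using g[of "norm x"] r by (simp add: at_within_Icc_at)
  then have "(g has_derivative (*) (norm x * k (norm x))) (at (norm x))"
    by (simp add: has_field_derivative_def)
  from has_derivative_compose[OF has_derivative_norm[OF False] this]
  have 1: "((\<lambda>x. g (norm x)) has_derivative (\<lambda>h. norm x * k (norm x) * (h \<bullet> sgn x))) (at x)" .
  have 2: "((\<lambda>x. x $ i) has_derivative (\<lambda>h. h $ i)) (at x)"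
    by (rule bounded_linear.has_derivative[OF bounded_linear_vec_nth has_derivative_ident])
  have eq: "norm x * k (norm x) * (h \<bullet> sgn x) = k (norm x) * (x \<bullet> h)" for h
    using r by (simp add: sgn_div_norm inner_commute)
  show ?thesis
    using has_derivative_mult[OF 1 2] unfolding eq .
next
  case True
  have "isCont (\<lambda>h::real^'n. g (norm h)) 0"
  proof -
    have gc: "continuous_on {0..1} g" using g by (rule DERIV_continuous_on)
    have "continuous_on (ball 0 1) (\<lambda>h::real^'n. g (norm h))"
      by (rule continuous_on_compose2[OF gc]) (auto intro: continuous_intros)
    then show ?thesis by (simp add: continuous_on_eq_continuous_at)
  qed
  then have "((\<lambda>h::real^'n. g (norm h)) \<longlongrightarrow> g 0) (at 0)" by (simp add: isCont_def)
  from tendsto_norm[OF tendsto_diff[OF this tendsto_const[of "g 0"]]]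
  have lim: "((\<lambda>h::real^'n. \<bar>g (norm h) - g 0\<bar>) \<longlongrightarrow> 0) (at 0)" by simp
  have "bounded_linear (\<lambda>h::real^'n. g 0 * h $ i)"
    by (intro bounded_linear_const_mult bounded_linear_vec_nth)
  moreover have "((\<lambda>h::real^'n. norm (g (norm (0 + h)) * (0 + h) $ i - g (norm (0::real^'n)) * (0::real^'n) $ i - g 0 * h $ i) / norm h)
      \<longlongrightarrow> 0) (at 0)"
  proof (rule Lim_null_comparison[OF always_eventually lim], rule allI)
    fix h :: "real^'n"
    have "\<bar>g (norm h) - g 0\<bar> * \<bar>h $ i\<bar> \<le> \<bar>g (norm h) - g 0\<bar> * norm h"
      by (intro mult_left_mono component_le_norm_cart) auto
    then have "\<bar>g (norm h) - g 0\<bar> * \<bar>h $ i\<bar> / norm h \<le> \<bar>g (norm h) - g 0\<bar>"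
      by (cases "h = 0") (simp_all add: pos_divide_le_eq)
    then show "norm (norm (g (norm (0 + h)) * (0 + h) $ i - g (norm (0::real^'n)) * (0::real^'n) $ i - g 0 * h $ i) / norm h)
        \<le> \<bar>g (norm h) - g 0\<bar>"
      by (simp add: left_diff_distrib[symmetric] abs_mult)
  qed
  ultimately show ?thesis
    unfolding True has_derivative_at by simp
qed

text \<open>On the ball the field equals g(|x|) x, whose partial derivatives extend continuously to
  the closed ball. So the classical derivatives are weak ones and are bounded.\<close>

lemma H1_vec_radial:
  fixes f g k :: "real \<Rightarrow> real"
  assumes g: "\<And>r. r \<in> {0..1} \<Longrightarrow> (g has_real_derivative r * k r) (at r within {0..1})"
    and kc: "continuous_on {0..1} k" and f: "\<And>r. r \<in> {0..1} \<Longrightarrow> f r = r * g r"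
  shows "H1_vec (ball 0 1) (\<lambda>x::real^'n. (f (norm x) / norm x) *\<^sub>R x)"
  unfolding H1_vec_def H1_scalar_def
proof (intro allI conjI)
  fix i j :: 'n
  have gc: "continuous_on {0..1} g" using g by (rule DERIV_continuous_on)
  have gnc: "continuous_on (cball 0 1) (\<lambda>x::real^'n. g (norm x))"
    by (rule continuous_on_compose2[OF gc]) (auto intro: continuous_intros)
  have knc: "continuous_on (cball 0 1) (\<lambda>x::real^'n. k (norm x))"
    by (rule continuous_on_compose2[OF kc]) (auto intro: continuous_intros)
  have eq: "((f (norm x) / norm x) *\<^sub>R x) $ i = g (norm x) * x $ i"
    if "x \<in> ball 0 1" for x :: "real^'n"
    using that f[of "norm x"] by (cases "x = 0") auto
  have "L2_on (ball 0 1) (\<lambda>x::real^'n. g (norm x) * x $ i)"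
    by (rule L2_on_continuous[of "cball 0 1"]) (auto intro!: continuous_intros gnc)
  then show "L2_on (ball 0 1) (\<lambda>x::real^'n. ((f (norm x) / norm x) *\<^sub>R x) $ i)"
    by (rule iffD2[OF L2_on_cong, rotated]) (rule eq)
  define D where "D x h = g (norm x) * h $ i + k (norm x) * (x \<bullet> h) * x $ i" for x h :: "real^'n"
  have Dc: "continuous_on (cball 0 1) (\<lambda>x. D x (axis j 1))"
    unfolding D_def by (intro continuous_intros gnc knc)
  have "L2_on (ball 0 1) (\<lambda>x. D x (axis j 1))"
    by (rule L2_on_continuous[OF _ Dc]) auto
  moreover have "weak_partial (ball 0 1) j (\<lambda>x::real^'n. ((f (norm x) / norm x) *\<^sub>R x) $ i) (\<lambda>x. D x (axis j 1))"
  proof (rule weak_partial_C1)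
    fix x :: "real^'n" assume x: "x \<in> ball 0 1"
    have "D x = (\<lambda>h. g (norm x) * h $ i + k (norm x) * (x \<bullet> h) * x $ i)" by (auto simp: D_def)
    then have "((\<lambda>x. g (norm x) * x $ i) has_derivative D x) (at x)"
      using has_derivative_radial_component[OF g x, where i = i] by simp
    then show "((\<lambda>x::real^'n. ((f (norm x) / norm x) *\<^sub>R x) $ i) has_derivative D x) (at x)"
      by (rule has_derivative_transform_within_open[OF _ open_ball x]) (simp only: eq)
  qed (use continuous_on_subset[OF Dc ball_subset_cball] in auto)
  ultimately show "\<exists>g. L2_on (ball 0 1) g \<and>
      weak_partial (ball 0 1) j (\<lambda>x::real^'n. ((f (norm x) / norm x) *\<^sub>R x) $ i) g"
    by blast
qed

text \<open>Balls of radius \<rho> / 2 touching the origin replace polar coordinates. On them the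
  squared field is at least c^2 / \<rho>^(2n), and their volume is of order \<rho>^(n+1), so the
  integrals stay above a positive constant. Yet each point lies in only finitely many of the balls,
  and dominated convergence sends the integrals to 0.\<close>

lemma H1_vec_radial_not_singular:
  fixes h :: "real \<Rightarrow> real"
  assumes H: "H1_vec (ball 0 1) (\<lambda>x::real^'n. (h (norm x) / norm x) *\<^sub>R x)"
    and n: "CARD('n) = Suc n" "1 \<le> n" and c: "0 < c" and d: "0 < d" "d < 1"
    and sing: "\<And>s. 0 < s \<Longrightarrow> s < d \<Longrightarrow> c \<le> s ^ n * \<bar>h s\<bar>"
  shows False
proof -
  let ?M = "lebesgue_on (ball (0::real^'n) 1)"
  define S where "S x = (\<Sum>i\<in>UNIV. (((h (norm x) / norm x) *\<^sub>R x) $ i)\<^sup>2)" for x :: "real^'n"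
  have Si: "integrable ?M S"
    unfolding S_def using H
    by (intro Bochner_Integration.integrable_sum) (auto simp: H1_vec_def H1_scalar_def L2_on_def)
  have S: "S x = (h (norm x))\<^sup>2" if "x \<noteq> 0" for x
  proof -
    have "S x = (norm ((h (norm x) / norm x) *\<^sub>R x))\<^sup>2"
      unfolding S_def power2_norm_eq_inner inner_vec_def by (simp only: inner_real_def power2_eq_square)
    also have "\<dots> = (h (norm x))\<^sup>2" using that by simp
    finally show ?thesis .
  qed
  obtain e :: "real^'n" where e: "norm e = 1" using vector_choose_size[of 1] by auto
  define \<rho> where "\<rho> k = d * (1/2) ^ k" for k :: nat
  have \<rho>: "0 < \<rho> k" "\<rho> k \<le> d" for k using d by (auto simp: \<rho>_def power_le_one mult_left_le)
  \<comment> \<open>Open, hence missing the origin, and contained in the ball of radius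
    \<open>\<rho> k\<close> about it.\<close>
  define A where "A k = ball ((\<rho> k / 2) *\<^sub>R e) (\<rho> k / 2)" for k
  have A: "x \<noteq> 0 \<and> norm x < \<rho> k" if "x \<in> A k" for x k
  proof
    have d: "dist ((\<rho> k / 2) *\<^sub>R e) x < \<rho> k / 2" using that by (simp add: A_def)
    then show "x \<noteq> 0" using e \<rho>(1)[of k] by auto
    have "norm x \<le> norm ((\<rho> k / 2) *\<^sub>R e) + dist ((\<rho> k / 2) *\<^sub>R e) x"
      using norm_triangle_ineq4[of "(\<rho> k / 2) *\<^sub>R e" "(\<rho> k / 2) *\<^sub>R e - x"] by (simp add: dist_norm)
    with d e \<rho>(1)[of k] show "norm x < \<rho> k" by simp
  qed
  have A1: "A k \<subseteq> ball 0 1" for k using A \<rho>(2)[of k] d by fastforce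
  have Am: "A k \<in> sets ?M" for k using A1[of k] by (auto simp: sets_restrict_space_iff A_def)
  have lim: "(\<lambda>k. integral\<^sup>L ?M (\<lambda>x. indicator (A k) x * S x)) \<longlonglongrightarrow> integral\<^sup>L ?M (\<lambda>x. 0)"
  proof (rule integral_dominated_convergence[where w = "\<lambda>x. \<bar>S x\<bar>"])
    show "AE x in ?M. (\<lambda>k. indicator (A k) x * S x) \<longlonglongrightarrow> 0"
    proof (rule AE_I2)
      fix x :: "real^'n"
      show "(\<lambda>k. indicator (A k) x * S x) \<longlonglongrightarrow> 0"
      proof (cases "x = 0")
        case True
        then have "(\<lambda>k. indicator (A k) x * S x) = (\<lambda>k. 0)" using A by (force simp: indicator_def)
        then show ?thesis by simp
      next
        case False
        have "\<rho> \<longlonglongrightarrow> d * 0"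
          unfolding \<rho>_def by (intro tendsto_intros LIMSEQ_power_zero) simp
        then have "\<forall>\<^sub>F k in sequentially. \<rho> k < norm x"
          by (rule order_tendstoD(2)) (use False in simp)
        then have "\<forall>\<^sub>F k in sequentially. indicator (A k) x * S x = 0"
          by eventually_elim (use A in \<open>force simp: indicator_def\<close>)
        then show ?thesis by (rule tendsto_eventually)
      qed
    qed
    show "integrable ?M (\<lambda>x. \<bar>S x\<bar>)" using Si by (rule integrable_abs)
    show "(\<lambda>x. indicator (A k) x * S x) \<in> borel_measurable ?M" for k
      using Si Am by (intro borel_measurable_times borel_measurable_indicator) auto
  qed (auto simp: indicator_def)
  define L where "L = c\<^sup>2 * (unit_ball_vol (real (CARD('n))) / 2 ^ Suc n)"
  have L: "0 < L" using c by (simp add: L_def)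
  have ge: "L \<le> integral\<^sup>L ?M (\<lambda>x. indicator (A k) x * S x)" for k
  proof -
    have rk: "0 < \<rho> k" "\<rho> k < 1" using \<rho>[of k] d by auto
    have Ac: "emeasure ?M (A k) = emeasure lborel (A k)"
      using A1[of k] by (simp add: emeasure_restrict_space A_def)
    have Amm: "measure ?M (A k) = unit_ball_vol (real (CARD('n))) * (\<rho> k / 2) ^ Suc n"
    proof -
      have "measure ?M (A k) = measure lborel (A k)" by (simp add: measure_def Ac)
      also have "\<dots> = unit_ball_vol (real (CARD('n))) * (\<rho> k / 2) ^ Suc n"
        unfolding A_def using rk by (simp add: content_ball n(1))
      finally show ?thesis .
    qed
    have fin: "emeasure ?M (A k) < \<infinity>"
    proof -
      have "emeasure lborel (A k) < \<infinity>" unfolding A_def by (rule emeasure_lborel_ball_finite)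
      then show ?thesis by (simp only: Ac)
    qed
    \<comment> \<open>The comparison 2 n \<ge> n + 1 is where the dimension N \<ge> 2
      enters.\<close>
    have "\<rho> k ^ (2 * n) \<le> \<rho> k ^ Suc n" using n(2) rk by (intro power_decreasing) auto
    then have "1 \<le> \<rho> k ^ Suc n / \<rho> k ^ (2 * n)" using rk by simp
    then have "L * 1 \<le> L * (\<rho> k ^ Suc n / \<rho> k ^ (2 * n))" using L by (intro mult_left_mono) auto
    also have "\<dots> = c\<^sup>2 / \<rho> k ^ (2 * n) * measure ?M (A k)"
      unfolding Amm L_def by (simp add: power_divide ac_simps)
    also have "\<dots> = integral\<^sup>L ?M (\<lambda>x. indicator (A k) x * (c\<^sup>2 / \<rho> k ^ (2 * n)))"
      using Am fin A1[of k] by (simp add: Int_absorb2 space_restrict_space)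
    also have "\<dots> \<le> integral\<^sup>L ?M (\<lambda>x. indicator (A k) x * S x)"
    proof (rule integral_mono)
      show "integrable ?M (\<lambda>x. indicator (A k) x * (c\<^sup>2 / \<rho> k ^ (2 * n)))"
        using Am fin by simp
      show "integrable ?M (\<lambda>x. indicator (A k) x * S x)"
        using integrable_mult_indicator[OF Am[of k] Si] by simp
      fix x
      show "indicator (A k) x * (c\<^sup>2 / \<rho> k ^ (2 * n)) \<le> indicator (A k) x * S x"
      proof (cases "x \<in> A k")
        case True
        with A have x: "x \<noteq> 0" "norm x < \<rho> k" by auto
        then have "c \<le> norm x ^ n * \<bar>h (norm x)\<bar>" using \<rho>(2)[of k] by (intro sing) auto
        also have "\<dots> \<le> \<rho> k ^ n * \<bar>h (norm x)\<bar>" using x by (intro mult_right_mono power_mono) auto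
        finally have "c\<^sup>2 \<le> (\<rho> k ^ n * \<bar>h (norm x)\<bar>)\<^sup>2" using c by (intro power_mono) auto
        then have "c\<^sup>2 / \<rho> k ^ (2 * n) \<le> S x"
          using rk x(1) by (simp add: S pos_divide_le_eq power_mult_distrib power_mult[symmetric] mult.commute)
        with True show ?thesis by simp
      qed simp
    qed
    finally show ?thesis by simp
  qed
  have "L \<le> integral\<^sup>L ?M (\<lambda>x. 0)"
    by (rule LIMSEQ_le_const[OF lim]) (use ge in auto)
  with L show False by simp
qed

section \<open>Cutoff functions and the fundamental theorem for weak derivatives\<close>

definition smooth_step :: "real \<Rightarrow> real" where
  "smooth_step t = 2 * (max 0 t)\<^sup>2 - 4 * (max 0 (t - 1/2))\<^sup>2 + 2 * (max 0 (t - 1))\<^sup>2"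

text \<open>A tent on [0, 1] with peak 2 at 1/2, hence of integral 1. Test functions have to be only
  C1, so a piecewise quadratic step suffices.\<close>

definition smooth_step' :: "real \<Rightarrow> real" where
  "smooth_step' t = 4 * max 0 t - 8 * max 0 (t - 1/2) + 4 * max 0 (t - 1)"

lemma has_real_derivative_max_sq:
  "((\<lambda>t. (max 0 (t - a))\<^sup>2) has_real_derivative 2 * max 0 (t - a)) (at t)" for a t :: real
proof -
  consider "t < a" | "t = a" | "a < t" by linarith
  then show ?thesis
  proof cases
    case 1
    have "((\<lambda>_. 0) has_real_derivative 0) (at t)" by simp
    then have "((\<lambda>t. (max 0 (t - a))\<^sup>2) has_real_derivative 0) (at t)"
      by (rule has_field_derivative_transform_within_open[where S = "{..<a}"]) (use 1 in auto)
    with 1 show ?thesis by simp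
  next
    case 3
    have "((\<lambda>t. (t - a)\<^sup>2) has_real_derivative 2 * (t - a)) (at t)"
      by (auto intro!: derivative_eq_intros)
    then have "((\<lambda>t. (max 0 (t - a))\<^sup>2) has_real_derivative 2 * (t - a)) (at t)"
      by (rule has_field_derivative_transform_within_open[where S = "{a<..}"]) (use 3 in auto)
    with 3 show ?thesis by simp
  next
    case 2
    have "((\<lambda>h::real. ((max 0 h)\<^sup>2 - 0) / h) \<longlongrightarrow> 0) (at 0)"
    proof (rule Lim_null_comparison)
      show "\<forall>\<^sub>F h in at 0. norm (((max 0 h)\<^sup>2 - 0) / h) \<le> \<bar>h\<bar>"
      proof (rule always_eventually, rule allI)
        fix h :: real
        show "norm (((max 0 h)\<^sup>2 - 0) / h) \<le> \<bar>h\<bar>"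
          by (cases "0 < h") (auto simp: power2_eq_square max_def)
      qed
      show "((\<lambda>h::real. \<bar>h\<bar>) \<longlongrightarrow> 0) (at 0)" by (rule tendsto_rabs_zero) (rule tendsto_ident_at)
    qed
    then show ?thesis using 2 by (simp add: DERIV_def)
  qed
qed

lemma has_real_derivative_smooth_step:
  "(smooth_step has_real_derivative smooth_step' t) (at t)"
proof -
  note D = has_real_derivative_max_sq
  show ?thesis
    unfolding smooth_step_def[abs_def] smooth_step'_def
    using DERIV_add[OF DERIV_diff[OF DERIV_cmult[OF D[of 0 t], of 2] DERIV_cmult[OF D[of "1/2" t], of 4]]
        DERIV_cmult[OF D[of 1 t], of 2]] by simp
qed

lemma smooth_step_simps:
  "t \<le> 0 \<Longrightarrow> smooth_step t = 0" "1 \<le> t \<Longrightarrow> smooth_step t = 1"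
  "t \<le> 0 \<Longrightarrow> smooth_step' t = 0" "1 \<le> t \<Longrightarrow> smooth_step' t = 0"
  by (auto simp: smooth_step_def smooth_step'_def power2_eq_square algebra_simps)

lemma smooth_step'_outside: "t \<notin> {0..1} \<Longrightarrow> smooth_step' t = 0"
  by (cases "t \<le> 0") (auto simp: smooth_step_simps)

lemma smooth_step'_cont: "continuous_on S smooth_step'"
  unfolding smooth_step'_def by (intro continuous_intros)

lemma smooth_step'_bounds: "0 \<le> smooth_step' t" "smooth_step' t \<le> 2"
  by (auto simp: smooth_step'_def max_def)

lemma smooth_step_mono: "s \<le> t \<Longrightarrow> smooth_step s \<le> smooth_step t"
  by (rule DERIV_nonneg_imp_nondecreasing)
    (use has_real_derivative_smooth_step smooth_step'_bounds in blast)+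

lemma smooth_step_bounds: "0 \<le> smooth_step t" "smooth_step t \<le> 1"
proof -
  show "0 \<le> smooth_step t"
    using smooth_step_mono[of "min t 0" t] by (simp add: smooth_step_simps)
  show "smooth_step t \<le> 1"
    using smooth_step_mono[of t "max t 1"] by (simp add: smooth_step_simps)
qed

lemma integral_smooth_step': "integrable lborel smooth_step'" "integral\<^sup>L lborel smooth_step' = 1"
proof -
  show i: "integrable lborel smooth_step'"
    by (rule integrable_continuous_compact_support[OF smooth_step'_cont compact_Icc smooth_step'_outside])
  have "(smooth_step' has_integral (smooth_step 1 - smooth_step 0)) {0..1}"
    by (rule fundamental_theorem_of_calculus)
      (auto intro: has_field_derivative_at_within[OF has_real_derivative_smooth_step]
        simp flip: has_real_derivative_iff_has_vector_derivative)
  then have "(smooth_step' has_integral 1) {0..1}" by (simp add: smooth_step_simps)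
  then have "((\<lambda>t. if t \<in> {0..1} then smooth_step' t else 0) has_integral 1) UNIV"
    by (simp only: has_integral_restrict_UNIV)
  moreover have "(\<lambda>t. if t \<in> {0..1} then smooth_step' t else 0) = smooth_step'"
    using smooth_step'_outside by (force simp: fun_eq_iff)
  ultimately have "(smooth_step' has_integral 1) UNIV" by simp
  then show "integral\<^sup>L lborel smooth_step' = 1"
    using has_integral_integral_lborel[OF i] has_integral_unique by blast
qed

text \<open>An approximation of the indicator of (x, y]: it rises on [x, x + 1/k] and falls on
  [y, y + 1/k]. Its derivative is the difference of two approximate point masses at x and y.\<close>

definition plateau :: "real \<Rightarrow> real \<Rightarrow> real \<Rightarrow> real \<Rightarrow> real" where
  "plateau k x y r = smooth_step (k * (r - x)) - smooth_step (k * (r - y))"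

lemma has_real_derivative_plateau:
  "(plateau k x y has_real_derivative k * smooth_step' (k * (r - x)) - k * smooth_step' (k * (r - y))) (at r)"
proof -
  have *: "((\<lambda>r. smooth_step (k * (r - x))) has_real_derivative k * smooth_step' (k * (r - x))) (at r)" for x
  proof -
    have "((\<lambda>r. k * (r - x)) has_real_derivative k) (at r)" by (auto intro!: derivative_eq_intros)
    from DERIV_chain'[where f = "\<lambda>r. k * (r - x)" and g = smooth_step, OF this has_real_derivative_smooth_step]
    show ?thesis by (simp add: mult.commute)
  qed
  show ?thesis unfolding plateau_def[abs_def] by (intro DERIV_diff *)
qed

lemma plateau_outside:
  assumes "0 < k" "x \<le> y" "r \<le> x \<or> y + 1 / k \<le> r" shows "plateau k x y r = 0"
  using assms(3)
proof
  assume "r \<le> x"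
  then have "k * (r - x) \<le> 0" "k * (r - y) \<le> 0"
    using assms by (auto intro!: mult_nonneg_nonpos)
  then show ?thesis by (simp add: plateau_def smooth_step_simps)
next
  assume r: "y + 1 / k \<le> r"
  have "k * (1 / k) \<le> k * (r - y)" using assms r by (intro mult_left_mono) auto
  moreover have "k * (r - y) \<le> k * (r - x)" using assms by (intro mult_left_mono) auto
  moreover have "k * (1 / k) = 1" using assms by simp
  ultimately have "1 \<le> k * (r - x)" "1 \<le> k * (r - y)" by linarith+
  then show ?thesis by (simp add: plateau_def smooth_step_simps)
qed

lemma plateau_bounds: "\<bar>plateau k x y r\<bar> \<le> 1"
  using smooth_step_bounds[of "k * (r - x)"] smooth_step_bounds[of "k * (r - y)"] unfolding plateau_def by linarith

lemma test_fun1_plateau: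
  assumes "0 < x" "x \<le> y" "y + 1 / k < 1" "0 < k"
  shows "test_fun1 {0<..<1} (plateau k x y)"
proof -
  have d: "deriv (plateau k x y) = (\<lambda>r. k * smooth_step' (k * (r - x)) - k * smooth_step' (k * (r - y)))"
    by (rule ext, rule DERIV_imp_deriv, rule has_real_derivative_plateau)
  have "{r. plateau k x y r \<noteq> 0} \<subseteq> {x..y + 1 / k}"
    using plateau_outside[OF assms(4,2)] by (auto simp: not_le) (meson linear)+
  then have sub: "closure {r. plateau k x y r \<noteq> 0} \<subseteq> {x..y + 1 / k}"
    by (rule closure_minimal) simp
  then have "compact (closure {r. plateau k x y r \<noteq> 0})"
    by (meson bounded_closed_interval bounded_subset closed_closure compact_eq_bounded_closed)
  moreover have "closure {r. plateau k x y r \<noteq> 0} \<subseteq> {0<..<1}" using sub assms by auto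
  moreover have "continuous_on UNIV (deriv (plateau k x y))"
    unfolding d by (intro continuous_intros continuous_on_compose2[OF smooth_step'_cont[of UNIV]]) auto
  moreover have "plateau k x y differentiable (at r)" for r
    using has_real_derivative_plateau real_differentiable_def by blast
  ultimately show ?thesis by (simp add: test_fun1_def)
qed

text \<open>Substituting r = x + s / k turns the integral into one of H(x + s / k) against a fixed
  tent of mass 1, and continuity of h at x gives the limit by dominated convergence.\<close>

lemma mollification_tendsto:
  fixes h :: "real \<Rightarrow> real"
  assumes h: "continuous_on {0<..<1} h" and x: "0 < x" "x < b" "b < 1"
    and k: "filterlim k at_top sequentially" "\<And>j. 0 < k j" "\<And>j. x + 1 / k j \<le> b"
  shows "(\<lambda>j. integral\<^sup>L (lebesgue_on {0<..<1}) (\<lambda>r. h r * (k j * smooth_step' (k j * (r - x))))) \<longlonglongrightarrow> h x"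
    "integrable (lebesgue_on {0<..<1}) (\<lambda>r. h r * (k j * smooth_step' (k j * (r - x))))"
proof -
  \<comment> \<open>Extension by 0 gives a Borel function on the line, so that the affine
    substitution is available.\<close>
  define H where "H r = indicator {0<..<1} r *\<^sub>R h r" for r
  have Hm: "H \<in> borel_measurable borel"
    unfolding H_def by (intro borel_measurable_continuous_on_indicator h) auto
  have "continuous_on {x..b} h" by (rule continuous_on_subset[OF h]) (use x in auto)
  then have "bounded (h ` {x..b})" by (intro compact_imp_bounded compact_continuous_image) auto
  then obtain B where "\<forall>r\<in>{x..b}. norm (h r) \<le> B" unfolding bounded_iff by blast
  then have B: "\<And>r. r \<in> {x..b} \<Longrightarrow> \<bar>h r\<bar> \<le> B" by simp
  have in_xb: "x + s / k j \<in> {x..b}" if "s \<in> {0..1}" for s j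
  proof -
    have "s / k j \<le> 1 / k j" using that k(2)[of j] by (intro divide_right_mono) auto
    with that k(2,3)[of j] show ?thesis by auto
  qed
  have bd: "\<bar>H (x + s / k j) * smooth_step' s\<bar> \<le> \<bar>B\<bar> * smooth_step' s" for s j
  proof (cases "s \<in> {0..1}")
    case True
    have "H (x + s / k j) = h (x + s / k j)" using in_xb[OF True, of j] x by (auto simp: H_def)
    then have "\<bar>H (x + s / k j)\<bar> \<le> \<bar>B\<bar>"
      using B[OF in_xb[OF True, of j]] by linarith
    then show ?thesis
      using smooth_step'_bounds[of s] by (simp add: abs_mult mult_right_mono)
  next
    case False
    then have "smooth_step' s = 0" by (rule smooth_step'_outside)
    then show ?thesis by simp
  qed
  have w: "integrable lborel (\<lambda>s. \<bar>B\<bar> * smooth_step' s)"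
    using integral_smooth_step'(1) by simp
  have sm: "smooth_step' \<in> borel_measurable borel"
    by (rule borel_measurable_continuous_onI[OF smooth_step'_cont])
  have fm: "(\<lambda>s. H (x + s / k j) * smooth_step' s) \<in> borel_measurable lborel" for j
    using Hm sm by measurable
  have fi: "integrable lborel (\<lambda>s. H (x + s / k j) * smooth_step' s)" for j
    by (rule Bochner_Integration.integrable_bound[OF w fm]) (use bd smooth_step'_bounds in \<open>auto simp: abs_mult\<close>)
  have "(\<lambda>j. integral\<^sup>L lborel (\<lambda>s. H (x + s / k j) * smooth_step' s))
      \<longlonglongrightarrow> integral\<^sup>L lborel (\<lambda>s. h x * smooth_step' s)"
  proof (rule integral_dominated_convergence[OF _ fm w])
    show "AE s in lborel. (\<lambda>j. H (x + s / k j) * smooth_step' s) \<longlonglongrightarrow> h x * smooth_step' s"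
    proof (rule AE_I2)
      fix s
      have "isCont H x"
      proof -
        have "continuous_on {0<..<1} H" by (rule continuous_on_eq[OF h]) (simp add: H_def)
        then show ?thesis using x by (simp add: continuous_on_eq_continuous_at)
      qed
      moreover have "(\<lambda>j. x + s / k j) \<longlonglongrightarrow> x + 0"
        by (intro tendsto_add tendsto_const real_tendsto_divide_at_top[OF tendsto_const k(1)])
      ultimately have "(\<lambda>j. H (x + s / k j)) \<longlonglongrightarrow> H x"
        using isCont_tendsto_compose[of x H "\<lambda>j. x + s / k j"] by simp
      then show "(\<lambda>j. H (x + s / k j) * smooth_step' s) \<longlonglongrightarrow> h x * smooth_step' s"
        using x by (intro tendsto_intros) (simp add: H_def)
    qed
    show "AE s in lborel. norm (H (x + s / k j) * smooth_step' s) \<le> \<bar>B\<bar> * smooth_step' s" for j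
      using bd by simp
    show "(\<lambda>s. h x * smooth_step' s) \<in> borel_measurable lborel" using sm by simp
  qed
  then have lim: "(\<lambda>j. integral\<^sup>L lborel (\<lambda>s. H (x + s / k j) * smooth_step' s)) \<longlonglongrightarrow> h x"
    using integral_smooth_step' by simp
  define F where "F j r = H r * (k j * smooth_step' (k j * (r - x)))" for j r
  have Fm: "F j \<in> borel_measurable borel" for j
    unfolding F_def using Hm sm by measurable
  have Fs: "F j (x + 1 / k j * s) = k j * (H (x + s / k j) * smooth_step' s)" for j s
    using k(2)[of j] by (simp add: F_def)
  have Fi: "integrable lborel (F j)" for j
  proof (rule lborel_integrable_real_affine_iff[THEN iffD1])
    show "1 / k j \<noteq> 0" using k(2)[of j] by simp
    show "integrable lborel (\<lambda>s. F j (x + 1 / k j * s))" unfolding Fs using fi by simp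
  qed
  have FI: "integral\<^sup>L lborel (F j) = integral\<^sup>L lborel (\<lambda>s. H (x + s / k j) * smooth_step' s)" for j
    using lborel_integral_real_affine[of "1 / k j" "F j" x] k(2)[of j] unfolding Fs by simp
  have ind: "(\<lambda>r. indicator {0<..<1} r *\<^sub>R (h r * (k j * smooth_step' (k j * (r - x))))) = F j" for j
    by (auto simp: F_def H_def fun_eq_iff)
  have V: "{0<..<1::real} \<inter> space lebesgue \<in> sets lebesgue" by auto
  have "integral\<^sup>L (lebesgue_on {0<..<1}) (\<lambda>r. h r * (k j * smooth_step' (k j * (r - x)))) = integral\<^sup>L lborel (F j)" for j
    unfolding integral_restrict_space[OF V] ind using Fm[of j] by (simp add: integral_completion)
  then show "(\<lambda>j. integral\<^sup>L (lebesgue_on {0<..<1}) (\<lambda>r. h r * (k j * smooth_step' (k j * (r - x))))) \<longlonglongrightarrow> h x"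
    using lim FI by simp
  show "integrable (lebesgue_on {0<..<1}) (\<lambda>r. h r * (k j * smooth_step' (k j * (r - x))))"
    unfolding integrable_restrict_space[OF V] ind using Fm[of j] Fi[of j] by (simp add: integrable_completion)
qed

text \<open>The definition provides integrability only against test functions; one that equals 1 on
  [x, y] gives local integrability.\<close>

lemma weak_deriv1_integrable:
  assumes wd: "weak_deriv1 {0<..<1} h p" and x: "0 < x" "y < 1"
  shows "p absolutely_integrable_on {x..y}"
proof (cases "x \<le> y")
  case True
  \<comment> \<open>The rising ramp starts at c = x / 2 and is over by x since 1 / k2 \<le> x / 2.
    The falling ramp starts at z > y and ends before 1 since 1 / k2 < (1 - y) / 4.\<close>
  define z where "z = y + (1 - y) / 4"
  define c where "c = x / 2"
  define k2 where "k2 = max (2 / x) (8 / (1 - y))"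
  have k2: "0 < k2" using x by (simp add: k2_def less_max_iff_disj)
  have "2 / x \<le> k2" "8 / (1 - y) \<le> k2" by (auto simp: k2_def)
  then have k2xy: "2 \<le> k2 * x" "8 \<le> k2 * (1 - y)" using x by (auto simp: pos_divide_le_eq)
  then have k2y: "1 / k2 < (1 - y) / 4" using k2 by (simp add: field_simps)
  have k2x: "1 \<le> k2 * (x / 2)" using k2xy by simp
  have "test_fun1 {0<..<1} (plateau k2 c z)"
    using x True k2 k2y by (intro test_fun1_plateau) (auto simp: c_def z_def field_simps)
  then have "integrable (lebesgue_on {0<..<1}) (\<lambda>r. p r * plateau k2 c z r)"
    using wd by (simp add: weak_deriv1_def)
  then have "integrable lebesgue (\<lambda>r. indicator {0<..<1} r *\<^sub>R (p r * plateau k2 c z r))"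
    by (subst (asm) integrable_restrict_space) auto
  then have int: "integrable lebesgue (\<lambda>r. indicator {x..y} r *\<^sub>R (indicator {0<..<1} r *\<^sub>R (p r * plateau k2 c z r)))"
    by (rule integrable_mult_indicator[rotated]) auto
  have eq: "indicator {x..y} r *\<^sub>R (indicator {0<..<1} r *\<^sub>R (p r * plateau k2 c z r)) = indicator {x..y} r *\<^sub>R p r" for r
  proof (cases "r \<in> {x..y}")
    case r: True
    have "k2 * (x / 2) \<le> k2 * (r - c)" using r k2 by (intro mult_left_mono) (auto simp: c_def)
    moreover have "k2 * (r - z) \<le> 0" using r k2 x by (intro mult_nonneg_nonpos) (auto simp: z_def field_simps)
    ultimately have "plateau k2 c z r = 1" using k2x by (simp add: plateau_def smooth_step_simps)
    then show ?thesis using r x by (auto simp: indicator_def)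
  qed simp
  have eq': "(\<lambda>r. indicator {x..y} r *\<^sub>R (indicator {0<..<1} r *\<^sub>R (p r * plateau k2 c z r)))
      = (\<lambda>r. indicator {x..y} r *\<^sub>R p r)" by (rule ext) (rule eq)
  show ?thesis using int unfolding eq' set_integrable_def .
qed (simp add: set_integrable_def)

text \<open>Testing with ever steeper plateaus: the side with h tends to h x - h y by mollification,
  the side with p to minus the integral over [x, y] by dominated convergence.\<close>

lemma weak_deriv1_has_integral:
  assumes wd: "weak_deriv1 {0<..<1} h p" and h: "continuous_on {0<..<1} h"
    and x: "0 < x" "x \<le> y" "y < 1"
  shows "(p has_integral (h y - h x)) {x..y}"
proof -
  define b where "b = (y + 1) / 2"
  have b: "y < b" "b < 1" using x by (auto simp: b_def)
  \<comment> \<open>The offset keeps 1 / k j \<le> b - y, so all ramps stay in [x, b] with b < 1,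
    where p is integrable.\<close>
  define k where "k j = 1 / (b - y) + real j" for j
  have k0: "0 < k j" for j using b by (simp add: k_def add_pos_nonneg)
  have kb: "y + 1 / k j \<le> b" for j
  proof -
    have "1 / (b - y) \<le> k j" by (simp add: k_def)
    then have "1 \<le> k j * (b - y)" using b by (simp add: pos_divide_le_eq)
    then have "1 / k j \<le> b - y" using k0[of j] by (simp add: pos_divide_le_eq mult.commute)
    then show ?thesis by simp
  qed
  have kx: "x + 1 / k j \<le> b" for j using kb[of j] x by simp
  have kt: "filterlim k at_top sequentially"
    unfolding k_def by (intro filterlim_tendsto_add_at_top[OF tendsto_const] filterlim_real_sequentially)
  have tf: "test_fun1 {0<..<1} (plateau (k j) x y)" for j
    using x b k0[of j] kb[of j] by (intro test_fun1_plateau) auto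
  have dp: "deriv (plateau (k j) x y) r = k j * smooth_step' (k j * (r - x)) - k j * smooth_step' (k j * (r - y))" for j r
    by (rule DERIV_imp_deriv, rule has_real_derivative_plateau)
  let ?M = "lebesgue_on {0<..<1::real}"
  have mx: "(\<lambda>j. integral\<^sup>L ?M (\<lambda>r. h r * (k j * smooth_step' (k j * (r - x))))) \<longlonglongrightarrow> h x"
    "integrable ?M (\<lambda>r. h r * (k j * smooth_step' (k j * (r - x))))" for j
    using mollification_tendsto[OF h x(1) _ b(2) kt k0 kx] x b by auto
  have my: "(\<lambda>j. integral\<^sup>L ?M (\<lambda>r. h r * (k j * smooth_step' (k j * (r - y))))) \<longlonglongrightarrow> h y"
    "integrable ?M (\<lambda>r. h r * (k j * smooth_step' (k j * (r - y))))" for j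
    using mollification_tendsto[OF h _ b(1) b(2) kt k0 kb] x by auto
  have "integral\<^sup>L ?M (\<lambda>r. h r * deriv (plateau (k j) x y) r)
      = integral\<^sup>L ?M (\<lambda>r. h r * (k j * smooth_step' (k j * (r - x))))
        - integral\<^sup>L ?M (\<lambda>r. h r * (k j * smooth_step' (k j * (r - y))))" for j
    unfolding dp right_diff_distrib[of "h _"] by (rule Bochner_Integration.integral_diff[OF mx(2) my(2)])
  with tendsto_diff[OF mx(1) my(1)]
  have lhs: "(\<lambda>j. integral\<^sup>L ?M (\<lambda>r. h r * deriv (plateau (k j) x y) r)) \<longlonglongrightarrow> h x - h y" by simp
  have pb: "p absolutely_integrable_on {x..b}" by (rule weak_deriv1_integrable[OF wd x(1) b(2)])
  have pxy: "p absolutely_integrable_on {x..y}" by (rule weak_deriv1_integrable[OF wd x(1,3)])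
  have rhs_eq: "integral\<^sup>L ?M (\<lambda>r. p r * plateau (k j) x y r)
      = integral\<^sup>L lebesgue (\<lambda>r. (indicator {x..b} r *\<^sub>R p r) * plateau (k j) x y r)" for j
  proof -
    have "indicator {0<..<1} r *\<^sub>R (p r * plateau (k j) x y r) = (indicator {x..b} r *\<^sub>R p r) * plateau (k j) x y r" for r
    proof (cases "r \<in> {x..b}")
      case True then show ?thesis using x b by (auto simp: indicator_def)
    next
      case False
      then have "r \<le> x \<or> y + 1 / k j \<le> r" using kb[of j] by auto
      then show ?thesis by (simp add: plateau_outside[OF k0 x(2)])
    qed
    then have eq: "(\<lambda>r. indicator {0<..<1} r *\<^sub>R (p r * plateau (k j) x y r))
        = (\<lambda>r. (indicator {x..b} r *\<^sub>R p r) * plateau (k j) x y r)" by (rule ext)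
    have V: "{0<..<1::real} \<inter> space lebesgue \<in> sets lebesgue" by auto
    show ?thesis unfolding integral_restrict_space[OF V] eq ..
  qed
  have pl_lim: "(\<lambda>j. plateau (k j) x y r) \<longlonglongrightarrow> indicator {x<..y} r" for r
  proof -
    have step: "\<forall>\<^sub>F j in sequentially. smooth_step (k j * (r - z)) = (if z < r then 1 else 0)" for z
    proof (cases "z < r")
      case True
      have "\<forall>\<^sub>F j in sequentially. 1 / (r - z) \<le> k j" using kt by (simp add: filterlim_at_top)
      then show ?thesis
      proof eventually_elim
        case (elim j)
        then have "1 \<le> k j * (r - z)" using True by (simp add: pos_divide_le_eq)
        then show ?case using True by (simp add: smooth_step_simps)
      qed
    next
      case False
      have "k j * (r - z) \<le> 0" for j using False k0[of j] by (intro mult_nonneg_nonpos) auto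
      then show ?thesis using False by (simp add: smooth_step_simps)
    qed
    have "\<forall>\<^sub>F j in sequentially. plateau (k j) x y r = indicator {x<..y} r"
      using step[of x] step[of y] by eventually_elim (use x in \<open>auto simp: plateau_def indicator_def\<close>)
    then show ?thesis by (rule tendsto_eventually)
  qed
  have "(\<lambda>j. integral\<^sup>L lebesgue (\<lambda>r. (indicator {x..b} r *\<^sub>R p r) * plateau (k j) x y r))
      \<longlonglongrightarrow> integral\<^sup>L lebesgue (\<lambda>r. (indicator {x..b} r *\<^sub>R p r) * indicator {x<..y} r)"
  proof (rule integral_dominated_convergence[where w = "\<lambda>r. \<bar>indicator {x..b} r *\<^sub>R p r\<bar>"])
    have pm: "(\<lambda>r. indicator {x..b} r *\<^sub>R p r) \<in> borel_measurable lebesgue"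
      using pb unfolding set_integrable_def by (rule borel_measurable_integrable)
    then show "(\<lambda>r. (indicator {x..b} r *\<^sub>R p r) * indicator {x<..y} r) \<in> borel_measurable lebesgue"
      by (intro borel_measurable_times borel_measurable_indicator) auto
    show "(\<lambda>r. (indicator {x..b} r *\<^sub>R p r) * plateau (k j) x y r) \<in> borel_measurable lebesgue" for j
    proof (intro borel_measurable_times pm)
      have "continuous_on UNIV (plateau (k j) x y)"
        by (rule DERIV_continuous_on) (rule has_field_derivative_at_within[OF has_real_derivative_plateau])
      then have "plateau (k j) x y \<in> borel_measurable lborel"
        using borel_measurable_continuous_onI by simp
      then show "plateau (k j) x y \<in> borel_measurable lebesgue" by (rule measurable_completion)
    qed
    show "integrable lebesgue (\<lambda>r. \<bar>indicator {x..b} r *\<^sub>R p r\<bar>)"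
      using pb unfolding set_integrable_def by (rule integrable_abs)
    show "AE r in lebesgue. (\<lambda>j. (indicator {x..b} r *\<^sub>R p r) * plateau (k j) x y r)
        \<longlonglongrightarrow> (indicator {x..b} r *\<^sub>R p r) * indicator {x<..y} r"
      by (intro AE_I2 tendsto_mult tendsto_const pl_lim)
    show "AE r in lebesgue. norm ((indicator {x..b} r *\<^sub>R p r) * plateau (k j) x y r) \<le> \<bar>indicator {x..b} r *\<^sub>R p r\<bar>" for j
      unfolding norm_mult by (intro AE_I2) (use plateau_bounds in \<open>auto intro: mult_left_le\<close>)
  qed
  moreover have "integral\<^sup>L lebesgue (\<lambda>r. (indicator {x..b} r *\<^sub>R p r) * indicator {x<..y} r) = integral {x..y} p"
  proof -
    have "integral\<^sup>L lebesgue (\<lambda>r. (indicator {x..b} r *\<^sub>R p r) * indicator {x<..y} r)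
        = integral\<^sup>L lebesgue (\<lambda>r. indicator {x..y} r *\<^sub>R p r)"
    proof (rule integral_cong_AE)
      have "AE r in lborel. r \<noteq> x" by (rule AE_lborel_singleton)
      then have "AE r in lebesgue. r \<noteq> x" by (rule AE_completion)
      then show "AE r in lebesgue. (indicator {x..b} r *\<^sub>R p r) * indicator {x<..y} r = indicator {x..y} r *\<^sub>R p r"
        by eventually_elim (use b in \<open>auto simp: indicator_def\<close>)
      show "(\<lambda>r. indicator {x..y} r *\<^sub>R p r) \<in> borel_measurable lebesgue"
        using pxy unfolding set_integrable_def by (rule borel_measurable_integrable)
      have "(\<lambda>r. indicator {x..b} r *\<^sub>R p r) \<in> borel_measurable lebesgue"
        using pb unfolding set_integrable_def by (rule borel_measurable_integrable)
      then show "(\<lambda>r. (indicator {x..b} r *\<^sub>R p r) * indicator {x<..y} r) \<in> borel_measurable lebesgue"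
        by (intro borel_measurable_times borel_measurable_indicator) auto
    qed
    also have "\<dots> = integral {x..y} p"
      using set_lebesgue_integral_eq_integral(2)[OF pxy] by (simp add: set_lebesgue_integral_def)
    finally show ?thesis .
  qed
  ultimately have "(\<lambda>j. - integral\<^sup>L ?M (\<lambda>r. p r * plateau (k j) x y r)) \<longlonglongrightarrow> - integral {x..y} p"
    unfolding rhs_eq by (intro tendsto_minus) simp
  moreover have "integral\<^sup>L ?M (\<lambda>r. h r * deriv (plateau (k j) x y) r) = - integral\<^sup>L ?M (\<lambda>r. p r * plateau (k j) x y r)" for j
    using wd tf[of j] by (simp add: weak_deriv1_def)
  ultimately have "h x - h y = - integral {x..y} p"
    using LIMSEQ_unique[OF lhs] by simp
  then have "integral {x..y} p = h y - h x" by simp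
  with set_lebesgue_integral_eq_integral(1)[OF pxy] show ?thesis
    by (metis integrable_integral)
qed

section \<open>Absolutely continuous functions and almost everywhere equality\<close>

lemma absolutely_integrable_continuous_mult:
  fixes f g :: "real \<Rightarrow> real"
  assumes "continuous_on {a..b} f" "g absolutely_integrable_on {a..b}"
  shows "(\<lambda>x. f x * g x) absolutely_integrable_on {a..b}"
proof (rule absolutely_integrable_bounded_measurable_product_real)
  show "f \<in> borel_measurable (lebesgue_on {a..b})"
    by (intro continuous_imp_measurable_on_sets_lebesgue assms) auto
  show "bounded (f ` {a..b})"
    by (intro compact_imp_bounded compact_continuous_image assms) auto
qed (use assms in auto)

text \<open>The defect W of the product formula is additive over adjacent intervals. On an interval
  where u and v oscillate by at most \<eta>, freezing u at the left end and v at the right end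
  bounds it by \<eta> times the integral of |u'| + |v'|. Summing short intervals gives this bound on
  [a, b] for every \<eta> > 0, so the defect vanishes.\<close>

lemma absolutely_continuous_product:
  fixes u v u' v' :: "real \<Rightarrow> real"
  assumes ab: "a \<le> b"
    and U: "\<And>c d. a \<le> c \<Longrightarrow> c \<le> d \<Longrightarrow> d \<le> b \<Longrightarrow> (u' has_integral (u d - u c)) {c..d}"
    and V: "\<And>c d. a \<le> c \<Longrightarrow> c \<le> d \<Longrightarrow> d \<le> b \<Longrightarrow> (v' has_integral (v d - v c)) {c..d}"
    and u': "u' absolutely_integrable_on {a..b}" and v': "v' absolutely_integrable_on {a..b}"
    and uc: "continuous_on {a..b} u" and vc: "continuous_on {a..b} v"
  shows "(\<lambda>r. u' r * v r + u r * v' r) absolutely_integrable_on {a..b}"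
    "((\<lambda>r. u' r * v r + u r * v' r) has_integral (u b * v b - u a * v a)) {a..b}"
proof -
  define w where "w r = u' r * v r + u r * v' r" for r
  define A where "A r = \<bar>u' r\<bar> + \<bar>v' r\<bar>" for r
  have wi: "w absolutely_integrable_on {a..b}"
    unfolding w_def
    using absolutely_integrable_continuous_mult[OF vc u'] absolutely_integrable_continuous_mult[OF uc v']
    by (intro set_integral_add) (simp_all add: mult.commute)
  have Ai: "A absolutely_integrable_on {a..b}"
    unfolding A_def by (intro set_integral_add set_integrable_abs u' v')
  have wI: "w integrable_on {c..d}" and AI: "A integrable_on {c..d}" if "a \<le> c" "d \<le> b" for c d
    using wi Ai that by (auto intro: integrable_on_subinterval set_lebesgue_integral_eq_integral(1))
  have A0: "0 \<le> A r" for r by (simp add: A_def)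
  define W where "W c d = u d * v d - u c * v c - integral {c..d} w" for c d
  have local_le: "\<bar>W c d\<bar> \<le> \<eta> * integral {c..d} A"
    if cd: "a \<le> c" "c \<le> d" "d \<le> b" and \<eta>: "\<And>r. r \<in> {c..d} \<Longrightarrow> \<bar>v d - v r\<bar> \<le> \<eta> \<and> \<bar>u c - u r\<bar> \<le> \<eta>" for c d \<eta>
  proof -
    have "((\<lambda>r. u' r * v d + u c * v' r) has_integral ((u d - u c) * v d + u c * (v d - v c))) {c..d}"
      by (intro has_integral_add has_integral_mult_left has_integral_mult_right U V cd)
    from has_integral_diff[OF this integrable_integral[OF wI[OF cd(1,3)]]]
    have I: "((\<lambda>r. u' r * v d + u c * v' r - w r) has_integral W c d) {c..d}"
      by (simp add: W_def algebra_simps)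
    have "norm (integral {c..d} (\<lambda>r. u' r * v d + u c * v' r - w r)) \<le> integral {c..d} (\<lambda>r. \<eta> * A r)"
    proof (rule integral_norm_bound_integral)
      show "(\<lambda>r. u' r * v d + u c * v' r - w r) integrable_on {c..d}" using I by blast
      show "(\<lambda>r. \<eta> * A r) integrable_on {c..d}"
        by (rule has_integral_integrable[OF has_integral_mult_right[OF integrable_integral[OF AI[OF cd(1,3)]]]])
      fix r assume r: "r \<in> {c..d}"
      have "u' r * v d + u c * v' r - w r = u' r * (v d - v r) + (u c - u r) * v' r"
        by (simp add: w_def algebra_simps)
      also have "\<bar>\<dots>\<bar> \<le> \<bar>u' r\<bar> * \<bar>v d - v r\<bar> + \<bar>u c - u r\<bar> * \<bar>v' r\<bar>"
        by (rule order_trans[OF abs_triangle_ineq]) (simp add: abs_mult)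
      also have "\<dots> \<le> \<bar>u' r\<bar> * \<eta> + \<eta> * \<bar>v' r\<bar>"
        using \<eta>[OF r] by (intro add_mono mult_mono) auto
      finally show "norm (u' r * v d + u c * v' r - w r) \<le> \<eta> * A r"
        by (simp add: A_def algebra_simps)
    qed
    then show ?thesis using integral_unique[OF I] by simp
  qed
  have Wab: "\<bar>W a b\<bar> \<le> \<eta> * integral {a..b} A" if "0 < \<eta>" for \<eta>
  proof -
    have "uniformly_continuous_on {a..b} u" "uniformly_continuous_on {a..b} v"
      using uc vc by (auto intro: compact_uniformly_continuous)
    then obtain e1 e2 where e1: "0 < e1" "\<And>x y. x \<in> {a..b} \<Longrightarrow> y \<in> {a..b} \<Longrightarrow> dist y x < e1 \<Longrightarrow> dist (u y) (u x) < \<eta>"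
      and e2: "0 < e2" "\<And>x y. x \<in> {a..b} \<Longrightarrow> y \<in> {a..b} \<Longrightarrow> dist y x < e2 \<Longrightarrow> dist (v y) (v x) < \<eta>"
      using \<open>0 < \<eta>\<close> unfolding uniformly_continuous_on_def by metis
    define e where "e = min e1 e2 / 2"
    have e: "0 < e" "e < e1" "e < e2" using e1(1) e2(1) by (auto simp: e_def)
    \<comment> \<open>Induction on the number of steps of length e needed to reach c from a; uniform
      continuity provides the small oscillation on each step.\<close>
    have "\<bar>W a c\<bar> \<le> \<eta> * integral {a..c} A" if "a \<le> c" "c \<le> b" "c \<le> a + real k * e" for c k
      using that
    proof (induction k arbitrary: c)
      case 0
      then have "c = a" by simp
      then show ?case by (simp add: W_def)
    next
      case (Suc k)
      define c' where "c' = max a (c - e)"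
      have c': "a \<le> c'" "c' \<le> c" "c' \<le> b" "c - c' \<le> e" using Suc.prems e by (auto simp: c'_def)
      have "c' \<le> a + real k * e"
        using Suc.prems e by (auto simp: c'_def algebra_simps)
      then have IH: "\<bar>W a c'\<bar> \<le> \<eta> * integral {a..c'} A" using Suc.IH c' by simp
      have loc: "\<bar>W c' c\<bar> \<le> \<eta> * integral {c'..c} A"
      proof (rule local_le[OF c'(1,2) Suc.prems(2)])
        fix r assume r: "r \<in> {c'..c}"
        have "dist (v c) (v r) < \<eta>"
          by (rule e2(2)) (use r c' e Suc.prems in \<open>auto simp: dist_real_def\<close>)
        moreover have "dist (u c') (u r) < \<eta>"
          by (rule e1(2)) (use r c' e Suc.prems in \<open>auto simp: dist_real_def\<close>)
        ultimately show "\<bar>v c - v r\<bar> \<le> \<eta> \<and> \<bar>u c' - u r\<bar> \<le> \<eta>" by (simp add: dist_real_def)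
      qed
      have "integral {a..c'} w + integral {c'..c} w = integral {a..c} w"
        by (rule Henstock_Kurzweil_Integration.integral_combine[OF c'(1,2) wI]) (use Suc.prems in auto)
      then have "W a c = W a c' + W c' c" by (simp add: W_def)
      moreover have "integral {a..c'} A + integral {c'..c} A = integral {a..c} A"
        by (rule Henstock_Kurzweil_Integration.integral_combine[OF c'(1,2) AI]) (use Suc.prems in auto)
      then have "\<eta> * integral {a..c} A = \<eta> * integral {a..c'} A + \<eta> * integral {c'..c} A"
        by (simp add: distrib_left[symmetric])
      ultimately show ?case using IH loc by linarith
    qed
    moreover obtain k :: nat where "(b - a) / e < real k" using reals_Archimedean2 by blast
    then have "b \<le> a + real k * e" using e by (simp add: pos_divide_less_eq)
    ultimately show ?thesis using ab by blast
  qed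
  have "W a b = 0"
  proof (rule ccontr)
    assume "W a b \<noteq> 0"
    define G where "G = integral {a..b} A + 1"
    have "0 \<le> integral {a..b} A" by (rule integral_nonneg[OF AI]) (auto intro: A0)
    then have G: "0 < G" by (simp add: G_def)
    define \<eta> where "\<eta> = \<bar>W a b\<bar> / (2 * G)"
    have \<eta>: "0 < \<eta>" using G \<open>W a b \<noteq> 0\<close> by (simp add: \<eta>_def)
    have "\<bar>W a b\<bar> \<le> \<eta> * integral {a..b} A" by (rule Wab[OF \<eta>])
    also have "\<dots> \<le> \<eta> * G" using \<eta> by (intro mult_left_mono) (auto simp: G_def)
    also have "\<dots> = \<bar>W a b\<bar> / 2" using G by (simp add: \<eta>_def)
    finally show False using \<open>W a b \<noteq> 0\<close> by simp
  qed
  then have "integral {a..b} w = u b * v b - u a * v a" by (simp add: W_def)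
  then have "(w has_integral (u b * v b - u a * v a)) {a..b}"
    using wI[of a b] by (metis integrable_integral order_refl)
  then show "((\<lambda>r. u' r * v r + u r * v' r) has_integral (u b * v b - u a * v a)) {a..b}"
    by (simp add: w_def[abs_def])
  show "(\<lambda>r. u' r * v r + u r * v' r) absolutely_integrable_on {a..b}"
    using wi by (simp add: w_def[abs_def])
qed

text \<open>The vanishing of integrals passes from half-lines, which are stable under intersection,
  to all Borel sets; then the density is 0 almost everywhere.\<close>

lemma AE_eq_0_if_integrals_eq_0:
  fixes d :: "real \<Rightarrow> real"
  assumes d: "d absolutely_integrable_on {a..b}" and ab: "a \<le> b"
    and 0: "\<And>c. c \<in> {a..b} \<Longrightarrow> integral {a..c} d = 0"
  shows "AE r in lborel. r \<in> {a..b} \<longrightarrow> d r = 0"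
proof -
  define D where "D r = indicator {a..b} r *\<^sub>R d r" for r
  have Di: "integrable lebesgue D" using d by (simp add: set_integrable_def D_def[abs_def])
  then have Dm: "D \<in> borel_measurable lebesgue" by (rule borel_measurable_integrable)
  \<comment> \<open>The integrand is only Lebesgue measurable; a Borel version fits the
    sigma-algebra generated by half-lines.\<close>
  then obtain D' where D': "D' \<in> borel_measurable lborel" "AE r in lborel. D r = D' r"
    using completion_ex_borel_measurable_real by blast
  have D'm: "D' \<in> borel_measurable lebesgue" by (rule measurable_completion[OF D'(1)])
  have AE: "AE r in lebesgue. D r = D' r" by (rule AE_completion[OF D'(2)])
  have "integrable lebesgue D'"
    by (rule integrable_cong_AE_imp[OF Di D'm]) (use AE in \<open>auto elim: eventually_mono\<close>)
  then have D'i: "integrable lborel D'" by (simp add: integrable_completion[OF D'(1)])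
  have si: "set_integrable lborel A D'" if "A \<in> sets lborel" for A
    unfolding set_integrable_def by (rule integrable_mult_indicator[OF that D'i])
  have atMost: "(LINT r:{..c}|lborel. D' r) = 0" for c
  proof -
    have "(LINT r:{..c}|lborel. D' r) = integral\<^sup>L lebesgue (\<lambda>r. indicator {..c} r *\<^sub>R D' r)"
      unfolding set_lebesgue_integral_def
      by (rule integral_completion[symmetric]) (use D'(1) in measurable)
    also have "\<dots> = integral\<^sup>L lebesgue (\<lambda>r. indicator {a..min b c} r *\<^sub>R d r)"
    proof (rule integral_cong_AE)
      show "AE r in lebesgue. indicator {..c} r *\<^sub>R D' r = indicator {a..min b c} r *\<^sub>R d r"
        using AE by eventually_elim (auto simp: D_def indicator_def)
      have eq: "(\<lambda>r. indicator {a..min b c} r *\<^sub>R d r) = (\<lambda>r. indicator {..c} r *\<^sub>R D r)"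
        by (auto simp: D_def indicator_def fun_eq_iff)
      show "(\<lambda>r. indicator {a..min b c} r *\<^sub>R d r) \<in> borel_measurable lebesgue"
        unfolding eq using Dm by (intro borel_measurable_scaleR borel_measurable_indicator) auto
      show "(\<lambda>r. indicator {..c} r *\<^sub>R D' r) \<in> borel_measurable lebesgue"
        using D'm by (intro borel_measurable_scaleR borel_measurable_indicator) auto
    qed
    also have "\<dots> = 0"
    proof (cases "a \<le> min b c")
      case True
      have "d absolutely_integrable_on {a..min b c}"
        using d by (rule absolutely_integrable_on_subinterval) auto
      then have "integral\<^sup>L lebesgue (\<lambda>r. indicator {a..min b c} r *\<^sub>R d r) = integral {a..min b c} d"
        using set_lebesgue_integral_eq_integral(2) unfolding set_lebesgue_integral_def by blast
      also have "\<dots> = 0" using True by (intro 0) auto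
      finally show ?thesis .
    qed simp
    finally show ?thesis .
  qed
  have tot: "integral\<^sup>L lborel D' = 0"
  proof -
    have "integral\<^sup>L lborel D' = integral\<^sup>L lebesgue D'" by (rule integral_completion[OF D'(1), symmetric])
    also have "\<dots> = integral\<^sup>L lebesgue D" by (rule integral_cong_AE[OF D'm Dm]) (use AE in \<open>auto elim: eventually_mono\<close>)
    also have "\<dots> = integral {a..b} d"
      using set_lebesgue_integral_eq_integral(2)[OF d] by (simp add: set_lebesgue_integral_def D_def[abs_def])
    finally show ?thesis using 0 ab by simp
  qed
  have all: "(LINT r:A|lborel. D' r) = 0" if "A \<in> sigma_sets UNIV (range (\<lambda>c::real. {..c}))" for A
  proof -
    have "Int_stable (range (\<lambda>c::real. {..c}))" by (auto simp: Int_stable_def)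
    moreover have "range (\<lambda>c::real. {..c}) \<subseteq> Pow UNIV" by simp
    ultimately show ?thesis using that
    proof (induction rule: sigma_sets_induct_disjoint)
      case (basic A)
      then show ?case using atMost by auto
    next
      case empty
      show ?case by (simp add: set_lebesgue_integral_def)
    next
      case (compl A)
      have A: "A \<in> sets lborel" using compl(1) by (simp add: borel_eq_atMost)
      have "(LINT r:UNIV - A|lborel. D' r) = integral\<^sup>L lborel (\<lambda>r. D' r - indicator A r *\<^sub>R D' r)"
        unfolding set_lebesgue_integral_def
        by (rule Bochner_Integration.integral_cong) (auto simp: indicator_def)
      also have "\<dots> = integral\<^sup>L lborel D' - (LINT r:A|lborel. D' r)"
        unfolding set_lebesgue_integral_def
        using si[OF A] by (intro Bochner_Integration.integral_diff D'i) (simp add: set_integrable_def)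
      finally show ?case using tot compl by simp
    next
      case (union A)
      have A: "A i \<in> sets lborel" for i using union(2) by (auto simp: borel_eq_atMost)
      have "(LINT r:(\<Union>i. A i)|lborel. D' r) = (\<Sum>i. (LINT r:A i|lborel. D' r))"
        by (rule lebesgue_integral_countable_add)
          (use A si union(1) in \<open>auto simp: disjoint_family_on_def\<close>)
      then show ?case using union by simp
    qed
  qed
  have "AE r in lborel. D' r = 0"
  proof (rule density_unique_real[OF D'i])
    show "integrable lborel (\<lambda>_. 0)" by simp
    fix A :: "real set" assume "A \<in> sets lborel"
    then have "A \<in> sigma_sets UNIV (range (\<lambda>c::real. {..c}))" by (simp add: borel_eq_atMost)
    then show "(LINT r:A|lborel. D' r) = (LINT r:A|lborel. 0)" using all by simp
  qed
  with D'(2) show ?thesis by eventually_elim (auto simp: D_def)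
qed

text \<open>A pointwise limit of restrictions to compact subintervals, where local integrability
  includes measurability.\<close>

lemma weak_deriv1_measurable:
  assumes wd: "weak_deriv1 {0<..<1} h p"
  shows "(\<lambda>r. indicator {0<..<1} r *\<^sub>R p r) \<in> borel_measurable lebesgue"
proof -
  define A where "A k = {1 / real (k + 2)..1 - 1 / real (k + 2)}" for k :: nat
  have m: "(\<lambda>r. indicator (A k) r *\<^sub>R p r) \<in> borel_measurable lebesgue" for k
  proof -
    have "p absolutely_integrable_on A k"
      unfolding A_def by (rule weak_deriv1_integrable[OF wd]) auto
    then show ?thesis unfolding set_integrable_def by (rule borel_measurable_integrable)
  qed
  have lim: "(\<lambda>k. indicator (A k) r *\<^sub>R p r) \<longlonglongrightarrow> indicator {0<..<1} r *\<^sub>R p r" for r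
  proof (cases "r \<in> {0<..<1}")
    case True
    have "(\<lambda>k. 1 / real (k + 2)) \<longlonglongrightarrow> 0"
      using LIMSEQ_ignore_initial_segment[OF lim_inverse_n', of 2] by simp
    then have "\<forall>\<^sub>F k in sequentially. 1 / real (k + 2) < min r (1 - r)"
      by (rule order_tendstoD(2)) (use True in simp)
    then have "\<forall>\<^sub>F k in sequentially. indicator (A k) r *\<^sub>R p r = indicator {0<..<1} r *\<^sub>R p r"
      by eventually_elim (use True in \<open>auto simp: A_def indicator_def\<close>)
    then show ?thesis by (rule tendsto_eventually)
  next
    case False
    have "r \<notin> A k" for k
    proof
      have "0 < 1 / real (k + 2)" by simp
      assume "r \<in> A k"
      then have "1 / real (k + 2) \<le> r" "r \<le> 1 - 1 / real (k + 2)" by (auto simp: A_def)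
      with \<open>0 < 1 / real (k + 2)\<close> have "0 < r" "r < 1" by linarith+
      with False show False by simp
    qed
    then show ?thesis using False by simp
  qed
  show ?thesis by (rule borel_measurable_LIMSEQ_real[OF lim m])
qed

text \<open>\<open>I_GL\<close> evaluates an arbitrarily chosen weak derivative, which has to be
  identified for the profile. Both p and f1 integrate to the increments of f over compact
  subintervals, so their difference vanishes almost everywhere.\<close>

lemma weak_deriv1_AE_eq:
  assumes wd: "weak_deriv1 {0<..<1} f p"
    and f: "\<And>r. r \<in> {0<..<1} \<Longrightarrow> (f has_real_derivative f1 r) (at r)" and f1c: "continuous_on {0<..<1} f1"
  shows "AE r in lborel. r \<in> {0<..<1} \<longrightarrow> p r = f1 r"
proof -
  have fc: "continuous_on {0<..<1} f"
    by (rule DERIV_continuous_on[OF has_field_derivative_at_within[OF f]])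
  define a b where "a k = 1 / real (k + 2)" and "b k = 1 - 1 / real (k + 2)" for k :: nat
  have ab: "0 < a k" "a k \<le> b k" "b k < 1" for k by (auto simp: a_def b_def field_simps)
  have "AE r in lborel. r \<in> {a k..b k} \<longrightarrow> p r - f1 r = 0" for k
  proof (rule AE_eq_0_if_integrals_eq_0)
    show "(\<lambda>r. p r - f1 r) absolutely_integrable_on {a k..b k}"
    proof (intro set_integral_diff(1))
      show "p absolutely_integrable_on {a k..b k}" by (rule weak_deriv1_integrable[OF wd ab(1,3)])
      show "f1 absolutely_integrable_on {a k..b k}"
        by (rule absolutely_integrable_continuous_real, rule continuous_on_subset[OF f1c])
          (use ab(1)[of k] ab(3)[of k] in auto)
    qed
    fix c assume c: "c \<in> {a k..b k}"
    have "(p has_integral (f c - f (a k))) {a k..c}"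
      by (rule weak_deriv1_has_integral[OF wd fc ab(1)]) (use c ab(3)[of k] in auto)
    moreover have "(f1 has_integral (f c - f (a k))) {a k..c}"
    proof (rule fundamental_theorem_of_calculus)
      fix x assume "x \<in> {a k..c}"
      then have "x \<in> {0<..<1}" using c ab(1)[of k] ab(3)[of k] by auto
      from has_field_derivative_at_within[OF f[OF this]]
      show "(f has_vector_derivative f1 x) (at x within {a k..c})"
        by (simp add: has_real_derivative_iff_has_vector_derivative)
    qed (use c in auto)
    ultimately have "((\<lambda>r. p r - f1 r) has_integral ((f c - f (a k)) - (f c - f (a k)))) {a k..c}"
      by (rule has_integral_diff)
    from integral_unique[OF this] show "integral {a k..c} (\<lambda>r. p r - f1 r) = 0" by simp
  qed (rule ab)
  then have "AE r in lborel. \<forall>k. r \<in> {a k..b k} \<longrightarrow> p r - f1 r = 0"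
    unfolding AE_all_countable by (rule allI)
  then show ?thesis
  proof eventually_elim
    case (elim r)
    show ?case
    proof
      assume r: "r \<in> {0<..<1}"
      have "(\<lambda>k. 1 / real (k + 2)) \<longlonglongrightarrow> 0"
        using LIMSEQ_ignore_initial_segment[OF lim_inverse_n', of 2] by simp
      then have "\<forall>\<^sub>F k in sequentially. 1 / real (k + 2) < min r (1 - r)"
        by (rule order_tendstoD(2)) (use r in simp)
      then obtain k where "1 / real (k + 2) < min r (1 - r)"
        by (auto simp: eventually_sequentially)
      then have "r \<in> {a k..b k}" by (auto simp: a_def b_def)
      with elim have "p r - f1 r = 0" by blast
      then show "p r = f1 r" by simp
    qed
  qed
qed

text \<open>Monotone convergence is run in the completed measure, because the integrands are only
  Lebesgue measurable; nonnegative integrals agree with those over \<open>lborel\<close>.\<close>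

lemma nn_integral_exhaust_Ioo:
  fixes \<phi> :: "real \<Rightarrow> ennreal"
  assumes m: "(\<lambda>r. \<phi> r * indicator {0<..<1} r) \<in> borel_measurable lebesgue"
    and le: "\<And>\<delta>. 0 < \<delta> \<Longrightarrow> \<delta> < 1 \<Longrightarrow> (\<integral>\<^sup>+r. \<phi> r * indicator {\<delta>..<1} r \<partial>lborel) \<le> X"
  shows "(\<integral>\<^sup>+r. \<phi> r * indicator {0<..<1} r \<partial>lborel) \<le> X"
proof -
  define a where "a k = 1 / real (k + 2)" for k :: nat
  have a: "0 < a k" "a k < 1" for k by (auto simp: a_def)
  define F where "F k r = \<phi> r * indicator {a k..<1} r" for k r
  have inc: "incseq F"
  proof (rule incseq_SucI, rule le_funI)
    fix k r
    have "a (Suc k) \<le> a k" by (simp add: a_def frac_le)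
    then show "F k r \<le> F (Suc k) r"
      unfolding F_def by (intro mult_left_mono) (auto simp: indicator_def)
  qed
  have Fm: "F k \<in> borel_measurable lebesgue" for k
  proof -
    have "F k = (\<lambda>r. (\<phi> r * indicator {0<..<1} r) * indicator {a k..<1} r)"
      using a[of k] by (auto simp: F_def indicator_def fun_eq_iff)
    then show ?thesis
      using borel_measurable_times_ennreal[OF m borel_measurable_indicator[of "{a k..<1}" lebesgue]] by simp
  qed
  have sup: "\<phi> r * indicator {0<..<1} r = (SUP k. F k r)" for r
  proof (cases "r \<in> {0<..<1}")
    case True
    have "a \<longlonglongrightarrow> 0"
      unfolding a_def using LIMSEQ_ignore_initial_segment[OF lim_inverse_n', of 2] by simp
    then have "\<forall>\<^sub>F k in sequentially. a k < r"
      by (rule order_tendstoD(2)) (use True in simp)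
    then obtain k where k: "a k < r" by (auto simp: eventually_sequentially)
    have "F j r \<le> \<phi> r" for j by (auto simp: F_def indicator_def)
    moreover have "F k r = \<phi> r" using k True by (simp add: F_def)
    ultimately have "(SUP k. F k r) = \<phi> r"
      by (metis (mono_tags, lifting) SUP_eqI UNIV_I)
    then show ?thesis using True by simp
  next
    case False
    then have "F k r = 0" for k using a[of k] by (auto simp: F_def indicator_def)
    then show ?thesis using False by simp
  qed
  have "(\<integral>\<^sup>+r. \<phi> r * indicator {0<..<1} r \<partial>lborel) = (\<integral>\<^sup>+r. (SUP k. F k r) \<partial>lebesgue)"
    by (simp add: sup nn_integral_completion)
  also have "\<dots> = (SUP k. \<integral>\<^sup>+r. F k r \<partial>lebesgue)"
    by (rule nn_integral_monotone_convergence_SUP[OF inc Fm])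
  also have "\<dots> \<le> X"
    using le a by (intro SUP_least) (simp add: F_def nn_integral_completion)
  finally show ?thesis .
qed

lemma nn_integral_Ico_eq_integral:
  fixes \<phi> :: "real \<Rightarrow> real"
  assumes "\<And>r. r \<in> {\<delta>..1} \<Longrightarrow> 0 \<le> \<phi> r" "\<phi> integrable_on {\<delta>..1}"
  shows "(\<integral>\<^sup>+r. ennreal (\<phi> r) * indicator {\<delta>..<1} r \<partial>lborel) = ennreal (integral {\<delta>..1} \<phi>)"
proof -
  have "(\<integral>\<^sup>+r. ennreal (\<phi> r) * indicator {\<delta>..1} r \<partial>lborel) = ennreal (integral {\<delta>..1} \<phi>)"
    by (rule nn_integral_has_integral_lebesgue'[OF assms(1) integrable_integral[OF assms(2)]])
  moreover have "(\<integral>\<^sup>+r. ennreal (\<phi> r) * indicator {\<delta>..<1} r \<partial>lborel)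
      = (\<integral>\<^sup>+r. ennreal (\<phi> r) * indicator {\<delta>..1} r \<partial>lborel)"
  proof (rule nn_integral_cong_AE)
    have "AE r in lborel. r \<noteq> (1::real)" by (rule AE_lborel_singleton)
    then show "AE r in lborel. ennreal (\<phi> r) * indicator {\<delta>..<1} r = ennreal (\<phi> r) * indicator {\<delta>..1} r"
      by eventually_elim (auto simp: indicator_def)
  qed
  ultimately show ?thesis by simp
qed

text \<open>On [\<delta>, 1) the weight is at least \<delta>^n, so the weighted bound gives square
  integrability up to the endpoint 1, and |x| \<le> 1 + x^2 then gives integrability of p
  itself.\<close>

lemma weak_deriv1_weighted_L2:
  fixes h p :: "real \<Rightarrow> real"
  assumes wd: "weak_deriv1 {0<..<1} h p"
    and fin: "(\<integral>\<^sup>+r. ennreal (r ^ n * (p r)\<^sup>2) * indicator {0<..<1} r \<partial>lborel) < \<infinity>"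
    and d: "0 < \<delta>" "\<delta> < 1"
  shows "(\<lambda>r. (p r)\<^sup>2) absolutely_integrable_on {\<delta>..1}" "p absolutely_integrable_on {\<delta>..1}"
proof -
  define P where "P r = indicator {\<delta><..<1} r *\<^sub>R p r" for r
  have Pm: "P \<in> borel_measurable lebesgue"
  proof -
    have "P = (\<lambda>r. indicator {\<delta><..<1} r *\<^sub>R (indicator {0<..<1} r *\<^sub>R p r))"
      using d by (auto simp: P_def indicator_def fun_eq_iff)
    then show ?thesis
      using borel_measurable_scaleR[OF borel_measurable_indicator[of "{\<delta><..<1}" lebesgue] weak_deriv1_measurable[OF wd]]
      by simp
  qed
  have "(\<integral>\<^sup>+r. ennreal ((P r)\<^sup>2) \<partial>lebesgue)
      \<le> (\<integral>\<^sup>+r. ennreal (inverse (\<delta> ^ n)) * (ennreal (r ^ n * (p r)\<^sup>2) * indicator {0<..<1} r) \<partial>lebesgue)"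
  proof (rule nn_integral_mono)
    fix r
    show "ennreal ((P r)\<^sup>2) \<le> ennreal (inverse (\<delta> ^ n)) * (ennreal (r ^ n * (p r)\<^sup>2) * indicator {0<..<1} r)"
    proof (cases "r \<in> {\<delta><..<1}")
      case True
      have "1 * (p r)\<^sup>2 \<le> (inverse (\<delta> ^ n) * r ^ n) * (p r)\<^sup>2"
      proof (rule mult_right_mono)
        have "\<delta> ^ n \<le> r ^ n" using True d by (intro power_mono) auto
        then show "1 \<le> inverse (\<delta> ^ n) * r ^ n" using d by (simp add: field_simps)
      qed simp
      then have "(p r)\<^sup>2 \<le> inverse (\<delta> ^ n) * (r ^ n * (p r)\<^sup>2)" by (simp add: mult.assoc)
      then have "ennreal ((p r)\<^sup>2) \<le> ennreal (inverse (\<delta> ^ n) * (r ^ n * (p r)\<^sup>2))" by (rule ennreal_leI)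
      also have "\<dots> = ennreal (inverse (\<delta> ^ n)) * ennreal (r ^ n * (p r)\<^sup>2)"
        using d by (intro ennreal_mult) (use True in auto)
      finally show ?thesis using True d by (simp add: P_def)
    qed (simp add: P_def)
  qed
  also have "\<dots> = ennreal (inverse (\<delta> ^ n)) * (\<integral>\<^sup>+r. ennreal (r ^ n * (p r)\<^sup>2) * indicator {0<..<1} r \<partial>lebesgue)"
  proof (rule nn_integral_cmult)
    have eq: "(\<lambda>r. ennreal (r ^ n * (p r)\<^sup>2) * indicator {0<..<1} r)
        = (\<lambda>r. ennreal (r ^ n * (indicator {0<..<1} r *\<^sub>R p r)\<^sup>2))"
      by (auto simp: indicator_def fun_eq_iff)
    have "(\<lambda>r::real. r ^ n) \<in> borel_measurable lebesgue"
      by (rule measurable_completion) simp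
    from measurable_compose[OF borel_measurable_times[OF this borel_measurable_power[OF weak_deriv1_measurable[OF wd]]]
        measurable_ennreal]
    show "(\<lambda>r. ennreal (r ^ n * (p r)\<^sup>2) * indicator {0<..<1} r) \<in> borel_measurable lebesgue"
      unfolding eq .
  qed
  also have "\<dots> < \<infinity>"
    using fin by (simp add: nn_integral_completion ennreal_mult_less_top)
  finally have sq: "integrable lebesgue (\<lambda>r. (P r)\<^sup>2)"
    using Pm by (intro integrableI_nonneg) auto
  have i1: "integrable lebesgue (\<lambda>r. indicator {\<delta>..1} r *\<^sub>R 1 + (P r)\<^sup>2)"
  proof (rule Bochner_Integration.integrable_add[OF _ sq])
    have "(\<lambda>_::real. 1::real) absolutely_integrable_on {\<delta>..1}"
      by (rule absolutely_integrable_continuous_real) simp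
    then show "integrable lebesgue (\<lambda>r. indicator {\<delta>..1} r *\<^sub>R (1::real))"
      unfolding set_integrable_def .
  qed
  have Pi: "integrable lebesgue P"
  proof (rule Bochner_Integration.integrable_bound[OF i1 Pm], rule AE_I2)
    fix r
    have "\<bar>x\<bar> \<le> 1 + x\<^sup>2" for x :: real
      using zero_le_power2[of "\<bar>x\<bar> - 1"] by (simp add: power2_diff)
    then show "norm (P r) \<le> norm (indicator {\<delta>..1} r *\<^sub>R 1 + (P r)\<^sup>2)"
      by (auto simp: P_def indicator_def)
  qed
  have "p absolutely_integrable_on {\<delta><..<1}"
    using Pi unfolding set_integrable_def P_def .
  then show "p absolutely_integrable_on {\<delta>..1}"
    by (simp only: absolutely_integrable_on_Icc_iff_Ioo)
  have "(\<lambda>r. (P r)\<^sup>2) = (\<lambda>r. indicator {\<delta><..<1} r *\<^sub>R (p r)\<^sup>2)"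
    by (auto simp: P_def indicator_def fun_eq_iff)
  then have "(\<lambda>r. (p r)\<^sup>2) absolutely_integrable_on {\<delta><..<1}"
    using sq unfolding set_integrable_def by (simp only:)
  then show "(\<lambda>r. (p r)\<^sup>2) absolutely_integrable_on {\<delta>..1}"
    by (simp only: absolutely_integrable_on_Icc_iff_Ioo)
qed

section \<open>The energy\<close>

context GL_convex_potential begin

text \<open>The tangent inequality for U as a convex function of y^2, whose slope is - q / 2. The
  auxiliary D has derivative 2 t (q x - q t) and so is least at |x| among nonnegative
  arguments.\<close>

lemma U_convexity:
  shows "2 * U x + q x * (x\<^sup>2 - y\<^sup>2) \<le> 2 * U y"
proof -
  define D where "D t = 2 * U t + q x * t\<^sup>2" for t
  have D: "(D has_real_derivative 2 * t * (q x - q t)) (at t)" for t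
    unfolding D_def by (auto intro!: derivative_eq_intros U_deriv simp: algebra_simps)
  have qx: "q x = q \<bar>x\<bar>" by (simp add: q_abs)
  have "D \<bar>x\<bar> \<le> D \<bar>y\<bar>"
  proof (cases "\<bar>x\<bar> \<le> \<bar>y\<bar>")
    case True
    then show ?thesis
    proof (rule DERIV_nonneg_imp_nondecreasing)
      fix t assume t: "\<bar>x\<bar> \<le> t" "t \<le> \<bar>y\<bar>"
      then have "0 \<le> 2 * t * (q x - q t)"
        using q_antimono[of "\<bar>x\<bar>" t] qx by (intro mult_nonneg_nonneg) auto
      with D show "\<exists>l. (D has_real_derivative l) (at t) \<and> 0 \<le> l" by blast
    qed
  next
    case False
    then have "\<bar>y\<bar> \<le> \<bar>x\<bar>" by simp
    then show ?thesis
    proof (rule DERIV_nonpos_imp_nonincreasing)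
      fix t assume t: "\<bar>y\<bar> \<le> t" "t \<le> \<bar>x\<bar>"
      then have "2 * t * (q x - q t) \<le> 0"
        using q_antimono[of t "\<bar>x\<bar>"] qx by (intro mult_nonneg_nonpos) auto
      with D show "\<exists>l. (D has_real_derivative l) (at t) \<and> l \<le> 0" by blast
    qed
  qed
  then show ?thesis by (simp add: D_def U_abs algebra_simps)
qed

end

text \<open>The second bound in \<open>f1_le\<close> says f' / f \<le> C / r; it controls the
  boundary term at the origin. The first, with \<open>f_le\<close>, makes the energy of f
  finite.\<close>

locale GL_profile = GL_convex_potential n q q' U for n q q' U +
  fixes f f1 f2 :: "real \<Rightarrow> real" and C :: real
  assumes F: "\<And>r. r \<in> {0<..1} \<Longrightarrow> (f has_real_derivative f1 r) (at r within {0..1})"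
    and F1: "\<And>r. r \<in> {0<..1} \<Longrightarrow> (f1 has_real_derivative f2 r) (at r within {0..1})"
    and f_eq: "\<And>r. r \<in> {0<..1} \<Longrightarrow> f2 r + real n / r * f1 r - real n / r\<^sup>2 * f r = - (q (f r) * f r)"
    and f_1: "f 1 = 1" and f01: "\<And>r. r \<in> {0<..<1} \<Longrightarrow> 0 < f r \<and> f r < 1"
    and C: "0 < C" and f_le: "\<And>r. r \<in> {0<..1} \<Longrightarrow> f r \<le> C * r"
    and f1_le: "\<And>r. r \<in> {0<..1} \<Longrightarrow> f1 r \<le> C" "\<And>r. r \<in> {0<..1} \<Longrightarrow> r * f1 r \<le> C * f r"
    and U_nonneg: "\<And>y. 0 \<le> U y"
begin

lemma f1_pos: "r \<in> {0<..1} \<Longrightarrow> 0 < f1 r"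
  by (rule profile_derivative_pos[OF F F1 f_eq f_1 f01])

lemma f_pos: "r \<in> {0<..1} \<Longrightarrow> 0 < f r"
  using f01[of r] f_1 by (cases "r = 1") auto

lemma f_cont: "S \<subseteq> {0<..1} \<Longrightarrow> continuous_on S f" and f1_cont: "S \<subseteq> {0<..1} \<Longrightarrow> continuous_on S f1"
proof -
  have "continuous_on {0<..1} f" by (rule DERIV_continuous_on[OF DERIV_subset[OF F]]) auto
  then show "S \<subseteq> {0<..1} \<Longrightarrow> continuous_on S f" by (rule continuous_on_subset)
  have "continuous_on {0<..1} f1" by (rule DERIV_continuous_on[OF DERIV_subset[OF F1]]) auto
  then show "S \<subseteq> {0<..1} \<Longrightarrow> continuous_on S f1" by (rule continuous_on_subset)
qed

lemma f_at: "r \<in> {0<..<1} \<Longrightarrow> (f has_real_derivative f1 r) (at r)"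
  using F[of r] by (simp add: at_within_Icc_at)

text \<open>r^n times the logarithmic derivative of f; the equation for f turns into the Riccati
  equation with right-hand side \<open>\<psi>'\<close>.\<close>

definition \<psi> :: "real \<Rightarrow> real" where "\<psi> r = r ^ n * f1 r / f r"
definition \<psi>' :: "real \<Rightarrow> real" where
  "\<psi>' r = r ^ n * (real n / r\<^sup>2 - q (f r)) - r ^ n * (f1 r / f r)\<^sup>2"

lemma \<psi>_deriv:
  assumes r: "r \<in> {0<..1}"
  shows "(\<psi> has_real_derivative \<psi>' r) (at r within {0..1})"
proof -
  have fp: "0 < f r" using f_pos r by simp
  obtain k where k: "n = Suc k" using n_pos by (cases n) auto
  have f2: "f2 r = real n / r\<^sup>2 * f r - real n / r * f1 r - q (f r) * f r"
    using f_eq[OF r] by simp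
  have "(\<psi> has_real_derivative ((real n * r ^ (n - 1) * f1 r + r ^ n * f2 r) * f r - r ^ n * f1 r * f1 r) / (f r * f r))
      (at r within {0..1})"
    unfolding \<psi>_def using fp r by (auto intro!: derivative_eq_intros F F1)
  also have "((real n * r ^ (n - 1) * f1 r + r ^ n * f2 r) * f r - r ^ n * f1 r * f1 r) / (f r * f r) = \<psi>' r"
    unfolding \<psi>'_def f2 unfolding k using fp r by (simp add: field_simps power2_eq_square)
  finally show ?thesis .
qed

lemma \<psi>_cont: "S \<subseteq> {0<..1} \<Longrightarrow> continuous_on S \<psi>"
  unfolding \<psi>_def using f_pos by (intro continuous_intros f_cont f1_cont) (auto simp: less_imp_neq[symmetric] subset_iff)

lemma \<psi>'_cont: "S \<subseteq> {0<..1} \<Longrightarrow> continuous_on S \<psi>'"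
  unfolding \<psi>'_def using f_pos
  by (intro continuous_intros f_cont f1_cont continuous_on_compose2[OF q_cont[of UNIV]])
    (auto simp: less_imp_neq[symmetric] subset_iff)

lemma \<psi>_bounds: "r \<in> {0<..1} \<Longrightarrow> 0 \<le> \<psi> r" "r \<in> {0<..1} \<Longrightarrow> \<psi> r \<le> C * r ^ n / r"
proof -
  assume r: "r \<in> {0<..1}"
  show "0 \<le> \<psi> r" unfolding \<psi>_def using f_pos[OF r] f1_pos[OF r] r by simp
  have "r ^ n * (r * f1 r) \<le> r ^ n * (C * f r)" using f1_le(2)[OF r] r by (intro mult_left_mono) auto
  then show "\<psi> r \<le> C * r ^ n / r"
    unfolding \<psi>_def using f_pos[OF r] r by (simp add: field_simps)
qed

definition dens :: "(real \<Rightarrow> real) \<Rightarrow> (real \<Rightarrow> real) \<Rightarrow> real \<Rightarrow> real" where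
  "dens h p r = ((p r)\<^sup>2 + real n / r\<^sup>2 * (h r)\<^sup>2 + 2 * U (h r)) * r ^ n"

text \<open>For differentiable h with p = h' this is r^n f^2 ((h / f)')^2, so it measures how far h
  is from a multiple of f.\<close>

definition gap :: "(real \<Rightarrow> real) \<Rightarrow> (real \<Rightarrow> real) \<Rightarrow> real \<Rightarrow> real" where
  "gap h p r = r ^ n * (p r - h r * f1 r / f r)\<^sup>2"

lemma dens_nonneg: "0 \<le> r \<Longrightarrow> 0 \<le> dens h p r"
  unfolding dens_def using U_nonneg by (intro mult_nonneg_nonneg add_nonneg_nonneg) auto

lemma gap_nonneg: "0 \<le> r \<Longrightarrow> 0 \<le> gap h p r"
  unfolding gap_def by simp

end

text \<open>Test functions vanish near 1, so the formula is first known for d < 1; it reaches the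
  endpoint by continuity of h and of the indefinite integral.\<close>

lemma weak_deriv1_has_integral_upto_1:
  assumes wd: "weak_deriv1 {0<..<1} h p" and hc: "continuous_on {0<..1} h"
    and p: "p absolutely_integrable_on {\<delta>..1}" and cd: "0 < \<delta>" "\<delta> \<le> c" "c \<le> d" "d \<le> 1"
  shows "(p has_integral (h d - h c)) {c..d}"
proof -
  have hc': "continuous_on {0<..<1} h" by (rule continuous_on_subset[OF hc]) auto
  note I = weak_deriv1_has_integral[OF wd hc']
  show ?thesis
  proof (cases "d < 1 \<or> c = d")
    case True
    then show ?thesis using I[of c d] cd by (auto simp: has_integral_refl)
  next
    case False
    then have d: "d = 1" "c < 1" using cd by auto
    have pi: "p integrable_on {c..1}"
      by (rule integrable_on_subinterval[OF set_lebesgue_integral_eq_integral(1)[OF p]]) (use cd in auto)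
    have c1: "continuous_on {c..1} (\<lambda>x. integral {c..x} p)"
      by (rule indefinite_integral_continuous_1[OF pi])
    have c2: "continuous_on {c..1} (\<lambda>x. integral {c..x} p - (h x - h c))"
      by (intro continuous_intros c1 continuous_on_subset[OF hc]) (use cd in auto)
    have "integral {c..1} p - (h 1 - h c) = 0"
    proof (rule continuous_constant_on_closure[where S = "{c..<1}" and f = "\<lambda>x. integral {c..x} p - (h x - h c)"])
      show "continuous_on (closure {c..<1}) (\<lambda>x. integral {c..x} p - (h x - h c))"
        using c2 d by simp
      show "integral {c..x} p - (h x - h c) = 0" if "x \<in> {c..<1}" for x
        using I[of c x] that cd by (simp add: integral_unique)
      show "1 \<in> closure {c..<1}" using d by simp
    qed
    then have "integral {c..1} p = h 1 - h c" by simp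
    with pi d show ?thesis by (metis integrable_integral)
  qed
qed

context GL_profile begin

context
  fixes h p :: "real \<Rightarrow> real" and \<delta> :: real
  assumes hc: "continuous_on {0<..1} h" and d: "0 < \<delta>" "\<delta> < 1"
    and p: "p absolutely_integrable_on {\<delta>..1}" and p2: "(\<lambda>r. (p r)\<^sup>2) absolutely_integrable_on {\<delta>..1}"
    and P: "\<And>c d. \<delta> \<le> c \<Longrightarrow> c \<le> d \<Longrightarrow> d \<le> 1 \<Longrightarrow> (p has_integral (h d - h c)) {c..d}"
begin

lemma sub: "{\<delta>..1} \<subseteq> {0<..1}" using d by auto

lemma hcd: "continuous_on {\<delta>..1} h" by (rule continuous_on_subset[OF hc sub])

lemma f_neq: "r \<in> {\<delta>..1} \<Longrightarrow> f r \<noteq> 0"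
  using f_pos[of r] d by auto

lemma gap_integrable: "gap h p integrable_on {\<delta>..1}"
proof -
  have c1: "continuous_on {\<delta>..1} (\<lambda>r. r ^ n)" by (intro continuous_intros)
  have c2: "continuous_on {\<delta>..1} (\<lambda>r. - 2 * r ^ n * (h r * f1 r / f r))"
    using f_neq by (intro continuous_intros hcd f_cont f1_cont sub) auto
  have c3: "continuous_on {\<delta>..1} (\<lambda>r. r ^ n * (h r * f1 r / f r)\<^sup>2)"
    using f_neq by (intro continuous_intros hcd f_cont f1_cont sub) auto
  have "(\<lambda>r. r ^ n * (p r)\<^sup>2 + (- 2 * r ^ n * (h r * f1 r / f r)) * p r + r ^ n * (h r * f1 r / f r)\<^sup>2)
      absolutely_integrable_on {\<delta>..1}"
    by (intro set_integral_add absolutely_integrable_continuous_mult[OF c1 p2]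
        absolutely_integrable_continuous_mult[OF c2 p] absolutely_integrable_continuous_real[OF c3])
  then have "(\<lambda>r. r ^ n * (p r)\<^sup>2 + (- 2 * r ^ n * (h r * f1 r / f r)) * p r + r ^ n * (h r * f1 r / f r)\<^sup>2)
      integrable_on {\<delta>..1}" by (rule set_lebesgue_integral_eq_integral(1))
  moreover have "(\<lambda>r. r ^ n * (p r)\<^sup>2 + (- 2 * r ^ n * (h r * f1 r / f r)) * p r + r ^ n * (h r * f1 r / f r)\<^sup>2) = gap h p"
    by (rule ext) (simp add: gap_def power2_diff algebra_simps)
  ultimately show ?thesis by simp
qed

lemma dens_integrable: "dens h p integrable_on {\<delta>..1}"
proof -
  have c1: "continuous_on {\<delta>..1} (\<lambda>r. r ^ n)" by (intro continuous_intros)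
  have c2: "continuous_on {\<delta>..1} (\<lambda>r. (real n / r\<^sup>2 * (h r)\<^sup>2 + 2 * U (h r)) * r ^ n)"
    using d by (intro continuous_intros hcd continuous_on_compose2[OF U_cont[of UNIV]]) auto
  have "(\<lambda>r. r ^ n * (p r)\<^sup>2 + (real n / r\<^sup>2 * (h r)\<^sup>2 + 2 * U (h r)) * r ^ n) absolutely_integrable_on {\<delta>..1}"
    by (intro set_integral_add absolutely_integrable_continuous_mult[OF c1 p2] absolutely_integrable_continuous_real[OF c2])
  then have "(\<lambda>r. r ^ n * (p r)\<^sup>2 + (real n / r\<^sup>2 * (h r)\<^sup>2 + 2 * U (h r)) * r ^ n) integrable_on {\<delta>..1}"
    by (rule set_lebesgue_integral_eq_integral(1))
  moreover have "(\<lambda>r. r ^ n * (p r)\<^sup>2 + (real n / r\<^sup>2 * (h r)\<^sup>2 + 2 * U (h r)) * r ^ n) = dens h p"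
    by (rule ext) (simp add: dens_def algebra_simps)
  ultimately show ?thesis by simp
qed

text \<open>Completing the square: the quadratic part of the energy is \<open>gap\<close> plus an exact derivative.\<close>

lemma quadratic_identity:
  "((\<lambda>r. r ^ n * ((p r)\<^sup>2 + (real n / r\<^sup>2 - q (f r)) * (h r)\<^sup>2) - gap h p r)
    has_integral (\<psi> 1 * (h 1)\<^sup>2 - \<psi> \<delta> * (h \<delta>)\<^sup>2)) {\<delta>..1}"
proof -
  have \<Psi>: "(\<psi>' has_integral (\<psi> b - \<psi> a)) {a..b}" if "\<delta> \<le> a" "a \<le> b" "b \<le> 1" for a b
  proof (rule fundamental_theorem_of_calculus[OF that(2)])
    fix x assume "x \<in> {a..b}"
    then have "x \<in> {0<..1}" "{a..b} \<subseteq> {0..1}" using that d by auto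
    from DERIV_subset[OF \<psi>_deriv[OF this(1)] this(2)]
    show "(\<psi> has_vector_derivative \<psi>' x) (at x within {a..b})"
      by (simp add: has_real_derivative_iff_has_vector_derivative)
  qed
  have \<psi>'i: "\<psi>' absolutely_integrable_on {\<delta>..1}"
    by (rule absolutely_integrable_continuous_real[OF \<psi>'_cont[OF sub]])
  have "\<delta> \<le> 1" using d by simp
  have \<psi>c: "continuous_on {\<delta>..1} \<psi>" by (rule \<psi>_cont[OF sub])
  have A: "(\<lambda>r. \<psi>' r * h r + \<psi> r * p r) absolutely_integrable_on {\<delta>..1}"
    by (rule absolutely_continuous_product(1)[where u = \<psi> and v = h],
        fact, erule (2) \<Psi>, erule (2) P, fact \<psi>'i, fact p, fact \<psi>c, fact hcd)
  have A': "((\<lambda>r. \<psi>' r * h r + \<psi> r * p r) has_integral (\<psi> b * h b - \<psi> a * h a)) {a..b}"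
    if ab: "\<delta> \<le> a" "a \<le> b" "b \<le> 1" for a b
  proof (rule absolutely_continuous_product(2)[OF ab(2)])
    show "(\<psi>' has_integral \<psi> d - \<psi> c) {c..d}" "(p has_integral h d - h c) {c..d}"
      if "a \<le> c" "c \<le> d" "d \<le> b" for c d using \<Psi> P that ab by auto
    show "\<psi>' absolutely_integrable_on {a..b}" "p absolutely_integrable_on {a..b}"
      using ab by (auto intro: absolutely_integrable_on_subinterval[OF \<psi>'i] absolutely_integrable_on_subinterval[OF p])
    show "continuous_on {a..b} \<psi>" "continuous_on {a..b} h"
      using ab d by (auto intro: \<psi>_cont continuous_on_subset[OF hc])
  qed
  \<comment> \<open>The exact derivative is that of \<psi> h^2. The product rule is applied to
    \<psi> h first and then to h and \<psi> h, since h is only absolutely continuous.\<close>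
  have "((\<lambda>r. p r * (\<psi> r * h r) + h r * (\<psi>' r * h r + \<psi> r * p r))
      has_integral (h 1 * (\<psi> 1 * h 1) - h \<delta> * (\<psi> \<delta> * h \<delta>))) {\<delta>..1}"
    by (rule absolutely_continuous_product(2)[where u = h and v = "\<lambda>r. \<psi> r * h r"],
        fact, erule (2) P, erule (2) A', fact p, fact A, fact hcd, intro continuous_intros \<psi>c hcd)
  also have "h 1 * (\<psi> 1 * h 1) - h \<delta> * (\<psi> \<delta> * h \<delta>) = \<psi> 1 * (h 1)\<^sup>2 - \<psi> \<delta> * (h \<delta>)\<^sup>2"
    by (simp add: power2_eq_square)
  finally show ?thesis
  proof (rule has_integral_eq[rotated])
    fix r assume r: "r \<in> {\<delta>..1}"
    show "p r * (\<psi> r * h r) + h r * (\<psi>' r * h r + \<psi> r * p r)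
        = r ^ n * ((p r)\<^sup>2 + (real n / r\<^sup>2 - q (f r)) * (h r)\<^sup>2) - gap h p r"
    proof -
      have "R * (P\<^sup>2 + K * H\<^sup>2) - R * (P - H * b)\<^sup>2 = P * (R * b * H) + H * ((R * K - R * b\<^sup>2) * H + R * b * P)"
        for R P K H b :: real
        by (simp add: power2_eq_square algebra_simps)
      from this[of "r ^ n" "p r" _ "h r" "f1 r / f r"] show ?thesis
        unfolding gap_def \<psi>_def \<psi>'_def by simp
    qed
  qed
qed

end

end

section \<open>From local inequalities to the global energy\<close>

context GL_profile begin

lemma f_local:
  assumes d: "0 < \<delta>" "\<delta> < 1"
  shows "f1 absolutely_integrable_on {\<delta>..1}" "(\<lambda>r. (f1 r)\<^sup>2) absolutely_integrable_on {\<delta>..1}"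
    "\<And>c d. \<delta> \<le> c \<Longrightarrow> c \<le> d \<Longrightarrow> d \<le> 1 \<Longrightarrow> (f1 has_integral (f d - f c)) {c..d}"
proof -
  have sub: "{\<delta>..1} \<subseteq> {0<..1}" using d by auto
  show "f1 absolutely_integrable_on {\<delta>..1}" "(\<lambda>r. (f1 r)\<^sup>2) absolutely_integrable_on {\<delta>..1}"
    by (intro absolutely_integrable_continuous_real continuous_intros f1_cont sub)+
  fix a b assume ab: "\<delta> \<le> a" "a \<le> b" "b \<le> 1"
  show "(f1 has_integral (f b - f a)) {a..b}"
  proof (rule fundamental_theorem_of_calculus[OF ab(2)])
    fix x assume "x \<in> {a..b}"
    then have "x \<in> {0<..1}" "{a..b} \<subseteq> {0..1}" using ab d by auto
    from DERIV_subset[OF F[OF this(1)] this(2)]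
    show "(f has_vector_derivative f1 x) (at x within {a..b})"
      by (simp add: has_real_derivative_iff_has_vector_derivative)
  qed
qed

lemma gap_f: "r \<in> {0<..1} \<Longrightarrow> gap f f1 r = 0"
  using f_pos[of r] by (simp add: gap_def)

text \<open>Subtract the quadratic identities for h and for f: the boundary terms at 1 cancel
  because both functions are 1 there, the gap of f vanishes, and \<open>U_convexity\<close> compares
  the remaining potential terms pointwise. At \<delta> only the term with h has the unfavourable
  sign.\<close>

lemma local_energy_gap:
  assumes hc: "continuous_on {0<..1} h" and h_1: "h 1 = 1" and d: "0 < \<delta>" "\<delta> < 1"
    and p: "p absolutely_integrable_on {\<delta>..1}" and p2: "(\<lambda>r. (p r)\<^sup>2) absolutely_integrable_on {\<delta>..1}"
    and P: "\<And>c d. \<delta> \<le> c \<Longrightarrow> c \<le> d \<Longrightarrow> d \<le> 1 \<Longrightarrow> (p has_integral (h d - h c)) {c..d}"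
  shows "integral {\<delta>..1} (\<lambda>r. dens f f1 r + gap h p r) \<le> integral {\<delta>..1} (dens h p) + \<psi> \<delta> * (h \<delta>)\<^sup>2"
proof -
  note fl = f_local[OF d]
  have fc: "continuous_on {0<..1} f" by (rule f_cont) simp
  define A where "A h p r = r ^ n * ((p r)\<^sup>2 + (real n / r\<^sup>2 - q (f r)) * (h r)\<^sup>2) - gap h p r" for h p :: "real \<Rightarrow> real" and r
  have Ah: "(A h p has_integral (\<psi> 1 * (h 1)\<^sup>2 - \<psi> \<delta> * (h \<delta>)\<^sup>2)) {\<delta>..1}"
    unfolding A_def by (rule quadratic_identity[OF hc d p p2], erule (2) P)
  have Af: "(A f f1 has_integral (\<psi> 1 * (f 1)\<^sup>2 - \<psi> \<delta> * (f \<delta>)\<^sup>2)) {\<delta>..1}"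
    unfolding A_def by (rule quadratic_identity[OF fc d fl(1,2)], erule (2) fl(3))
  have dh: "dens h p integrable_on {\<delta>..1}" by (rule dens_integrable[OF hc d p p2], erule (2) P)
  have df: "dens f f1 integrable_on {\<delta>..1}" by (rule dens_integrable[OF fc d fl(1,2)], erule (2) fl(3))
  have gh: "gap h p integrable_on {\<delta>..1}" by (rule gap_integrable[OF hc d p p2], erule (2) P)
  have le: "dens f f1 r + gap h p r + (A h p r - A f f1 r) \<le> dens h p r" if r: "r \<in> {\<delta>..1}" for r
  proof -
    have r0: "0 \<le> r ^ n" using r d by simp
    have "gap f f1 r = 0" using r d by (intro gap_f) auto
    then have "dens h p r - (dens f f1 r + gap h p r + (A h p r - A f f1 r))
        = r ^ n * (2 * U (h r) - (2 * U (f r) + q (f r) * ((f r)\<^sup>2 - (h r)\<^sup>2)))"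
      unfolding dens_def A_def by (simp add: algebra_simps)
    also have "0 \<le> \<dots>" using r0 U_convexity[of "f r" "h r"] by (intro mult_nonneg_nonneg) auto
    finally show ?thesis by simp
  qed
  have "((\<lambda>r. dens f f1 r + gap h p r + (A h p r - A f f1 r)) has_integral
      (integral {\<delta>..1} (\<lambda>r. dens f f1 r + gap h p r) +
       ((\<psi> 1 * (h 1)\<^sup>2 - \<psi> \<delta> * (h \<delta>)\<^sup>2) - (\<psi> 1 * (f 1)\<^sup>2 - \<psi> \<delta> * (f \<delta>)\<^sup>2)))) {\<delta>..1}"
    by (intro has_integral_add integrable_integral has_integral_diff Ah Af integrable_add df gh)
  from has_integral_le[OF this integrable_integral[OF dh] le]
  have "integral {\<delta>..1} (\<lambda>r. dens f f1 r + gap h p r) + \<psi> \<delta> * (f \<delta>)\<^sup>2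
      \<le> integral {\<delta>..1} (dens h p) + \<psi> \<delta> * (h \<delta>)\<^sup>2"
    by (simp add: h_1 f_1)
  moreover have "0 \<le> \<psi> \<delta> * (f \<delta>)\<^sup>2" using \<psi>_bounds(1)[of \<delta>] d by simp
  ultimately show ?thesis by linarith
qed

definition energy :: "(real \<Rightarrow> real) \<Rightarrow> (real \<Rightarrow> real) \<Rightarrow> ennreal" where
  "energy h p = (\<integral>\<^sup>+r. ennreal (dens h p r) * indicator {0<..<1} r \<partial>lborel)"

text \<open>If the boundary term exceeded \<eta> on all of (0, d], then \<psi> \<le> C r^(n-1) would
  make the energy density at least \<eta> / (C r), whose integral diverges logarithmically at
  0.\<close>

lemma boundary_term_small:
  assumes fin: "energy h p < \<infinity>" and \<eta>: "0 < \<eta>" and d: "0 < d" "d < 1"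
  obtains \<delta> where "0 < \<delta>" "\<delta> \<le> d" "\<psi> \<delta> * (h \<delta>)\<^sup>2 \<le> \<eta>"
proof (rule ccontr)
  note witness = that
  assume no: "\<not> thesis"
  have gt: "\<eta> < \<psi> r * (h r)\<^sup>2" if "0 < r" "r \<le> d" for r
    using no witness[OF that] by linarith
  have dens: "\<eta> / C / r \<le> dens h p r" if r: "0 < r" "r \<le> d" for r
  proof -
    have r1: "r \<in> {0<..1}" using r d by auto
    have "\<eta> \<le> (C * r ^ n / r) * (h r)\<^sup>2"
      using gt[OF r] mult_right_mono[OF \<psi>_bounds(2)[OF r1], of "(h r)\<^sup>2"] by simp
    then have "\<eta> / C / r \<le> (C * r ^ n / r) * (h r)\<^sup>2 / C / r"
      using r C by (intro divide_right_mono) auto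
    also have "\<dots> = 1 * (h r)\<^sup>2 / r\<^sup>2 * r ^ n"
      using r C by (simp add: field_simps power2_eq_square)
    also have "\<dots> \<le> real n * (h r)\<^sup>2 / r\<^sup>2 * r ^ n"
      using n_pos r by (intro mult_right_mono divide_right_mono) auto
    also have "\<dots> \<le> dens h p r"
      unfolding dens_def using U_nonneg r by (intro mult_right_mono) auto
    finally show ?thesis .
  qed
  obtain j where j: "energy h p = ennreal j" "0 \<le> j"
    using fin by (cases "energy h p") auto
  \<comment> \<open>Chosen so that \<eta> / (C r) integrates over [s, d] to j + 1, one more than the
    energy.\<close>
  define s where "s = d * exp (- (C * (j + 1) / \<eta>))"
  have "0 \<le> C * (j + 1) / \<eta>" using C j \<eta> by simp
  then have s: "0 < s" "s \<le> d" using d by (auto simp: s_def mult_left_le)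
  have I: "((\<lambda>r. \<eta> / C / r) has_integral (\<eta> / C * ln d - \<eta> / C * ln s)) {s..d}"
    by (rule fundamental_theorem_of_calculus[OF s(2)])
      (use s C in \<open>auto intro!: derivative_eq_intros simp flip: has_real_derivative_iff_has_vector_derivative\<close>)
  have "ln s = ln d - C * (j + 1) / \<eta>"
    using d by (simp add: s_def ln_mult)
  then have val: "\<eta> / C * ln d - \<eta> / C * ln s = j + 1"
    using C \<eta> by (simp add: field_simps)
  have "ennreal (j + 1) = (\<integral>\<^sup>+r. ennreal (\<eta> / C / r) * indicator {s..d} r \<partial>lborel)"
    using I unfolding val
    by (intro nn_integral_has_integral_lebesgue'[symmetric]) (use s C \<eta> in auto)
  also have "\<dots> \<le> energy h p"
    unfolding energy_def
  proof (rule nn_integral_mono)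
    fix r
    show "ennreal (\<eta> / C / r) * indicator {s..d} r \<le> ennreal (dens h p r) * indicator {0<..<1} r"
      using dens[of r] s d by (auto simp: indicator_def intro!: ennreal_leI)
  qed
  finally show False using j by simp
qed

lemma weighted_derivative_finite:
  assumes fin: "energy h p < \<infinity>"
  shows "(\<integral>\<^sup>+r. ennreal (r ^ n * (p r)\<^sup>2) * indicator {0<..<1} r \<partial>lborel) < \<infinity>"
proof (rule le_less_trans[OF _ fin])
  show "(\<integral>\<^sup>+r. ennreal (r ^ n * (p r)\<^sup>2) * indicator {0<..<1} r \<partial>lborel) \<le> energy h p"
    unfolding energy_def
  proof (rule nn_integral_mono)
    fix r
    have "r ^ n * (p r)\<^sup>2 \<le> dens h p r" if "0 < r"
    proof -
      have "(p r)\<^sup>2 * r ^ n \<le> dens h p r"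
        unfolding dens_def using that U_nonneg by (intro mult_right_mono) auto
      then show ?thesis by (simp add: mult.commute)
    qed
    then show "ennreal (r ^ n * (p r)\<^sup>2) * indicator {0<..<1} r \<le> ennreal (dens h p r) * indicator {0<..<1} r"
      by (auto simp: indicator_def intro!: ennreal_leI)
  qed
qed

lemma borel_measurable_indicator_continuous_Ioo:
  fixes u :: "real \<Rightarrow> real"
  assumes "continuous_on {0<..<1} u"
  shows "(\<lambda>r. indicator {0<..<1} r *\<^sub>R u r) \<in> borel_measurable lebesgue"
proof (rule measurable_completion)
  show "(\<lambda>r. indicator {0<..<1} r *\<^sub>R u r) \<in> borel_measurable lborel"
    using borel_measurable_continuous_on_indicator[OF _ assms] by simp
qed

lemma gap_measurable:
  assumes hc: "continuous_on {0<..1} h" and wd: "weak_deriv1 {0<..<1} h p"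
  shows "(\<lambda>r. ennreal (gap h p r) * indicator {0<..<1} r) \<in> borel_measurable lebesgue"
proof -
  have c: "continuous_on {0<..<1} (\<lambda>r. h r * f1 r / f r)"
    using f_pos by (intro continuous_intros f_cont f1_cont continuous_on_subset[OF hc]) (auto simp: less_imp_neq[symmetric])
  have c2: "continuous_on {0<..<1::real} (\<lambda>r. r ^ n)" by (intro continuous_intros)
  have "(\<lambda>r. (indicator {0<..<1} r *\<^sub>R r ^ n)
      * (indicator {0<..<1} r *\<^sub>R p r - indicator {0<..<1} r *\<^sub>R (h r * f1 r / f r))\<^sup>2) \<in> borel_measurable lebesgue"
    by (intro borel_measurable_times borel_measurable_power borel_measurable_diff weak_deriv1_measurable[OF wd] borel_measurable_indicator_continuous_Ioo[OF c] borel_measurable_indicator_continuous_Ioo[OF c2])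
  from measurable_compose[OF this measurable_ennreal]
  have "(\<lambda>r. ennreal ((indicator {0<..<1} r *\<^sub>R r ^ n)
      * (indicator {0<..<1} r *\<^sub>R p r - indicator {0<..<1} r *\<^sub>R (h r * f1 r / f r))\<^sup>2)) \<in> borel_measurable lebesgue" .
  also have "(\<lambda>r. ennreal ((indicator {0<..<1} r *\<^sub>R r ^ n)
      * (indicator {0<..<1} r *\<^sub>R p r - indicator {0<..<1} r *\<^sub>R (h r * f1 r / f r))\<^sup>2))
    = (\<lambda>r. ennreal (gap h p r) * indicator {0<..<1} r)"
    by (auto simp: gap_def indicator_def fun_eq_iff)
  finally show ?thesis .
qed

lemma dens_f_measurable: "(\<lambda>r. ennreal (dens f f1 r) * indicator {0<..<1} r) \<in> borel_measurable lebesgue"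
proof -
  have c: "continuous_on {0<..<1} (dens f f1)"
    unfolding dens_def by (intro continuous_intros f_cont f1_cont continuous_on_compose2[OF U_cont[of UNIV]]) auto
  from measurable_compose[OF borel_measurable_indicator_continuous_Ioo[OF c] measurable_ennreal]
  have "(\<lambda>r. ennreal (indicator {0<..<1} r *\<^sub>R dens f f1 r)) \<in> borel_measurable lebesgue" .
  also have "(\<lambda>r. ennreal (indicator {0<..<1} r *\<^sub>R dens f f1 r)) = (\<lambda>r. ennreal (dens f f1 r) * indicator {0<..<1} r)"
    by (auto simp: indicator_def fun_eq_iff)
  finally show ?thesis .
qed

text \<open>The local inequality as the inner radius tends to 0 along radii with small boundary
  term. The gap is added on the left rather than obtained as a difference, so that an infinite
  energy of h causes no trouble.\<close>

lemma energy_gap: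
  assumes hc: "continuous_on {0<..1} h" and h_1: "h 1 = 1" and wd: "weak_deriv1 {0<..<1} h p"
  shows "energy f f1 + (\<integral>\<^sup>+r. ennreal (gap h p r) * indicator {0<..<1} r \<partial>lborel) \<le> energy h p"
proof (cases "energy h p < \<infinity>")
  case fin: True
  note fin2 = weighted_derivative_finite[OF fin]
  obtain j where j: "energy h p = ennreal j" "0 \<le> j"
    using fin by (cases "energy h p") auto
  note p2 = weak_deriv1_weighted_L2(1)[OF wd fin2] and p1 = weak_deriv1_weighted_L2(2)[OF wd fin2]
  have P: "(p has_integral (h d - h c)) {c..d}" if "0 < \<delta>" "\<delta> < 1" "\<delta> \<le> c" "c \<le> d" "d \<le> 1" for \<delta> c d
    by (rule weak_deriv1_has_integral_upto_1[OF wd hc p1[OF that(1,2)] that(1,3-5)])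
  have fc: "continuous_on {0<..1} f" by (rule f_cont) simp
  have df: "dens f f1 integrable_on {\<delta>..1}" if "0 < \<delta>" "\<delta> < 1" for \<delta>
    by (rule dens_integrable[OF fc that f_local(1,2)[OF that]], erule (2) f_local(3)[OF that])
  have gh: "gap h p integrable_on {\<delta>..1}" if "0 < \<delta>" "\<delta> < 1" for \<delta>
    by (rule gap_integrable[OF hc that p1[OF that] p2[OF that]], erule (2) P[OF that])
  have dh: "dens h p integrable_on {\<delta>..1}" if "0 < \<delta>" "\<delta> < 1" for \<delta>
    by (rule dens_integrable[OF hc that p1[OF that] p2[OF that]], erule (2) P[OF that])
  have dh_le: "integral {\<delta>..1} (dens h p) \<le> j" if \<delta>: "0 < \<delta>" "\<delta> < 1" for \<delta>
  proof -
    have "ennreal (integral {\<delta>..1} (dens h p)) = (\<integral>\<^sup>+r. ennreal (dens h p r) * indicator {\<delta>..<1} r \<partial>lborel)"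
      by (rule nn_integral_Ico_eq_integral[symmetric, OF dens_nonneg dh[OF \<delta>]]) (use \<delta> in auto)
    also have "\<dots> \<le> energy h p"
      unfolding energy_def using \<delta> by (intro nn_integral_mono mult_left_mono) (auto simp: indicator_def)
    finally show ?thesis using j by simp
  qed
  \<comment> \<open>For fixed d, a good radius \<delta> \<le> d depends on \<eta>. Nonnegativity of
    the integrands allows enlarging [d, 1] to [\<delta>, 1] before using the local
    inequality.\<close>
  have main: "integral {d..1} (\<lambda>r. dens f f1 r + gap h p r) \<le> j" if d: "0 < d" "d < 1" for d
  proof (rule field_le_epsilon)
    fix \<eta> :: real assume \<eta>: "0 < \<eta>"
    obtain \<delta> where \<delta>: "0 < \<delta>" "\<delta> \<le> d" "\<psi> \<delta> * (h \<delta>)\<^sup>2 \<le> \<eta>"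
      by (rule boundary_term_small[OF fin \<eta> d])
    have \<delta>1: "\<delta> < 1" using \<delta> d by simp
    note \<delta>' = \<delta>(1) \<delta>1
    have "integral {d..1} (\<lambda>r. dens f f1 r + gap h p r) \<le> integral {\<delta>..1} (\<lambda>r. dens f f1 r + gap h p r)"
      by (rule integral_subset_le)
        (use \<delta> d in \<open>auto intro!: integrable_add df gh add_nonneg_nonneg dens_nonneg gap_nonneg\<close>)
    also have "\<dots> \<le> integral {\<delta>..1} (dens h p) + \<psi> \<delta> * (h \<delta>)\<^sup>2"
      by (rule local_energy_gap[OF hc h_1 \<delta>' p1[OF \<delta>'] p2[OF \<delta>']], erule (2) P[OF \<delta>'])
    also have "\<dots> \<le> j + \<eta>" using dh_le[OF \<delta>'] \<delta>(3) by linarith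
    finally show "integral {d..1} (\<lambda>r. dens f f1 r + gap h p r) \<le> j + \<eta>" .
  qed
  note gm = gap_measurable[OF hc wd] and fm = dens_f_measurable
  have split: "(\<lambda>r. (ennreal (dens f f1 r) + ennreal (gap h p r)) * indicator {0<..<1} r)
      = (\<lambda>r. ennreal (dens f f1 r) * indicator {0<..<1} r + ennreal (gap h p r) * indicator {0<..<1} r)"
    by (simp add: distrib_right)
  have "energy f f1 + (\<integral>\<^sup>+r. ennreal (gap h p r) * indicator {0<..<1} r \<partial>lborel)
      = (\<integral>\<^sup>+r. (ennreal (dens f f1 r) + ennreal (gap h p r)) * indicator {0<..<1} r \<partial>lborel)"
    unfolding energy_def split nn_integral_completion[of lborel, symmetric]
    by (rule nn_integral_add[OF fm gm, symmetric])
  also have "\<dots> \<le> ennreal j"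
  proof (rule nn_integral_exhaust_Ioo)
    show "(\<lambda>r. (ennreal (dens f f1 r) + ennreal (gap h p r)) * indicator {0<..<1} r) \<in> borel_measurable lebesgue"
      unfolding split using fm gm by (rule borel_measurable_add)
    fix \<delta> :: real assume \<delta>: "0 < \<delta>" "\<delta> < 1"
    have "(\<integral>\<^sup>+r. (ennreal (dens f f1 r) + ennreal (gap h p r)) * indicator {\<delta>..<1} r \<partial>lborel)
        = (\<integral>\<^sup>+r. ennreal (dens f f1 r + gap h p r) * indicator {\<delta>..<1} r \<partial>lborel)"
      by (rule nn_integral_cong) (use \<delta> in \<open>auto simp: indicator_def dens_nonneg gap_nonneg\<close>)
    also have "\<dots> = ennreal (integral {\<delta>..1} (\<lambda>r. dens f f1 r + gap h p r))"
      by (rule nn_integral_Ico_eq_integral)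
        (use \<delta> in \<open>auto intro!: integrable_add df gh add_nonneg_nonneg dens_nonneg gap_nonneg\<close>)
    also have "\<dots> \<le> ennreal j" using main[OF \<delta>] by (rule ennreal_leI)
    finally show "(\<integral>\<^sup>+r. (ennreal (dens f f1 r) + ennreal (gap h p r)) * indicator {\<delta>..<1} r \<partial>lborel) \<le> ennreal j" .
  qed
  finally show ?thesis using j by simp
next
  case False
  then have "energy h p = \<infinity>" by (simp add: not_less top_unique)
  then show ?thesis by simp
qed

text \<open>The linear bound on f absorbs the factor 1 / r^2. Finiteness is what permits cancelling
  the energy of f in the uniqueness argument.\<close>

lemma energy_f_finite: "energy f f1 < \<infinity>"
proof -
  obtain x where "\<forall>y\<in>{0..1}. U y \<le> U x"
    using continuous_attains_sup[OF compact_Icc _ U_cont, of 0 1] by auto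
  then have x: "U y \<le> U x" if "y \<in> {0..1}" for y using that by blast
  define K where "K = C\<^sup>2 + real n * C\<^sup>2 + 2 * U x"
  have le: "dens f f1 r \<le> K" if r: "r \<in> {0<..<1}" for r
  proof -
    have r1: "r \<in> {0<..1}" using r by auto
    have "(f1 r)\<^sup>2 \<le> C\<^sup>2" using f1_pos[OF r1] f1_le(1)[OF r1] by (intro power_mono) auto
    moreover have "(f r)\<^sup>2 \<le> (C * r)\<^sup>2" using f_pos[OF r1] f_le[OF r1] by (intro power_mono) auto
    then have "(f r)\<^sup>2 / r\<^sup>2 \<le> C\<^sup>2" using r by (simp add: power_mult_distrib pos_divide_le_eq)
    then have "real n * ((f r)\<^sup>2 / r\<^sup>2) \<le> real n * C\<^sup>2" by (intro mult_left_mono) auto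
    moreover have "U (f r) \<le> U x" using f01[OF r] by (intro x) auto
    ultimately have "(f1 r)\<^sup>2 + real n / r\<^sup>2 * (f r)\<^sup>2 + 2 * U (f r) \<le> K" by (simp add: K_def)
    moreover have "0 \<le> (f1 r)\<^sup>2 + real n / r\<^sup>2 * (f r)\<^sup>2 + 2 * U (f r)"
      using U_nonneg by (intro add_nonneg_nonneg) auto
    ultimately have "dens f f1 r \<le> K * 1"
      unfolding dens_def using r by (intro mult_mono power_le_one) auto
    then show ?thesis by simp
  qed
  have "energy f f1 \<le> (\<integral>\<^sup>+r. ennreal K * indicator {0<..<1::real} r \<partial>lborel)"
    unfolding energy_def using le by (intro nn_integral_mono) (auto simp: indicator_def intro!: ennreal_leI)
  also have "\<dots> = ennreal K" by (subst nn_integral_cmult_indicator) auto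
  finally show ?thesis by (simp add: le_less_trans)
qed

text \<open>Vanishing gap means p = h f' / f almost everywhere, so the product rule gives h / f the
  derivative 0; being 1 at r = 1, the quotient is 1 throughout.\<close>

lemma zero_gap_eq:
  assumes hc: "continuous_on {0<..1} h" and h_1: "h 1 = 1" and wd: "weak_deriv1 {0<..<1} h p"
    and fin: "energy h p < \<infinity>"
    and gap0: "AE r in lborel. r \<in> {0<..<1} \<longrightarrow> gap h p r = 0" and r: "r \<in> {0<..1}"
  shows "h r = f r"
proof (cases "r = 1")
  case False
  then have d: "0 < r" "r < 1" using r by auto
  have p: "p absolutely_integrable_on {r..1}"
    by (rule weak_deriv1_weighted_L2(2)[OF wd weighted_derivative_finite[OF fin] d])
  have P: "(p has_integral (h b - h a)) {a..b}" if "r \<le> a" "a \<le> b" "b \<le> 1" for a b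
    by (rule weak_deriv1_has_integral_upto_1[OF wd hc p d(1) that])
  have sub: "{r..1} \<subseteq> {0<..1}" using d by auto
  have fn: "f x \<noteq> 0" if "x \<in> {r..1}" for x using f_pos[of x] that d by auto
  define v' where "v' x = - (f1 x / (f x)\<^sup>2)" for x
  have v'c: "continuous_on {r..1} v'"
    unfolding v'_def using fn by (intro continuous_intros f_cont f1_cont sub) auto
  have V: "(v' has_integral (inverse (f b) - inverse (f a))) {a..b}" if "r \<le> a" "a \<le> b" "b \<le> 1" for a b
  proof (rule fundamental_theorem_of_calculus[OF that(2)])
    fix x assume "x \<in> {a..b}"
    then have x: "x \<in> {0<..1}" "{a..b} \<subseteq> {0..1}" using that d by auto
    have "f x \<noteq> 0" using f_pos[OF x(1)] by simp
    then have "((\<lambda>x. inverse (f x)) has_real_derivative v' x) (at x within {a..b})"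
      using DERIV_subset[OF F[OF x(1)] x(2)]
      by (auto intro!: derivative_eq_intros simp: v'_def power2_eq_square divide_simps)
    then show "((\<lambda>x. inverse (f x)) has_vector_derivative v' x) (at x within {a..b})"
      by (simp add: has_real_derivative_iff_has_vector_derivative)
  qed
  have ic: "continuous_on {r..1} (\<lambda>x. inverse (f x))"
    using fn by (intro continuous_intros f_cont sub) auto
  have hcr: "continuous_on {r..1} h" by (rule continuous_on_subset[OF hc sub])
  have "r \<le> 1" using d by simp
  have I: "((\<lambda>x. p x * inverse (f x) + h x * v' x) has_integral (h 1 * inverse (f 1) - h r * inverse (f r))) {r..1}"
    by (rule absolutely_continuous_product(2)[where u = h and v = "\<lambda>x. inverse (f x)"],
        fact, erule (2) P, erule (2) V, fact p, rule absolutely_integrable_continuous_real[OF v'c], fact hcr, fact ic)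
  have "AE x in lborel. x \<noteq> (1::real)" by (rule AE_lborel_singleton)
  with gap0 have "AE x in lborel. x \<in> {r..1} \<longrightarrow> p x * inverse (f x) + h x * v' x = 0"
  proof eventually_elim
    case (elim x)
    show ?case
    proof
      assume x: "x \<in> {r..1}"
      then have "x \<in> {0<..<1}" using elim d by auto
      then have "p x = h x * f1 x / f x" using elim by (simp add: gap_def)
      then show "p x * inverse (f x) + h x * v' x = 0"
        using fn[OF x] by (simp add: v'_def field_simps power2_eq_square)
    qed
  qed
  then have "((\<lambda>x. p x * inverse (f x) + h x * v' x) has_integral (h 1 * inverse (f 1) - h r * inverse (f r))) {r..1}
      = ((\<lambda>x. 0) has_integral (h 1 * inverse (f 1) - h r * inverse (f r))) {r..1}"
    by (rule has_integral_AE)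
  with I have "((\<lambda>x. 0) has_integral (h 1 * inverse (f 1) - h r * inverse (f r))) {r..1}" by simp
  then have "h 1 * inverse (f 1) - h r * inverse (f r) = 0" by (rule has_integral_unique) simp
  then show ?thesis using f_pos[OF r] h_1 f_1 by (simp add: field_simps)
qed (use h_1 f_1 in simp)

lemma energy_minimal:
  assumes "continuous_on {0<..1} h" "h 1 = 1" "weak_deriv1 {0<..<1} h p"
  shows "energy f f1 \<le> energy h p"
proof -
  have "energy f f1 + 0 \<le> energy f f1 + (\<integral>\<^sup>+r. ennreal (gap h p r) * indicator {0<..<1} r \<partial>lborel)"
    by (intro add_left_mono) simp
  also have "\<dots> \<le> energy h p" by (rule energy_gap[OF assms])
  finally show ?thesis by simp
qed

text \<open>Together with \<open>energy_gap\<close>, the assumption leaves no room for a gap: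
  cancelling the finite energy of f makes its integral 0.\<close>

lemma energy_unique_minimizer:
  assumes hc: "continuous_on {0<..1} h" and h_1: "h 1 = 1" and wd: "weak_deriv1 {0<..<1} h p"
    and le: "energy h p \<le> energy f f1" and r: "r \<in> {0<..1}"
  shows "h r = f r"
proof (rule zero_gap_eq[OF hc h_1 wd _ _ r])
  show "energy h p < \<infinity>" using le energy_f_finite by (rule le_less_trans)
  let ?G = "\<integral>\<^sup>+r. ennreal (gap h p r) * indicator {0<..<1} r \<partial>lborel"
  obtain j where j: "energy f f1 = ennreal j" "0 \<le> j"
    using energy_f_finite by (cases "energy f f1") auto
  have "energy f f1 + ?G \<le> energy f f1 + 0"
    using order_trans[OF energy_gap[OF hc h_1 wd] le] by simp
  then have "?G = 0"
    unfolding j(1) by (simp add: ennreal_add_left_cancel_le)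
  then have "(\<integral>\<^sup>+r. ennreal (gap h p r) * indicator {0<..<1} r \<partial>lebesgue) = 0"
    by (simp add: nn_integral_completion)
  then have "AE r in lebesgue. ennreal (gap h p r) * indicator {0<..<1} r = 0"
    by (subst (asm) nn_integral_0_iff_AE[OF gap_measurable[OF hc wd]])
  then have "AE r in lborel. ennreal (gap h p r) * indicator {0<..<1} r = 0"
    by (simp only: AE_completion_iff)
  then show "AE r in lborel. r \<in> {0<..<1} \<longrightarrow> gap h p r = 0"
  proof eventually_elim
    case (elim r)
    then show ?case using gap_nonneg[of r h p] by (auto simp: ennreal_eq_0_iff)
  qed
qed

end

section \<open>The Ginzburg-Landau profile\<close>

text \<open>The one-sided derivative at the endpoint 1 is enough at y = 0, because 1 - y^2
  approaches 1 only from below.\<close>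

lemma has_real_derivative_one_minus_square:
  assumes "\<forall>t\<le>1. (V has_real_derivative V' t) (at t within {..1::real})"
  shows "((\<lambda>y. V (1 - y\<^sup>2)) has_real_derivative - (2 * y * V' (1 - y\<^sup>2))) (at y)"
proof -
  have g: "((\<lambda>y. 1 - y\<^sup>2) has_real_derivative - (2 * y)) (at y within UNIV)"
    by (auto intro!: derivative_eq_intros)
  have "(V has_real_derivative V' (1 - y\<^sup>2)) (at (1 - y\<^sup>2) within range (\<lambda>y. 1 - y\<^sup>2))"
    by (rule DERIV_subset[where s = "{..1}"]) (use assms in auto)
  from DERIV_image_chain[OF this g] show ?thesis by (simp add: o_def mult.commute)
qed

lemma has_real_derivative_within_atMost:
  assumes "\<forall>t\<le>1. (V has_real_derivative V' t) (at t within {..1::real})" "t < 1"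
  shows "(V has_real_derivative V' t) (at t)"
proof -
  have "at t within {..1} = at t within UNIV"
    by (rule at_within_nhd[of t "{..<1}"]) (use assms(2) in auto)
  then show ?thesis using assms(1)[rule_format, of t] assms(2) by simp
qed

section \<open>From W to the abstract potential, and assembly\<close>

context
  fixes n :: nat and W W' W'' :: "real \<Rightarrow> real" and \<epsilon> :: real
  assumes n: "1 \<le> n" and \<epsilon>: "0 < \<epsilon>"
    and W_d1: "\<forall>t\<le>1. (W has_real_derivative W' t) (at t within {..1})"
    and W_d2: "\<forall>t\<le>1. (W' has_real_derivative W'' t) (at t within {..1})"
    and W_c2: "continuous_on {..1} W''"
    and W0: "W 0 = 0" and W_nonneg: "\<forall>t\<le>1. W t \<ge> 0"
begin

definition "pot_q y = W' (1 - y\<^sup>2) / \<epsilon>\<^sup>2"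
definition "pot_q' y = - (2 * y * W'' (1 - y\<^sup>2)) / \<epsilon>\<^sup>2"
definition "pot_U y = W (1 - y\<^sup>2) / (2 * \<epsilon>\<^sup>2)"

lemma W'_0: "W' 0 = 0"
proof (rule DERIV_local_min)
  show "(W has_real_derivative W' 0) (at 0)"
    by (rule has_real_derivative_within_atMost[OF W_d1]) simp
  show "\<forall>y. \<bar>0 - y\<bar> < 1 \<longrightarrow> W 0 \<le> W y"
    using W0 W_nonneg by auto
qed simp

lemma potential: "GL_potential n pot_q pot_q' pot_U"
proof
  fix y
  show "(pot_q has_real_derivative pot_q' y) (at y)"
    unfolding pot_q_def[abs_def] pot_q'_def
    by (rule DERIV_cdivide[OF has_real_derivative_one_minus_square[OF W_d2]])
  have "(pot_U has_real_derivative - (2 * y * W' (1 - y\<^sup>2)) / (2 * \<epsilon>\<^sup>2)) (at y)"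
    unfolding pot_U_def[abs_def]
    by (rule DERIV_cdivide[OF has_real_derivative_one_minus_square[OF W_d1]])
  then show "(pot_U has_real_derivative - (pot_q y * y)) (at y)"
    by (simp add: pot_q_def mult.commute)
  show "continuous_on UNIV pot_q'"
    unfolding pot_q'_def using \<epsilon>
    by (intro continuous_intros continuous_on_compose2[OF W_c2]) auto
qed (use n W'_0 in \<open>simp_all add: pot_q_def pot_U_def\<close>)

text \<open>Continuity of W'' supplies its sign at the excluded point 0. So W' is nondecreasing, and
  1 - y^2 decreases for y \<ge> 0.\<close>

lemma convex_potential:
  assumes W''_nonneg: "\<forall>t\<le>1. t \<noteq> 0 \<longrightarrow> W'' t \<ge> 0"
  shows "GL_convex_potential n pot_q pot_q' pot_U"
proof (intro GL_convex_potential.intro potential GL_convex_potential_axioms.intro)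
  have W''0: "0 \<le> W'' 0"
  proof (rule tendsto_lowerbound)
    have "(W'' \<longlongrightarrow> W'' 0) (at 0 within {..1})"
      using W_c2 by (auto simp: continuous_on_def)
    moreover have "at (0::real) within {..1} = at 0 within UNIV"
      by (rule at_within_nhd[of 0 "{..<1}"]) auto
    ultimately show "(W'' \<longlongrightarrow> W'' 0) (at 0)" by simp
    show "\<forall>\<^sub>F t in at 0. 0 \<le> W'' t"
      unfolding eventually_at using W''_nonneg by (intro exI[of _ 1]) (auto simp: dist_real_def)
  qed simp
  fix x y :: real assume xy: "0 \<le> x" "x \<le> y"
  have "W' (1 - y\<^sup>2) \<le> W' (1 - x\<^sup>2)"
  proof (rule DERIV_nonneg_imp_increasing_open[where f = W'])
    show "1 - y\<^sup>2 \<le> 1 - x\<^sup>2" using xy by (simp add: power_mono)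
    fix t assume t: "1 - y\<^sup>2 < t" "t < 1 - x\<^sup>2"
    moreover have "1 - x\<^sup>2 \<le> 1" by simp
    ultimately have "t < 1" by linarith
    then have "(W' has_real_derivative W'' t) (at t)"
      by (rule has_real_derivative_within_atMost[OF W_d2])
    moreover have "0 \<le> W'' t" using W''_nonneg W''0 \<open>t < 1\<close> by (cases "t = 0") auto
    ultimately show "\<exists>d. (W' has_real_derivative d) (at t) \<and> 0 \<le> d" by blast
  next
    have "continuous_on {..1} W'" by (rule DERIV_continuous_on) (use W_d2 in auto)
    then show "continuous_on {1 - y\<^sup>2..1 - x\<^sup>2} W'"
      by (rule continuous_on_subset) (auto intro: order_trans)
  qed
  then show "pot_q y \<le> pot_q x" unfolding pot_q_def by (intro divide_right_mono) auto
qed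

lemma GL_solution_iff_solves:
  "GL_solution (Suc n) W' \<epsilon> h \<longleftrightarrow>
    continuous_on {0<..1} h \<and> h 1 = 1 \<and> (\<exists>h1 h2. GL_potential.solves n pot_q h h1 h2)"
  unfolding GL_solution_def GL_potential.solves_def[OF potential] pot_q_def by simp

text \<open>Membership in \<open>B_GL\<close> guarantees that the choice inside \<open>I_GL\<close>
  is a weak derivative; nothing more is known about the chosen p.\<close>

lemma I_GL_eq:
  assumes h: "h \<in> B_GL (Suc n)"
  obtains p where "weak_deriv1 {0<..<1} h p"
    "I_GL (Suc n) W \<epsilon> h = ennreal (1/2) *
      (\<integral>\<^sup>+r. ennreal (((p r)\<^sup>2 + real n / r\<^sup>2 * (h r)\<^sup>2 + 2 * pot_U (h r)) * r ^ n) * indicator {0<..<1} r \<partial>lborel)"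
proof
  define p where "p = (SOME g. weak_deriv1 {0<..<1} h g)"
  show "weak_deriv1 {0<..<1} h p"
  proof -
    obtain f' where "weak_deriv1 {0<..<1} h f'" using h unfolding B_GL_def by blast
    then show ?thesis unfolding p_def by (rule someI[where P = "weak_deriv1 {0<..<1} h"])
  qed
  show "I_GL (Suc n) W \<epsilon> h = ennreal (1/2) *
      (\<integral>\<^sup>+r. ennreal (((p r)\<^sup>2 + real n / r\<^sup>2 * (h r)\<^sup>2 + 2 * pot_U (h r)) * r ^ n) * indicator {0<..<1} r \<partial>lborel)"
    unfolding I_GL_def Let_def p_def[symmetric] by (simp add: pot_U_def)
qed

lemma GL_profile_exists:
  assumes N: "CARD('n::finite) = Suc n"
  shows "\<exists>f. GL_solution (Suc n) W' \<epsilon> f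
      \<and> (\<exists>g. C2_on {0..1} g \<and> (\<forall>r\<in>{0<..1}. g r = f r / r))
      \<and> (\<forall>r\<in>{0<..<1}. 0 < f r \<and> f r < 1)
      \<and> f 0 = 0
      \<and> ((\<forall>t\<le>1. t \<noteq> 0 \<longrightarrow> W'' t \<ge> 0) \<longrightarrow>
           (\<forall>r\<in>{0<..1}. \<exists>d>0. (f has_real_derivative d) (at r within {0..1}))
         \<and> H1_vec (ball 0 1) (\<lambda>x::real^'n. (f (norm x) / norm x) *\<^sub>R x)
         \<and> (\<forall>h. GL_solution (Suc n) W' \<epsilon> h
                 \<and> H1_vec (ball 0 1) (\<lambda>x::real^'n. (h (norm x) / norm x) *\<^sub>R x)
                 \<longrightarrow> (\<forall>r\<in>{0<..1}. h r = f r))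
         \<and> f \<in> B_GL (Suc n) \<and> (\<forall>h\<in>B_GL (Suc n). I_GL (Suc n) W \<epsilon> f \<le> I_GL (Suc n) W \<epsilon> h)
         \<and> (\<forall>h\<in>B_GL (Suc n). (\<forall>k\<in>B_GL (Suc n). I_GL (Suc n) W \<epsilon> h \<le> I_GL (Suc n) W \<epsilon> k)
                 \<longrightarrow> (\<forall>r\<in>{0<..1}. h r = f r)))"
    (is "\<exists>f. ?sol f \<and> ?smooth f \<and> ?bounds f \<and> ?zero f \<and> (?W_convex \<longrightarrow> ?convex_part f)")
proof -
  interpret GL_potential n pot_q pot_q' pot_U by (rule potential)
  obtain g k s where g: "\<And>r. r \<in> {0..1} \<Longrightarrow> (g has_real_derivative r * k r) (at r within {0..1})"
    and g2: "\<And>r. r \<in> {0..1} \<Longrightarrow> ((\<lambda>r. r * k r) has_real_derivative s r) (at r within {0..1})"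
    and kc: "continuous_on {0..1} k" and sc: "continuous_on {0..1} s"
    and eq: "\<And>r. r \<in> {0..1} \<Longrightarrow> r * s r + real (n + 2) * (r * k r) = - (pot_q (r * g r) * (r * g r))"
    and gpos: "\<And>r. r \<in> {0..1} \<Longrightarrow> 0 < g r" and glt: "\<And>r. r \<in> {0<..<1} \<Longrightarrow> r * g r < 1" and g_1: "g 1 = 1"
    by (rule shooting) blast
  define f where "f r = r * g r" for r
  define f1 where "f1 r = g r + r * (r * k r)" for r
  define f2 where "f2 r = 2 * (r * k r) + r * s r" for r
  have gc: "continuous_on {0..1} g" by (rule DERIV_continuous_on[OF g])
  have F: "(f has_real_derivative f1 r) (at r within {0..1})" if r: "r \<in> {0..1}" for r
    unfolding f_def f1_def using DERIV_mult[OF DERIV_ident g[OF r]] by (simp add: mult.commute)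
  have F1: "(f1 has_real_derivative f2 r) (at r within {0..1})" if r: "r \<in> {0..1}" for r
    unfolding f1_def f2_def
    using DERIV_add[OF g[OF r] DERIV_mult[OF DERIV_ident g2[OF r]]] by (simp add: algebra_simps)
  have f_eq: "f2 r + real n / r * f1 r - real n / r\<^sup>2 * f r = - (pot_q (f r) * f r)" if r: "r \<in> {0<..1}" for r
  proof -
    have "f2 r + real n / r * f1 r - real n / r\<^sup>2 * f r = r * s r + real (n + 2) * (r * k r)"
      using r by (simp add: f_def f1_def f2_def field_simps power2_eq_square)
    then show ?thesis using eq[of r] r by (simp add: f_def)
  qed
  have f_1: "f 1 = 1" by (simp add: f_def g_1)
  have f01: "0 < f r \<and> f r < 1" if "r \<in> {0<..<1}" for r
    using gpos[of r] glt[of r] that by (simp add: f_def)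
  have f_at: "(f has_real_derivative f1 r) (at r)" "(f1 has_real_derivative f2 r) (at r)" if "r \<in> {0<..<1}" for r
    using F[of r] F1[of r] that by (simp_all add: at_within_Icc_at)
  have fsol: "solves f f1 f2" unfolding solves_def using f_at f_eq by auto
  have fc: "continuous_on {0<..1} f"
    unfolding f_def by (intro continuous_intros continuous_on_subset[OF gc]) auto
  have f1c: "continuous_on {0..1} f1" unfolding f1_def by (intro continuous_intros gc kc)
  have f1c': "continuous_on {0<..<1} f1" by (rule continuous_on_subset[OF f1c]) auto
  have "C2_on {0..1} g"
    unfolding C2_on_def using g g2 sc by (intro exI[of _ "\<lambda>r. r * k r"] exI[of _ s]) auto
  then have C2: "\<exists>g. C2_on {0..1} g \<and> (\<forall>r\<in>{0<..1}. g r = f r / r)"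
    by (intro exI[of _ g]) (simp add: f_def)
  have sol: "GL_solution (Suc n) W' \<epsilon> f"
    unfolding GL_solution_iff_solves using fc f_1 fsol by blast
  have convex: "?convex_part f"
    if W''_nonneg: "\<forall>t\<le>1. t \<noteq> 0 \<longrightarrow> W'' t \<ge> 0"
  proof -
    obtain m where m: "m \<in> {0..1}" "\<forall>r\<in>{0..1}. g m \<le> g r"
      using continuous_attains_inf[OF compact_Icc _ gc] by auto
    obtain M where M: "M \<in> {0..1}" "\<forall>r\<in>{0..1}. g r \<le> g M"
      using continuous_attains_sup[OF compact_Icc _ gc] by auto
    obtain K where K: "K \<in> {0..1}" "\<forall>r\<in>{0..1}. \<bar>k r\<bar> \<le> \<bar>k K\<bar>"
      using continuous_attains_sup[OF compact_Icc _ continuous_on_rabs[OF kc]] by auto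
    \<comment> \<open>B bounds f1. With the minimum g m of g one has f1 \<le> (B / g m) g, which
      after multiplication by r is the bound on r f1 by C f; the summand B in C covers f1 \<le> C
      and f \<le> C r.\<close>
    define B where "B = g M + \<bar>k K\<bar>"
    define C where "C = B + B / g m"
    have gm: "0 < g m" and B: "0 < B" using gpos[OF m(1)] gpos[OF M(1)] by (auto simp: B_def)
    then have CB: "B \<le> C" "B / g m \<le> C" "0 < C" by (auto simp: C_def add_pos_pos)
    have f1B: "f1 r \<le> B" if r: "r \<in> {0..1}" for r
    proof -
      have "r * (r * k r) \<le> 1 * (1 * \<bar>k K\<bar>)"
      proof (rule order_trans[OF abs_ge_self])
        have "\<bar>r\<bar> * (\<bar>r\<bar> * \<bar>k r\<bar>) \<le> 1 * (1 * \<bar>k K\<bar>)"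
          using r K(2) by (intro mult_mono) auto
        then show "\<bar>r * (r * k r)\<bar> \<le> 1 * (1 * \<bar>k K\<bar>)" by (simp add: abs_mult)
      qed
      with M(2) r show ?thesis unfolding f1_def B_def by (intro add_mono) auto
    qed
    interpret cv: GL_convex_potential n pot_q pot_q' pot_U by (rule convex_potential[OF W''_nonneg])
    interpret pr: GL_profile n pot_q pot_q' pot_U f f1 f2 C
    proof
      fix r :: real assume r: "r \<in> {0<..1}"
      then have r': "r \<in> {0..1}" by auto
      show "(f has_real_derivative f1 r) (at r within {0..1})" "(f1 has_real_derivative f2 r) (at r within {0..1})"
        using F F1 r' by auto
      show "f2 r + real n / r * f1 r - real n / r\<^sup>2 * f r = - (pot_q (f r) * f r)" by (rule f_eq[OF r])
      have "g r \<le> C" using M(2) r' CB(1) by (force simp: B_def)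
      then show "f r \<le> C * r" using r by (simp add: f_def mult.commute)
      show "f1 r \<le> C" using f1B[OF r'] CB by simp
      have "f1 r \<le> B / g m * g m" using f1B[OF r'] gm by simp
      also have "\<dots> \<le> C * g r" using CB gm m(2) r' by (intro mult_mono) auto
      finally have "r * f1 r \<le> r * (C * g r)" using r by (intro mult_left_mono) auto
      then show "r * f1 r \<le> C * f r" by (simp add: f_def algebra_simps)
    qed (use f_1 f01 CB W_nonneg in \<open>auto simp: pot_U_def\<close>)
    have c1: "\<forall>r\<in>{0<..1}. \<exists>d>0. (f has_real_derivative d) (at r within {0..1})"
      using pr.f1_pos pr.F by blast
    have c2: "H1_vec (ball 0 1) (\<lambda>x::real^'n. (f (norm x) / norm x) *\<^sub>R x)"
      by (rule H1_vec_radial[OF g kc]) (simp_all add: f_def)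
    have c3: "h r = f r"
      if h: "GL_solution (Suc n) W' \<epsilon> h" "H1_vec (ball 0 1) (\<lambda>x::real^'n. (h (norm x) / norm x) *\<^sub>R x)"
        and r: "r \<in> {0<..1}" for h r
    proof -
      obtain h1 h2 where hs: "solves h h1 h2" and hc: "continuous_on {0<..1} h" and h_1: "h 1 = 1"
        using h(1) unfolding GL_solution_iff_solves by blast
      \<comment> \<open>A solution exceeding 1 in modulus somewhere grows at least like s^(-n) at
        the origin, which membership in H1 excludes through square integrability.\<close>
      have hbd: "\<bar>h r\<bar> \<le> 1" if r: "0 < r" "r < 1" for r
      proof (rule ccontr)
        assume "\<not> \<bar>h r\<bar> \<le> 1"
        then have "1 < \<bar>h r\<bar>" by simp
        then obtain c \<delta> where c: "0 < c" "0 < \<delta>" "\<delta> < 1" "\<And>s. 0 < s \<Longrightarrow> s < \<delta> \<Longrightarrow> c \<le> s ^ n * \<bar>h s\<bar>"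
          using cv.unbounded_solution_singular[OF hs hc h_1 r] by blast
        show False by (rule H1_vec_radial_not_singular[OF h(2) N n c])
      qed
      show "h r = f r"
        by (rule cv.bounded_solution_unique[OF fsol hs fc hc f_1 h_1 _ hbd]) (use f01 r in force)+
    qed
    have fB: "f \<in> B_GL (Suc n)"
    proof -
      have n2: "(real (Suc n) - 1) / 2 = real n / 2" by simp
      have pc: "continuous_on {0..1} (\<lambda>r::real. r powr (real n / 2))"
        using n by (intro continuous_on_powr' continuous_intros) auto
      have L1: "L2_on {0<..<1} (\<lambda>r. r powr ((real (Suc n) - 1) / 2) * f1 r)"
        unfolding n2 by (rule L2_on_continuous[of "{0..1}"]) (auto intro!: continuous_intros pc f1c)
      have "L2_on {0<..<1} (\<lambda>r. r powr (real n / 2) * g r)"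
        by (rule L2_on_continuous[of "{0..1}"]) (auto intro!: continuous_intros pc gc)
      \<comment> \<open>The factor r in f = r g raises the exponent (N - 3) / 2 to n / 2 > 0, so the
        weighted function is continuous up to 0.\<close>
      then have L2: "L2_on {0<..<1} (\<lambda>r. r powr ((real (Suc n) - 3) / 2) * f r)"
      proof (rule iffD2[OF L2_on_cong, rotated])
        fix r :: real assume r: "r \<in> {0<..<1}"
        have "r powr (real n / 2) = r powr ((real (Suc n) - 3) / 2 + 1)" by (simp add: field_simps)
        also have "\<dots> = r powr ((real (Suc n) - 3) / 2) * r" using r by (simp add: powr_add)
        finally show "r powr ((real (Suc n) - 3) / 2) * f r = r powr (real n / 2) * g r"
          by (simp add: f_def)
      qed
      have "weak_deriv1 {0<..<1} f f1"
        by (rule weak_deriv1_C1) (use f_at(1) f1c' in auto)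
      with L1 L2 fc f_1 show ?thesis unfolding B_GL_def by blast
    qed
    have energy: "\<exists>p. weak_deriv1 {0<..<1} h p \<and> I_GL (Suc n) W \<epsilon> h = ennreal (1/2) * pr.energy h p"
      if h: "h \<in> B_GL (Suc n)" for h
      unfolding pr.energy_def pr.dens_def by (rule I_GL_eq[OF h], rule exI, rule conjI)
    have If: "I_GL (Suc n) W \<epsilon> f = ennreal (1/2) * pr.energy f f1"
    proof -
      obtain p where p: "weak_deriv1 {0<..<1} f p" "I_GL (Suc n) W \<epsilon> f = ennreal (1/2) * pr.energy f p"
        using energy[OF fB] by blast
      \<comment> \<open>The chosen weak derivative agrees with f1 only almost everywhere, which is
        enough for the integral.\<close>
      have "AE r in lborel. r \<in> {0<..<1} \<longrightarrow> p r = f1 r"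
        by (rule weak_deriv1_AE_eq[OF p(1) f_at(1) f1c'])
      then have "pr.energy f p = pr.energy f f1"
        unfolding pr.energy_def pr.dens_def
        by (intro nn_integral_cong_AE) (auto elim!: eventually_mono simp: indicator_def)
      with p(2) show ?thesis by simp
    qed
    have c4: "I_GL (Suc n) W \<epsilon> f \<le> I_GL (Suc n) W \<epsilon> h" if h: "h \<in> B_GL (Suc n)" for h
    proof -
      obtain p where p: "weak_deriv1 {0<..<1} h p" "I_GL (Suc n) W \<epsilon> h = ennreal (1/2) * pr.energy h p"
        using energy[OF h] by blast
      have "pr.energy f f1 \<le> pr.energy h p"
        by (rule pr.energy_minimal[OF _ _ p(1)]) (use h in \<open>auto simp: B_GL_def\<close>)
      then show ?thesis unfolding If p(2) by (rule mult_left_mono) simp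
    qed
    have c5: "h r = f r"
      if h: "h \<in> B_GL (Suc n)" and min: "\<forall>k\<in>B_GL (Suc n). I_GL (Suc n) W \<epsilon> h \<le> I_GL (Suc n) W \<epsilon> k"
        and r: "r \<in> {0<..1}" for h r
    proof -
      obtain p where p: "weak_deriv1 {0<..<1} h p" "I_GL (Suc n) W \<epsilon> h = ennreal (1/2) * pr.energy h p"
        using energy[OF h] by blast
      have half: "2 * (ennreal (1/2) * x) = x" for x :: ennreal
      proof -
        have "2 * ennreal (1/2) = ennreal (2 * (1/2))" by (subst ennreal_mult) auto
        then show ?thesis by (simp add: mult.assoc[symmetric])
      qed
      have "ennreal (1/2) * pr.energy h p \<le> ennreal (1/2) * pr.energy f f1"
        using min fB If p(2) by auto
      then have "2 * (ennreal (1/2) * pr.energy h p) \<le> 2 * (ennreal (1/2) * pr.energy f f1)"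
        by (rule mult_left_mono) simp
      then have "pr.energy h p \<le> pr.energy f f1" unfolding half .
      then show ?thesis
        by (rule pr.energy_unique_minimizer[OF _ _ p(1) _ r, rotated 2]) (use h in \<open>auto simp: B_GL_def\<close>)
    qed
    show ?thesis
    proof (intro conjI)
      show "\<forall>h. GL_solution (Suc n) W' \<epsilon> h
          \<and> H1_vec (ball 0 1) (\<lambda>x::real^'n. (h (norm x) / norm x) *\<^sub>R x)
          \<longrightarrow> (\<forall>r\<in>{0<..1}. h r = f r)"
        using c3 by blast
      show "\<forall>h\<in>B_GL (Suc n). I_GL (Suc n) W \<epsilon> f \<le> I_GL (Suc n) W \<epsilon> h"
        using c4 by blast
      show "\<forall>h\<in>B_GL (Suc n). (\<forall>k\<in>B_GL (Suc n). I_GL (Suc n) W \<epsilon> h \<le> I_GL (Suc n) W \<epsilon> k)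
          \<longrightarrow> (\<forall>r\<in>{0<..1}. h r = f r)"
        using c5 by blast
    qed (fact c1 c2 fB)+
  qed
  show ?thesis
    by (rule exI[of _ f], intro conjI impI) (use sol C2 f01 convex in \<open>auto simp: f_def\<close>)
qed

end

theorem theorem2p1:
  fixes N :: nat and W W' W'' :: "real \<Rightarrow> real"
  assumes N_card: "N = CARD('n::finite)"
    and N_ge: "N \<ge> 2"
    and W_d1: "\<forall>t\<le>1. (W has_real_derivative W' t) (at t within {..1})"
    and W_d2: "\<forall>t\<le>1. (W' has_real_derivative W'' t) (at t within {..1})"
    and W_c2: "continuous_on {..1} W''"
    and W0: "W 0 = 0"
    and W_nonneg: "\<forall>t\<le>1. W t \<ge> 0"
  shows "\<forall>\<epsilon>>0. \<exists>f. GL_solution N W' \<epsilon> f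
      \<and> (\<exists>g. C2_on {0..1} g \<and> (\<forall>r\<in>{0<..1}. g r = f r / r))
      \<and> (\<forall>r\<in>{0<..<1}. 0 < f r \<and> f r < 1)
      \<and> f 0 = 0
      \<and> ((\<forall>t\<le>1. t \<noteq> 0 \<longrightarrow> W'' t \<ge> 0) \<longrightarrow>
           (\<forall>r\<in>{0<..1}. \<exists>d>0. (f has_real_derivative d) (at r within {0..1}))
         \<and> H1_vec (ball 0 1) (\<lambda>x::real^'n. (f (norm x) / norm x) *\<^sub>R x)
         \<and> (\<forall>h. GL_solution N W' \<epsilon> h
                 \<and> H1_vec (ball 0 1) (\<lambda>x::real^'n. (h (norm x) / norm x) *\<^sub>R x)
                 \<longrightarrow> (\<forall>r\<in>{0<..1}. h r = f r))
         \<and> f \<in> B_GL N \<and> (\<forall>h\<in>B_GL N. I_GL N W \<epsilon> f \<le> I_GL N W \<epsilon> h)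
         \<and> (\<forall>h\<in>B_GL N. (\<forall>k\<in>B_GL N. I_GL N W \<epsilon> h \<le> I_GL N W \<epsilon> k)
                 \<longrightarrow> (\<forall>r\<in>{0<..1}. h r = f r)))"
proof -
  define n where "n = N - 1"
  have n: "1 \<le> n" "N = Suc n" using N_ge by (auto simp: n_def)
  have card: "CARD('n) = Suc n" using N_card n by simp
  show ?thesis
    unfolding n(2)
    by (intro allI impI) (rule GL_profile_exists[OF n(1) _ W_d1 W_d2 W_c2 W0 W_nonneg card])
qed

end
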